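(* The spaces $(\rho',{\cal BH}^+)$ and $(\rho',{\cal BH}^-)$ have pseudounitary structures that are preserved by the real form $\mathfrak u(2,2)$ of $\mathfrak{gl}(2,\mathbb H_{\mathbb C})$. The invariant pseudounitary structure on ${\cal BH}^+$ can be described as $$\bigl(\phi^{(1)}_{l,m,n},\phi^{(1)}_{l',m',n'}\bigr)_{{\cal BH}^+}=\frac{2l(2l+1)}{2\pi^2}\int_{X\in S^3}\phi^{(1)}_{l,m,n}(X)\cdot\overline{\phi^{(1)}_{l',m',n'}(X)}\,dS,$$ $$\bigl(\phi^{(2)}_{l,m,n},\phi^{(2)}_{l',m',n'}\bigr)_{{\cal BH}^+}=-\frac{2l(2l+1)}{2\pi^2}\int_{X\in S^3}\phi^{(2)}_{l,m,n}(X)\cdot\overline{\phi^{(2)}_{l',m',n'}(X)}\,dS,$$ $$\bigl(\phi^{(\alpha)}_{l,m,n},\phi^{(\alpha')}_{l',m',n'}\bigr)_{{\cal BH}^+}=0\quad\text{if }\alpha\ne\alpha'.$$ This structure descends to a non-degenerate product on ${\cal BH}^+/{\cal I}'_0$. The invariant pseudounitary structures on ${\cal BH}^-$ and ${\cal BH}^-/{\cal I}'_0$ are similar (with $\tilde\phi^{(\alpha)}_{l,m,n}$ in place of $\phi^{(\alpha)}_{l,m,n}$).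
   Context: $\mathbb H_{\mathbb C}=\mathbb C\otimes_{\mathbb R}\mathbb H$ is identified with $2\times2$ complex matrices $Z=\bigl(\begin{smallmatrix} z_{11}&z_{12}\\ z_{21}&z_{22}\end{smallmatrix}\bigr)=z^0e_0+z^1e_1+z^2e_2+z^3e_3$, with $e_0=1$, $e_1=\bigl(\begin{smallmatrix}0&-i\\-i&0\end{smallmatrix}\bigr)$, $e_2=\bigl(\begin{smallmatrix}0&-1\\1&0\end{smallmatrix}\bigr)$, $e_3=\bigl(\begin{smallmatrix}-i&0\\0&i\end{smallmatrix}\bigr)$; $\mathbb H$ is the subset with real $z^j$. $N(Z)=\det Z$. $S^3=\{X\in\mathbb H;N(X)=1\}$ with Euclidean volume element $dS$. For $l=0,\frac12,1,\dots$ and $m,n\in\mathbb Z+l$, $-l\le m,n\le l$, $$t^l_{n\,\underline{m}}(Z)=\frac1{2\pi i}\oint (sz_{11}+z_{21})^{l-m}(sz_{12}+z_{22})^{l+m}s^{-l+n}\,\frac{ds}s$$ (counterclockwise loop around $0$). For $l=0,\frac12,1,\dots$: $\phi^{(1)}_{l,m,n}=t^l_{n\,\underline m}(Z)$, $\tilde\phi^{(1)}_{l,m,n}=t^l_{m\,\underline n}(Z^{-1})$ ($-l\le m,n\le l$), $\phi^{(2)}_{l,m,n}=N(Z)t^{l-1}_{n\,\underline m}(Z)$, $\tilde\phi^{(2)}_{l,m,n}=N(Z)^{-1}t^{l-1}_{m\,\underline n}(Z^{-1})$ ($-l+1\le m,n\le l-1$). ${\cal BH}^+$ (resp. ${\cal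 BH}^-$) is the complex span of all $\phi^{(\alpha)}_{l,m,n}$ (resp. $\tilde\phi^{(\alpha)}_{l,m,n}$), $\alpha=1,2$; these functions form bases. ${\cal I}'_0=\mathbb C$ is the space of constant functions, contained in both. $\mathfrak{gl}(2,\mathbb H_{\mathbb C})$ acts by $\rho'$, obtained by differentiating $(\rho'(h)f)(Z)=f\bigl((aZ+b)(cZ+d)^{-1}\bigr)$, $h^{-1}=\bigl(\begin{smallmatrix}a&b\\ c&d\end{smallmatrix}\bigr)$. $\mathfrak u(2,2)=\bigl\{\bigl(\begin{smallmatrix}A&B\\ B^*&D\end{smallmatrix}\bigr);A,B,D\in\mathbb H_{\mathbb C},A=-A^*,D=-D^*\bigr\}$, $*$ being conjugate transpose. Forms are linear in the first and antilinear in the second argument; invariance means $(\rho'(Y)\phi_1,\phi_2)+(\phi_1,\rho'(Y)\phi_2)=0$ for $Y\in\mathfrak u(2,2)$. "Pseudounitary structure" refers to an invariant indefinite Hermitian form, which here becomes non-degenerate after passing to the quotient by ${\cal I}'_0$.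
   Formalization: The factor -2l(2l+1) in the formula for φ^(2) (and its tilde analogue on BH^-) is replaced by -2l(2l-1): invariance under Y=(0 1;1 0) applied to (tr Z, N(Z)) forces (N,N) = -(tr,tr) = -2, whereas the printed factor gives -6. *)

theory Defs
  imports "HOL-Complex_Analysis.Complex_Analysis" "HOL-Library.Function_Algebras"
begin

text \<open>\<open>$\<close> selects vector and matrix components only; quaternionic matrices are multiplied by \<open>**\<close>
  (the product \<open>*\<close> on vector types is componentwise).\<close>

no_notation fps_nth (infixl "$" 75)

type_synonym hc = "complex^2^2"
type_synonym gl2hc = "complex^(2+2)^(2+2)"

definition adj :: "hc \<Rightarrow> hc" where
  "adj M = (\<chi> i j. cnj (M $ j $ i))"


definition e0 :: hc where "e0 = mat 1"
definition e1 :: hc where "e1 = vector [vector [0, -\<i>], vector [-\<i>, 0]]"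
definition e2 :: hc where "e2 = vector [vector [0, -1], vector [1, 0]]"
definition e3 :: hc where "e3 = vector [vector [-\<i>, 0], vector [0, \<i>]]"

definition quat :: "real^4 \<Rightarrow> hc" where
  "quat x = x$0 *\<^sub>R e0 + x$1 *\<^sub>R e1 + x$2 *\<^sub>R e2 + x$3 *\<^sub>R e3"

definition quaternions :: "hc set" where
  "quaternions = range quat"

definition S3 :: "hc set" where
  "S3 = {X \<in> quaternions. det X = 1}"

text \<open>
  The Euclidean surface measure of the unit sphere of an \<open>n\<close>-dimensional Euclidean space:
  the measure of a Borel set \<open>A\<close> is \<open>n\<close> times the Lebesgue measure of the part of the open
  unit ball lying on the rays through \<open>A\<close>. It is carried by the unit sphere, since \<open>sgn x\<close>
  is \<open>x / norm x\<close> and the origin is a null set.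
\<close>

definition sphere_measure :: "'a::euclidean_space measure" where
  "sphere_measure =
     distr (density lborel (\<lambda>x. of_nat DIM('a) * indicator (ball 0 1) x)) borel sgn"

lemma sgn_borel_measurable:
  "(sgn :: 'a::euclidean_space \<Rightarrow> 'a) \<in> borel_measurable borel"
  unfolding sgn_div_norm by measurable

lemma emeasure_sphere_measure:
  fixes A :: "'a::euclidean_space set"
  assumes "A \<in> sets borel"
  shows "emeasure sphere_measure A = of_nat DIM('a) * emeasure lborel {x \<in> ball 0 1. sgn x \<in> A}"
proof -
  have *: "sgn -` A \<in> sets (borel :: 'a measure)"
    using measurable_sets[OF sgn_borel_measurable assms] by simp
  have "emeasure sphere_measure A = emeasure (density lborel
          (\<lambda>x. of_nat DIM('a) * indicator (ball 0 1) x)) (sgn -` A)"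
    unfolding sphere_measure_def
    by (subst emeasure_distr) (use assms sgn_borel_measurable in auto)
  also have "\<dots> = (\<integral>\<^sup>+x. of_nat DIM('a) * indicator (ball 0 1) x * indicator (sgn -` A) x \<partial>lborel)"
    by (subst emeasure_density) (use * in \<open>auto intro!: borel_measurable_times_ennreal borel_measurable_indicator\<close>)
  also have "\<dots> = (\<integral>\<^sup>+x. of_nat DIM('a) * indicator {x \<in> ball 0 1. sgn x \<in> A} x \<partial>lborel)"
    by (intro nn_integral_cong) (auto simp: indicator_def)
  also have "\<dots> = of_nat DIM('a) * emeasure lborel {x \<in> ball 0 1. sgn x \<in> A}"
  proof (rule nn_integral_cmult_indicator)
    have "{x \<in> ball 0 1. sgn x \<in> A} = ball 0 1 \<inter> sgn -` A" by auto
    then show "{x \<in> ball 0 1. sgn x \<in> A} \<in> sets lborel" using * by auto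
  qed
  finally show ?thesis .
qed

text \<open>
  The coordinates \<open>z\<^sup>j\<close> are the Euclidean ones on the quaternions, so that the determinant is
  the squared norm; \<open>dS\<close> is the surface measure transported to matrices by them.
\<close>

definition dS :: "hc measure" where
  "dS = distr sphere_measure borel quat"

lemma det_quat: "det (quat x) = complex_of_real ((norm x)\<^sup>2)"
proof -
  have "(norm x)\<^sup>2 = (x$0)\<^sup>2 + (x$1)\<^sup>2 + (x$2)\<^sup>2 + (x$3)\<^sup>2"
    using arg_cong[of "4 :: 4" 0 "vec_nth x"]
    unfolding norm_vec_def L2_set_def by (simp add: sum_4 sum_nonneg)
  then show ?thesis
    by (simp add: det_2 quat_def e0_def e1_def e2_def e3_def mat_def power2_eq_square)
       (simp add: scaleR_conv_of_real algebra_simps)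
qed


definition half_nats :: "real set" where
  "half_nats = {real k / 2 | k :: nat. True}"

text \<open>Empty if \<open>l < 0\<close>.\<close>

definition weights :: "real \<Rightarrow> real set" where
  "weights l = {m. m - l \<in> \<int> \<and> -l \<le> m \<and> m \<le> l}"

text \<open>\<open>tcoef l n m\<close> is the function \<open>t\<^sup>l\<close> with first index \<open>n\<close> and second (underlined) index \<open>m\<close>.
  For \<open>m, n \<in> weights l\<close> all floors are of integers, and the first two exponents are
  nonnegative.\<close>

definition tcoef :: "real \<Rightarrow> real \<Rightarrow> real \<Rightarrow> hc \<Rightarrow> complex" where
  "tcoef l n m Z =
     1 / (2 * of_real pi * \<i>) *
     contour_integral (circlepath 0 1)
       (\<lambda>s. (s * Z$1$1 + Z$2$1) ^ nat \<lfloor>l - m\<rfloor> * (s * Z$1$2 + Z$2$2) ^ nat \<lfloor>l + m\<rfloor>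
            * s powi \<lfloor>- l + n\<rfloor> / s)"

text \<open>
  Functions defined on an open set \<open>U\<close> of matrices are represented by their extension by zero;
  \<open>U\<close> is \<open>UNIV\<close> for the polynomial functions and \<open>GL2\<close> for those involving \<open>Z\<^sup>-\<^sup>1\<close>.
\<close>

definition GL2 :: "hc set" where
  "GL2 = {Z. det Z \<noteq> 0}"

definition phi1 :: "real \<Rightarrow> real \<Rightarrow> real \<Rightarrow> hc \<Rightarrow> complex" where
  "phi1 l m n Z = tcoef l n m Z"

definition phi2 :: "real \<Rightarrow> real \<Rightarrow> real \<Rightarrow> hc \<Rightarrow> complex" where
  "phi2 l m n Z = det Z * tcoef (l - 1) n m Z"

definition phi1' :: "real \<Rightarrow> real \<Rightarrow> real \<Rightarrow> hc \<Rightarrow> complex" where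
  "phi1' l m n Z = (if Z \<in> GL2 then tcoef l m n (matrix_inv Z) else 0)"

definition phi2' :: "real \<Rightarrow> real \<Rightarrow> real \<Rightarrow> hc \<Rightarrow> complex" where
  "phi2' l m n Z = (if Z \<in> GL2 then inverse (det Z) * tcoef (l - 1) m n (matrix_inv Z) else 0)"

definition idx1 :: "(real \<times> real \<times> real) set" where
  "idx1 = {(l, m, n). l \<in> half_nats \<and> m \<in> weights l \<and> n \<in> weights l}"

definition idx2 :: "(real \<times> real \<times> real) set" where
  "idx2 = {(l, m, n). l \<in> half_nats \<and> m \<in> weights (l - 1) \<and> n \<in> weights (l - 1)}"

definition cspan :: "(hc \<Rightarrow> complex) set \<Rightarrow> (hc \<Rightarrow> complex) set" where
  "cspan = module.span (\<lambda>(c::complex) f Z. c * f Z)"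

lemma vector_space_functions:
  "vector_space (\<lambda>(c::complex) (f :: hc \<Rightarrow> complex) Z. c * f Z)"
  by unfold_locales (auto simp: algebra_simps)

definition BHplus :: "(hc \<Rightarrow> complex) set" where
  "BHplus = cspan ({phi1 l m n | l m n. (l, m, n) \<in> idx1} \<union>
                   {phi2 l m n | l m n. (l, m, n) \<in> idx2})"

definition BHminus :: "(hc \<Rightarrow> complex) set" where
  "BHminus = cspan ({phi1' l m n | l m n. (l, m, n) \<in> idx1} \<union>
                    {phi2' l m n | l m n. (l, m, n) \<in> idx2})"

definition constants :: "hc set \<Rightarrow> (hc \<Rightarrow> complex) set" where
  "constants U = {\<lambda>Z. if Z \<in> U then c else 0 | c. True}"


definition blk11 :: "gl2hc \<Rightarrow> hc" where "blk11 M = (\<chi> i j. M $ Inl i $ Inl j)"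
definition blk12 :: "gl2hc \<Rightarrow> hc" where "blk12 M = (\<chi> i j. M $ Inl i $ Inr j)"
definition blk21 :: "gl2hc \<Rightarrow> hc" where "blk21 M = (\<chi> i j. M $ Inr i $ Inl j)"
definition blk22 :: "gl2hc \<Rightarrow> hc" where "blk22 M = (\<chi> i j. M $ Inr i $ Inr j)"

definition u22 :: "gl2hc set" where
  "u22 = {Y. blk11 Y = - adj (blk11 Y) \<and> blk22 Y = - adj (blk22 Y) \<and> blk21 Y = adj (blk12 Y)}"

definition rho_group :: "gl2hc \<Rightarrow> (hc \<Rightarrow> complex) \<Rightarrow> hc \<Rightarrow> complex" where
  "rho_group h f Z =
     (let g = matrix_inv h
      in f ((blk11 g ** Z + blk12 g) ** matrix_inv (blk21 g ** Z + blk22 g)))"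

definition mexp :: "gl2hc \<Rightarrow> gl2hc" where
  "mexp A = (\<Sum>k. (1 / fact k) *\<^sub>R (((**) A) ^^ k) (mat 1))"

text \<open>The derivative at \<open>t = 0\<close> of the group action along the one-parameter group of \<open>Y\<close>, for
  functions on the open set \<open>U\<close>. For \<open>Z \<in> U\<close> and small \<open>t\<close> all inverses exist and
  \<open>f\<close> is only evaluated inside \<open>U\<close>.\<close>

definition rho' :: "hc set \<Rightarrow> gl2hc \<Rightarrow> (hc \<Rightarrow> complex) \<Rightarrow> hc \<Rightarrow> complex" where
  "rho' U Y f Z =
     (if Z \<in> U then vector_derivative (\<lambda>t. rho_group (mexp (t *\<^sub>R Y)) f Z) (at 0) else 0)"


type_synonym form = "(hc \<Rightarrow> complex) \<Rightarrow> (hc \<Rightarrow> complex) \<Rightarrow> complex"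

definition rho'_stable :: "hc set \<Rightarrow> (hc \<Rightarrow> complex) set \<Rightarrow> bool" where
  "rho'_stable U V \<longleftrightarrow> (\<forall>Y. \<forall>f\<in>V. rho' U Y f \<in> V)"

text \<open>Antilinearity in the second argument follows from linearity in the first and symmetry.\<close>

definition hermitian_form :: "(hc \<Rightarrow> complex) set \<Rightarrow> form \<Rightarrow> bool" where
  "hermitian_form V B \<longleftrightarrow>
     (\<forall>a b. \<forall>f\<in>V. \<forall>g\<in>V. \<forall>h\<in>V. B (\<lambda>Z. a * f Z + b * g Z) h = a * B f h + b * B g h) \<and>
     (\<forall>f\<in>V. \<forall>g\<in>V. B g f = cnj (B f g))"

definition indefinite_form :: "(hc \<Rightarrow> complex) set \<Rightarrow> form \<Rightarrow> bool" where
  "indefinite_form V B \<longleftrightarrow> (\<exists>f\<in>V. Re (B f f) > 0) \<and> (\<exists>f\<in>V. Re (B f f) < 0)"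

definition u22_invariant :: "hc set \<Rightarrow> (hc \<Rightarrow> complex) set \<Rightarrow> form \<Rightarrow> bool" where
  "u22_invariant U V B \<longleftrightarrow>
     (\<forall>Y\<in>u22. \<forall>f\<in>V. \<forall>g\<in>V. B (rho' U Y f) g + B f (rho' U Y g) = 0)"

definition coset_rel ::
    "(hc \<Rightarrow> complex) set \<Rightarrow> (hc \<Rightarrow> complex) set \<Rightarrow> ((hc \<Rightarrow> complex) \<times> (hc \<Rightarrow> complex)) set" where
  "coset_rel V W = {(f, g). f \<in> V \<and> g \<in> V \<and> (\<lambda>Z. f Z - g Z) \<in> W}"

text \<open>The form induces a non-degenerate form \<open>q\<close> on the quotient \<open>V / W\<close>, whose elements are the
  classes of \<open>coset_rel V W\<close> and whose zero is \<open>W\<close> itself.\<close>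

definition descends_nondegenerate ::
    "(hc \<Rightarrow> complex) set \<Rightarrow> (hc \<Rightarrow> complex) set \<Rightarrow> form \<Rightarrow> bool" where
  "descends_nondegenerate V W B \<longleftrightarrow> W \<subseteq> V \<and>
     (\<exists>q. (\<forall>f\<in>V. \<forall>g\<in>V. q (coset_rel V W `` {f}) (coset_rel V W `` {g}) = B f g) \<and>
          (\<forall>C \<in> V // coset_rel V W. (\<forall>D \<in> V // coset_rel V W. q C D = 0) \<longrightarrow> C = W))"

text \<open>Stability of \<open>V\<close> and of the constants under the whole Lie algebra makes \<open>V\<close> and the quotient by
  the constants representations. The form induced on the quotient is given by representatives,
  so it inherits symmetry, indefiniteness and invariance.\<close>

definition pseudounitary :: "hc set \<Rightarrow> (hc \<Rightarrow> complex) set \<Rightarrow> form \<Rightarrow> bool" where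
  "pseudounitary U V B \<longleftrightarrow>
     rho'_stable U V \<and> rho'_stable U (constants U) \<and>
     hermitian_form V B \<and> indefinite_form V B \<and> u22_invariant U V B \<and>
     descends_nondegenerate V (constants U) B"

end

theory Submission
  imports Defs
begin

text \<open>
  Let \<open>\<Delta> = \<partial>\<^sub>1\<^sub>1 \<partial>\<^sub>2\<^sub>2 - \<partial>\<^sub>1\<^sub>2 \<partial>\<^sub>2\<^sub>1\<close>, let \<open>E\<close> be the Euler operator and \<open>N = det\<close>, acting on polynomials in the four
  matrix entries. The invariant form has a description that does not mention the basis: with the
  Fischer forms \<open>\<langle>f, g\<rangle>\<close>, in which the sum of \<open>w |\<alpha>| * \<alpha>! * f\<^sub>\<alpha> * cnj g\<^sub>\<alpha>\<close> over all exponents \<open>\<alpha>\<close>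
  is taken with a weight \<open>w\<close> depending on the degree, it is
  \<open>\<langle>f, g\<rangle>\<close> for the weight \<open>1 / (d - 1)!\<close> minus \<open>\<langle>\<Delta> f, \<Delta> g\<rangle>\<close> for the weight \<open>1 / (d + 1)!\<close>
  (\<open>bform\<close>; the first weight is \<open>0\<close> in degree \<open>0\<close>, so that constants are null vectors).

  Invariance. In a Fischer form, multiplication by an entry and differentiation by it are adjoint up
  to a shift of the weight. The infinitesimal action is a combination of the derivations \<open>\<partial>\<^sub>p\<close>, of the fields
  of left and right multiplication, and of quadratic fields \<open>K\<^sub>p\<close> (\<open>lie_eq\<close>). The linear fields have linear
  fields as adjoints, and \<open>K\<^sub>p\<close> is adjoint to \<open>\<partial>\<^sub>p\<close> on biharmonic polynomials (\<open>bform_conf_op\<close>): each of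
  the two Fischer forms violates this, but by the same term. The equations of u(2,2) pair off these
  adjoints (\<open>bform_u22\<close>).

  The space. A polynomial is harmonic if and only if \<open>\<alpha>! * f\<^sub>\<alpha>\<close> depends on the row and column sums of \<open>\<alpha>\<close> only,
  and the function \<open>t\<^sup>l\<close> is, up to a factor, the sum of \<open>Z\<^sup>\<alpha> / \<alpha>!\<close> over all \<open>\<alpha>\<close> with given
  row and column sums. Together with \<open>\<Delta> (N k) = (E + 2) k\<close> for harmonic \<open>k\<close> this identifies \<open>BHplus\<close> with
  the space of all biharmonic polynomials (\<open>BHplus_eq\<close>), whose stability is a commutator computation.

  Non-degeneracy. The product of \<open>f\<close> with \<open>N k\<close>, \<open>k\<close> harmonic, is minus the Fischer product of \<open>\<Delta> f\<close> with
  \<open>(E + 1) k\<close>. If \<open>f\<close> is in the radical, the choice \<open>k = \<Delta> f\<close> shows that \<open>f\<close> is harmonic, and the product of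
  \<open>f\<close> with itself then shows that it is constant (\<open>bform_radical\<close>).

  Integrals. The measure \<open>dS\<close> is invariant under left multiplication by unit quaternions. The
  infinitesimal form of this is an integration by parts formula (\<open>sph_ent_mult\<close>), and induction on the degree
  shows that for harmonic polynomials the integral of \<open>f * cnj g\<close> over the sphere is \<open>2 \<pi>\<^sup>2\<close> times the Fischer form
  with weight \<open>1 / (d + 1)!\<close> (\<open>sph_harmonic\<close>). Comparing weights gives the factors \<open>2 l (2 l + 1)\<close> and
  \<open>- 2 l (2 l - 1)\<close>.

  Finally, \<open>BHminus\<close> is the pullback of \<open>BHplus\<close> along matrix inversion. Inversion exchanges the
  two rows and the two columns of blocks in the Lie algebra, an operation under which u(2,2) is stable, and it preserves
  \<open>dS\<close>; so the form and all its properties are transported.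
\<close>

section \<open>Polynomial functions of the matrix entries\<close>

definition ent :: "hc \<Rightarrow> 2 \<times> 2 \<Rightarrow> complex" where
  "ent Z p = Z $ fst p $ snd p"

definition unit_matrix :: "2 \<times> 2 \<Rightarrow> complex \<Rightarrow> hc" where
  "unit_matrix p w = (\<chi> i j. if (i, j) = p then w else 0)"

definition pdiff :: "2 \<times> 2 \<Rightarrow> (hc \<Rightarrow> complex) \<Rightarrow> hc \<Rightarrow> complex" where
  "pdiff p f Z = deriv (\<lambda>w. f (Z + unit_matrix p w)) 0"

inductive_set polys :: "(hc \<Rightarrow> complex) set" where
  polys_const [intro, simp]: "(\<lambda>Z. c) \<in> polys"
| polys_ent [intro, simp]: "(\<lambda>Z. ent Z p) \<in> polys"
| polys_add [intro, simp]: "f \<in> polys \<Longrightarrow> g \<in> polys \<Longrightarrow> (\<lambda>Z. f Z + g Z) \<in> polys"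
| polys_mult [intro, simp]: "f \<in> polys \<Longrightarrow> g \<in> polys \<Longrightarrow> (\<lambda>Z. f Z * g Z) \<in> polys"

lemma polys_uminus [intro, simp]: "f \<in> polys \<Longrightarrow> (\<lambda>Z. - f Z) \<in> polys"
  using polys_mult[OF polys_const[of "-1"]] by simp

lemma polys_diff [intro, simp]: "f \<in> polys \<Longrightarrow> g \<in> polys \<Longrightarrow> (\<lambda>Z. f Z - g Z) \<in> polys"
  using polys_add[OF _ polys_uminus] by simp

lemma polys_sum [intro, simp]: "(\<And>x. x \<in> A \<Longrightarrow> f x \<in> polys) \<Longrightarrow> (\<lambda>Z. \<Sum>x\<in>A. f x Z) \<in> polys"
  by (induction A rule: infinite_finite_induct) auto

lemma polys_prod [intro, simp]: "(\<And>x. x \<in> A \<Longrightarrow> f x \<in> polys) \<Longrightarrow> (\<lambda>Z. \<Prod>x\<in>A. f x Z) \<in> polys"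
  by (induction A rule: infinite_finite_induct) auto

lemma polys_power [intro, simp]: "f \<in> polys \<Longrightarrow> (\<lambda>Z. f Z ^ n) \<in> polys"
  by (induction n) auto

lemma ent_add [simp]: "ent (X + Y) p = ent X p + ent Y p"
  by (simp add: ent_def)

lemma ent_unit_matrix [simp]: "ent (unit_matrix p w) q = (if q = p then w else 0)"
  by (auto simp: ent_def unit_matrix_def)

lemma unit_matrix_0 [simp]: "unit_matrix p 0 = 0"
  by (auto simp: unit_matrix_def vec_eq_iff)

lemma polys_differentiable_along:
  "f \<in> polys \<Longrightarrow> (\<lambda>w. f (Z + unit_matrix p w)) field_differentiable at a"
proof (induction rule: polys.induct)
  case (polys_ent q)
  show ?case by (cases "q = p") (auto intro!: field_differentiable_add)
qed (auto intro: field_differentiable_add field_differentiable_mult)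

lemma pdiff_has_field_derivative:
  "f \<in> polys \<Longrightarrow> ((\<lambda>w. f (Z + unit_matrix p w)) has_field_derivative pdiff p f Z) (at 0)"
  unfolding pdiff_def by (intro DERIV_deriv_iff_field_differentiable[THEN iffD2] polys_differentiable_along)

lemma pdiff_eqI:
  "(\<And>Z. ((\<lambda>w. f (Z + unit_matrix p w)) has_field_derivative f' Z) (at 0)) \<Longrightarrow> pdiff p f = f'"
  unfolding pdiff_def by (intro ext DERIV_imp_deriv)

lemma pdiff_const [simp]: "pdiff p (\<lambda>Z. c) = (\<lambda>Z. 0)"
  by (rule pdiff_eqI) auto

lemma pdiff_ent: "pdiff p (\<lambda>Z. ent Z q) = (\<lambda>Z. if p = q then 1 else 0)"
  by (rule pdiff_eqI) (auto intro!: derivative_eq_intros)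

lemma pdiff_add [simp]:
  "f \<in> polys \<Longrightarrow> g \<in> polys \<Longrightarrow> pdiff p (\<lambda>Z. f Z + g Z) = (\<lambda>Z. pdiff p f Z + pdiff p g Z)"
  by (rule pdiff_eqI) (auto intro!: derivative_eq_intros pdiff_has_field_derivative)

lemma pdiff_mult [simp]:
  "f \<in> polys \<Longrightarrow> g \<in> polys \<Longrightarrow> pdiff p (\<lambda>Z. f Z * g Z) = (\<lambda>Z. pdiff p f Z * g Z + f Z * pdiff p g Z)"
  by (rule pdiff_eqI) (auto intro!: derivative_eq_intros pdiff_has_field_derivative)

lemma pdiff_uminus [simp]: "f \<in> polys \<Longrightarrow> pdiff p (\<lambda>Z. - f Z) = (\<lambda>Z. - pdiff p f Z)"
  by (rule pdiff_eqI) (auto intro!: derivative_eq_intros pdiff_has_field_derivative)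

lemma pdiff_diff [simp]:
  "f \<in> polys \<Longrightarrow> g \<in> polys \<Longrightarrow> pdiff p (\<lambda>Z. f Z - g Z) = (\<lambda>Z. pdiff p f Z - pdiff p g Z)"
  by (rule pdiff_eqI) (auto intro!: derivative_eq_intros pdiff_has_field_derivative)

lemma pdiff_polys [intro, simp]: "f \<in> polys \<Longrightarrow> pdiff p f \<in> polys"
  by (induction rule: polys.induct) (auto simp: pdiff_ent)

lemma pdiff_sum [simp]: "(\<And>x. x \<in> A \<Longrightarrow> f x \<in> polys) \<Longrightarrow>
    pdiff p (\<lambda>Z. \<Sum>x\<in>A. f x Z) = (\<lambda>Z. \<Sum>x\<in>A. pdiff p (f x) Z)"
proof (induction A rule: infinite_finite_induct)
  case (insert x A)
  have "pdiff p (\<lambda>Z. f x Z + (\<Sum>x\<in>A. f x Z)) = (\<lambda>Z. pdiff p (f x) Z + pdiff p (\<lambda>Z. \<Sum>x\<in>A. f x Z) Z)"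
    by (rule pdiff_add) (use insert.prems in auto)
  then show ?case using insert by simp
qed auto

lemma pdiff_commute: "f \<in> polys \<Longrightarrow> pdiff p (pdiff q f) = pdiff q (pdiff p f)"
  by (induction rule: polys.induct) (auto simp: pdiff_ent algebra_simps)

lemma sum_entries: "(\<Sum>p\<in>UNIV. f p) = f (1,1) + f (1,2) + f (2,1) + f (2,2)"
  for f :: "2 \<times> 2 \<Rightarrow> 'a::comm_monoid_add"
proof -
  have "(UNIV :: (2 \<times> 2) set) = {(1,1), (1,2), (2,1), (2,2)}"
    by (auto simp: UNIV_2 simp flip: UNIV_Times_UNIV)
  then have "sum f UNIV = sum f {(1,1), (1,2), (2,1), (2,2)}" by (rule arg_cong)
  then show ?thesis by (simp add: add.assoc)
qed

lemma forall_entries: "(\<forall>p :: 2 \<times> 2. P p) \<longleftrightarrow> P (1,1) \<and> P (1,2) \<and> P (2,1) \<and> P (2,2)"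
  by (metis (full_types) exhaust_2 surj_pair)

text \<open>The chain rule for a curve whose entries are differentiable; induction on the polynomial
  makes derivatives of functions on the space of matrices unnecessary.\<close>

lemma polys_has_vector_derivative:
  assumes "f \<in> polys"
    and "\<And>p. ((\<lambda>t. ent (\<gamma> t) p) has_vector_derivative v p) (at t0 within S)"
  shows "((\<lambda>t. f (\<gamma> t)) has_vector_derivative (\<Sum>p\<in>UNIV. v p * pdiff p f (\<gamma> t0))) (at t0 within S)"
  using assms(1)
proof (induction rule: polys.induct)
  case (polys_ent p)
  show ?case using assms(2)[of p] by (simp add: pdiff_ent if_distrib cong: if_cong)
next
  case (polys_mult f g)
  show ?case
    using has_vector_derivative_mult[OF polys_mult.IH] polys_mult.hyps
    by (simp add: sum_distrib_left sum_distrib_right sum.distrib algebra_simps)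
next
  case (polys_add f g)
  show ?case
    using has_vector_derivative_add[OF polys_add.IH] polys_add.hyps
    by (simp add: sum_distrib_left sum_distrib_right sum.distrib algebra_simps)
qed simp

definition laplacian :: "(hc \<Rightarrow> complex) \<Rightarrow> hc \<Rightarrow> complex" where
  "laplacian f = (\<lambda>Z. pdiff (1,1) (pdiff (2,2) f) Z - pdiff (1,2) (pdiff (2,1) f) Z)"

definition euler :: "(hc \<Rightarrow> complex) \<Rightarrow> hc \<Rightarrow> complex" where
  "euler f = (\<lambda>Z. \<Sum>p\<in>UNIV. ent Z p * pdiff p f Z)"

text \<open>The entry that shares neither row nor column with \<open>p\<close>, and the sign of their product in the
  determinant.\<close>

definition opp :: "2 \<times> 2 \<Rightarrow> 2 \<times> 2" where
  "opp p = (if fst p = 1 then 2 else 1, if snd p = 1 then 2 else 1)"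

definition sg :: "2 \<times> 2 \<Rightarrow> complex" where
  "sg p = (if fst p = snd p then 1 else -1)"

lemma opp_sg_simps [simp]:
  "opp (1,1) = (2,2)" "opp (1,2) = (2,1)" "opp (2,1) = (1,2)" "opp (2,2) = (1,1)"
  "sg (1,1) = 1" "sg (2,2) = 1" "sg (1,2) = -1" "sg (2,1) = -1"
  by (auto simp: opp_def sg_def)

lemma det_ent: "det Z = ent Z (1,1) * ent Z (2,2) - ent Z (1,2) * ent Z (2,1)"
  by (simp add: ent_def det_2)

lemma det_polys [simp, intro]: "(\<lambda>Z. det Z) \<in> polys"
  unfolding det_ent by auto

lemma pdiff_det: "pdiff p (\<lambda>Z. det Z) = (\<lambda>Z. sg p * ent Z (opp p))"
proof -
  have "\<forall>p. pdiff p (\<lambda>Z. det Z) = (\<lambda>Z. sg p * ent Z (opp p))"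
    unfolding forall_entries det_ent by (auto simp: pdiff_ent)
  then show ?thesis by blast
qed

lemma laplacian_polys [simp, intro]: "f \<in> polys \<Longrightarrow> laplacian f \<in> polys"
  and euler_polys [simp, intro]: "f \<in> polys \<Longrightarrow> euler f \<in> polys"
  by (auto simp: laplacian_def euler_def)

lemma pdiff_euler: "f \<in> polys \<Longrightarrow> pdiff p (euler f) = (\<lambda>Z. euler (pdiff p f) Z + pdiff p f Z)"
  by (auto simp: euler_def pdiff_ent sum.distrib if_distrib[of "\<lambda>x. x * _"] cong: if_cong)
     (simp add: pdiff_commute[of f p] add.commute)

lemma laplacian_add [simp]: "f \<in> polys \<Longrightarrow> g \<in> polys \<Longrightarrow>
    laplacian (\<lambda>Z. f Z + g Z) = (\<lambda>Z. laplacian f Z + laplacian g Z)"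
  and laplacian_diff [simp]: "f \<in> polys \<Longrightarrow> g \<in> polys \<Longrightarrow>
    laplacian (\<lambda>Z. f Z - g Z) = (\<lambda>Z. laplacian f Z - laplacian g Z)"
  and laplacian_cmult [simp]: "f \<in> polys \<Longrightarrow> laplacian (\<lambda>Z. c * f Z) = (\<lambda>Z. c * laplacian f Z)"
  and laplacian_const [simp]: "laplacian (\<lambda>Z. c) = (\<lambda>Z. 0)"
  by (auto simp: laplacian_def algebra_simps)

lemma euler_add [simp]: "f \<in> polys \<Longrightarrow> g \<in> polys \<Longrightarrow>
    euler (\<lambda>Z. f Z + g Z) = (\<lambda>Z. euler f Z + euler g Z)"
  and euler_cmult [simp]: "f \<in> polys \<Longrightarrow> euler (\<lambda>Z. c * f Z) = (\<lambda>Z. c * euler f Z)"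
  and euler_diff [simp]: "f \<in> polys \<Longrightarrow> g \<in> polys \<Longrightarrow>
    euler (\<lambda>Z. f Z - g Z) = (\<lambda>Z. euler f Z - euler g Z)"
  and euler_mult: "f \<in> polys \<Longrightarrow> g \<in> polys \<Longrightarrow>
    euler (\<lambda>Z. f Z * g Z) = (\<lambda>Z. euler f Z * g Z + f Z * euler g Z)"
  by (auto simp: euler_def sum_entries algebra_simps)

lemma pdiff_laplacian: "f \<in> polys \<Longrightarrow> pdiff p (laplacian f) = laplacian (pdiff p f)"
  unfolding laplacian_def
  by (simp add: pdiff_commute[of "pdiff (2,2) f" p "(1,1)"] pdiff_commute[of "pdiff (2,1) f" p "(1,2)"] pdiff_commute[of f p "(2,2)"] pdiff_commute[of f p "(2,1)"])

lemma laplacian_euler: "f \<in> polys \<Longrightarrow> laplacian (euler f) = (\<lambda>Z. euler (laplacian f) Z + 2 * laplacian f Z)"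
  by (subst laplacian_def) (simp add: pdiff_euler laplacian_def algebra_simps)

lemma laplacian_ent_mult:
  "f \<in> polys \<Longrightarrow> laplacian (\<lambda>Z. ent Z p * f Z) = (\<lambda>Z. ent Z p * laplacian f Z + sg p * pdiff (opp p) f Z)"
proof -
  assume f: "f \<in> polys"
  have "\<forall>p. laplacian (\<lambda>Z. ent Z p * f Z) = (\<lambda>Z. ent Z p * laplacian f Z + sg p * pdiff (opp p) f Z)"
    unfolding forall_entries laplacian_def using f by (simp add: pdiff_ent algebra_simps)
  then show ?thesis by blast
qed

lemma laplacian_det_mult:
  assumes f: "f \<in> polys"
  shows "laplacian (\<lambda>Z. det Z * f Z) = (\<lambda>Z. det Z * laplacian f Z + euler f Z + 2 * f Z)"
  unfolding laplacian_def euler_def sum_entries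
  by (simp add: f pdiff_det pdiff_ent algebra_simps)

section \<open>Monomial coefficients\<close>

definition monom4 :: "(2 \<times> 2 \<Rightarrow> nat) \<Rightarrow> hc \<Rightarrow> complex" where
  "monom4 \<alpha> Z = (\<Prod>p\<in>UNIV. ent Z p ^ \<alpha> p)"

text \<open>The polynomial function with given coefficients, which are meant to have finite support.\<close>

definition ev :: "((2 \<times> 2 \<Rightarrow> nat) \<Rightarrow> complex) \<Rightarrow> hc \<Rightarrow> complex" where
  "ev c Z = (\<Sum>\<alpha> | c \<alpha> \<noteq> 0. c \<alpha> * monom4 \<alpha> Z)"

definition coeff4 :: "(hc \<Rightarrow> complex) \<Rightarrow> (2 \<times> 2 \<Rightarrow> nat) \<Rightarrow> complex" where
  "coeff4 f = (THE c. finite {\<alpha>. c \<alpha> \<noteq> 0} \<and> f = ev c)"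

lemma monom4_polys [simp, intro]: "monom4 \<alpha> \<in> polys"
proof -
  have "monom4 \<alpha> = (\<lambda>Z. \<Prod>p\<in>UNIV. ent Z p ^ \<alpha> p)" by (auto simp: monom4_def)
  then show ?thesis by auto
qed

lemma ev_polys [simp, intro]: "ev c \<in> polys"
proof -
  have "ev c = (\<lambda>Z. \<Sum>\<alpha> | c \<alpha> \<noteq> 0. c \<alpha> * monom4 \<alpha> Z)" by (auto simp: ev_def)
  then show ?thesis by auto
qed

lemma ev_superset:
  "finite S \<Longrightarrow> {\<alpha>. c \<alpha> \<noteq> 0} \<subseteq> S \<Longrightarrow> ev c Z = (\<Sum>\<alpha>\<in>S. c \<alpha> * monom4 \<alpha> Z)"
  unfolding ev_def by (rule sum.mono_neutral_left) auto

lemma monom4_0 [simp]: "monom4 (\<lambda>_. 0) = (\<lambda>Z. 1)"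
  by (auto simp: monom4_def)

lemma monom4_split: "monom4 \<alpha> Z = ent Z p ^ \<alpha> p * (\<Prod>q\<in>UNIV-{p}. ent Z q ^ \<alpha> q)"
  unfolding monom4_def by (rule prod.remove) auto

lemma monom4_Suc: "monom4 (\<alpha>(p := Suc (\<alpha> p))) Z = ent Z p * monom4 \<alpha> Z"
  by (simp add: monom4_split[of _ _ p])

lemma monom4_add: "monom4 \<alpha> Z * monom4 \<beta> Z = monom4 (\<lambda>p. \<alpha> p + \<beta> p) Z"
  by (simp add: monom4_def power_add prod.distrib)

lemma pdiff_power: "pdiff p (\<lambda>Z. ent Z p ^ k) = (\<lambda>Z. of_nat k * ent Z p ^ (k - 1))"
  by (rule pdiff_eqI) (auto intro!: derivative_eq_intros)

lemma pdiff_monom4: "pdiff p (monom4 \<alpha>) = (\<lambda>Z. of_nat (\<alpha> p) * monom4 (\<alpha>(p := \<alpha> p - 1)) Z)"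
proof -
  have "pdiff p (\<lambda>Z. \<Prod>q\<in>UNIV-{p}. ent Z q ^ \<alpha> q) = (\<lambda>Z. 0)"
  proof (rule pdiff_eqI)
    fix Z
    have "(\<lambda>w. \<Prod>q\<in>UNIV-{p}. ent (Z + unit_matrix p w) q ^ \<alpha> q) = (\<lambda>w. \<Prod>q\<in>UNIV-{p}. ent Z q ^ \<alpha> q)"
      by (intro ext prod.cong) auto
    then show "((\<lambda>w. \<Prod>q\<in>UNIV-{p}. ent (Z + unit_matrix p w) q ^ \<alpha> q) has_field_derivative 0) (at 0)"
      by simp
  qed
  moreover have "monom4 \<alpha> = (\<lambda>Z. ent Z p ^ \<alpha> p * (\<Prod>q\<in>UNIV-{p}. ent Z q ^ \<alpha> q))"
    by (auto simp: monom4_split[of _ _ p])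
  ultimately have "pdiff p (monom4 \<alpha>) = (\<lambda>Z. of_nat (\<alpha> p) * ent Z p ^ (\<alpha> p - 1) * (\<Prod>q\<in>UNIV-{p}. ent Z q ^ \<alpha> q))"
    by (simp add: pdiff_power)
  then show ?thesis by (simp add: monom4_split[of _ _ p] mult.assoc)
qed

lemma ent_mult_ev:
  assumes "finite {\<alpha>. c \<alpha> \<noteq> 0}"
  shows "finite {\<alpha>. (if \<alpha> p = 0 then 0 else c (\<alpha>(p := \<alpha> p - 1))) \<noteq> 0}" (is "finite ?S")
    and "(\<lambda>Z. ent Z p * ev c Z) = ev (\<lambda>\<alpha>. if \<alpha> p = 0 then 0 else c (\<alpha>(p := \<alpha> p - 1)))"
proof -
  have S: "?S = (\<lambda>\<alpha>. \<alpha>(p := Suc (\<alpha> p))) ` {\<alpha>. c \<alpha> \<noteq> 0}" (is "_ = ?h ` _")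
  proof (intro equalityI subsetI)
    fix \<beta> assume "\<beta> \<in> ?S"
    then have "\<beta> p \<noteq> 0" "c (\<beta>(p := \<beta> p - 1)) \<noteq> 0" by (auto split: if_splits)
    then show "\<beta> \<in> ?h ` {\<alpha>. c \<alpha> \<noteq> 0}" by (intro image_eqI[of _ _ "\<beta>(p := \<beta> p - 1)"]) auto
  qed (auto simp: fun_upd_idem)
  then show "finite ?S" using assms by simp
  have inj: "inj_on ?h {\<alpha>. c \<alpha> \<noteq> 0}"
    by (rule inj_on_inverseI[of _ "\<lambda>\<beta>. \<beta>(p := \<beta> p - 1)"]) (auto simp: fun_upd_idem)
  show "(\<lambda>Z. ent Z p * ev c Z) = ev (\<lambda>\<alpha>. if \<alpha> p = 0 then 0 else c (\<alpha>(p := \<alpha> p - 1)))"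
  proof
    fix Z show "ent Z p * ev c Z = ev (\<lambda>\<alpha>. if \<alpha> p = 0 then 0 else c (\<alpha>(p := \<alpha> p - 1))) Z"
      unfolding ev_def[of "\<lambda>\<alpha>. if \<alpha> p = 0 then 0 else c (\<alpha>(p := \<alpha> p - 1))"] S
        sum.reindex[OF inj]
      by (simp add: ev_def sum_distrib_left monom4_Suc mult_ac fun_upd_idem)
  qed
qed

lemma pdiff_ev:
  assumes "finite {\<alpha>. c \<alpha> \<noteq> 0}"
  shows "finite {\<alpha>. of_nat (Suc (\<alpha> p)) * c (\<alpha>(p := Suc (\<alpha> p))) \<noteq> 0}" (is "finite ?S")
    and "pdiff p (ev c) = ev (\<lambda>\<alpha>. of_nat (Suc (\<alpha> p)) * c (\<alpha>(p := Suc (\<alpha> p))))"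
proof -
  let ?h = "\<lambda>\<alpha> :: 2 \<times> 2 \<Rightarrow> nat. \<alpha>(p := \<alpha> p - 1)"
  have S: "?S = ?h ` {\<alpha>. c \<alpha> \<noteq> 0 \<and> \<alpha> p \<noteq> 0}"
  proof (intro equalityI subsetI)
    fix \<beta> assume "\<beta> \<in> ?S"
    then have "c (\<beta>(p := Suc (\<beta> p))) \<noteq> 0" by auto
    then show "\<beta> \<in> ?h ` {\<alpha>. c \<alpha> \<noteq> 0 \<and> \<alpha> p \<noteq> 0}"
      by (intro image_eqI[of _ _ "\<beta>(p := Suc (\<beta> p))"]) auto
  qed (auto simp del: of_nat_Suc)
  then show "finite ?S" using assms by simp
  have inj: "inj_on ?h {\<alpha>. c \<alpha> \<noteq> 0 \<and> \<alpha> p \<noteq> 0}"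
    by (rule inj_on_inverseI[of _ "\<lambda>\<beta>. \<beta>(p := Suc (\<beta> p))"]) auto
  have "pdiff p (ev c) = pdiff p (\<lambda>Z. \<Sum>\<alpha> | c \<alpha> \<noteq> 0. c \<alpha> * monom4 \<alpha> Z)"
    by (rule arg_cong[of _ _ "pdiff p"]) (auto simp: ev_def)
  also have "\<dots> = (\<lambda>Z. \<Sum>\<alpha> | c \<alpha> \<noteq> 0. c \<alpha> * (of_nat (\<alpha> p) * monom4 (\<alpha>(p := \<alpha> p - 1)) Z))"
    by (simp add: pdiff_monom4)
  also have "\<dots> = (\<lambda>Z. \<Sum>\<alpha> | c \<alpha> \<noteq> 0 \<and> \<alpha> p \<noteq> 0. c \<alpha> * (of_nat (\<alpha> p) * monom4 (\<alpha>(p := \<alpha> p - 1)) Z))"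
    by (intro ext sum.mono_neutral_right) (use assms in auto)
  also have "\<dots> = ev (\<lambda>\<alpha>. of_nat (Suc (\<alpha> p)) * c (\<alpha>(p := Suc (\<alpha> p))))"
    unfolding ev_def[of "\<lambda>\<alpha>. of_nat (Suc (\<alpha> p)) * c (\<alpha>(p := Suc (\<alpha> p)))"] S sum.reindex[OF inj]
    by (intro ext sum.cong) (auto simp del: of_nat_Suc)
  finally show "pdiff p (ev c) = ev (\<lambda>\<alpha>. of_nat (Suc (\<alpha> p)) * c (\<alpha>(p := Suc (\<alpha> p))))" .
qed

text \<open>A derivative that lowers an exponent \<open>\<alpha>\<close> step by step to \<open>0\<close> turns the coefficient at \<open>\<alpha>\<close> into
  a nonzero multiple of a constant term, which is the value at the zero matrix.\<close>

lemma ev_eq_0D: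
  assumes "finite {\<alpha>. c \<alpha> \<noteq> 0}" "ev c = (\<lambda>Z. 0)"
  shows "c \<alpha> = 0"
  using assms
proof (induction "\<Sum>p\<in>UNIV. \<alpha> p" arbitrary: \<alpha> c)
  case 0
  then have \<alpha>: "\<alpha> = (\<lambda>_. 0)" by auto
  have "monom4 \<beta> 0 = (if \<beta> = \<alpha> then 1 else 0)" for \<beta>
  proof (cases "\<beta> = \<alpha>")
    case False
    then obtain p where "\<beta> p \<noteq> 0" using \<alpha> by (auto simp: fun_eq_iff)
    then show ?thesis using False by (auto simp: monom4_split[of _ _ p] ent_def)
  qed (simp add: \<alpha>)
  then have "ev c 0 = (\<Sum>\<beta> | c \<beta> \<noteq> 0. if \<beta> = \<alpha> then c \<beta> else 0)"
    unfolding ev_def by (intro sum.cong) auto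
  also have "\<dots> = c \<alpha>" using 0(2) by simp
  finally show ?case using 0(3) by (simp add: fun_eq_iff)
next
  case (Suc n)
  then obtain p where p: "\<alpha> p \<noteq> 0"
    by (metis (mono_tags, lifting) Zero_not_Suc sum.neutral)
  let ?\<beta> = "\<alpha>(p := \<alpha> p - 1)" and ?c = "\<lambda>\<alpha>. of_nat (Suc (\<alpha> p)) * c (\<alpha>(p := Suc (\<alpha> p)))"
  have "(\<Sum>q\<in>UNIV. \<alpha> q) = \<alpha> p + (\<Sum>q\<in>UNIV-{p}. \<alpha> q)"
       "(\<Sum>q\<in>UNIV. ?\<beta> q) = ?\<beta> p + (\<Sum>q\<in>UNIV-{p}. ?\<beta> q)"
    by (rule sum.remove; simp)+
  then have n: "n = (\<Sum>q\<in>UNIV. ?\<beta> q)" using p Suc(2) by simp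
  have "?c ?\<beta> = 0"
  proof (rule Suc.hyps(1)[OF n])
    show "finite {\<alpha>. ?c \<alpha> \<noteq> 0}" using pdiff_ev(1)[OF Suc(3)] .
    show "ev ?c = (\<lambda>Z. 0)" using pdiff_ev(2)[OF Suc(3), of p] Suc(4) by simp
  qed
  then show ?case using p by simp
qed

lemma ev_add:
  assumes "finite {\<alpha>. c \<alpha> \<noteq> 0}" "finite {\<alpha>. d \<alpha> \<noteq> 0}"
  shows "finite {\<alpha>. c \<alpha> + d \<alpha> \<noteq> 0}" "(\<lambda>Z. ev c Z + ev d Z) = ev (\<lambda>\<alpha>. c \<alpha> + d \<alpha>)"
proof -
  let ?S = "{\<alpha>. c \<alpha> \<noteq> 0} \<union> {\<alpha>. d \<alpha> \<noteq> 0}"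
  have S: "finite ?S" "{\<alpha>. c \<alpha> + d \<alpha> \<noteq> 0} \<subseteq> ?S" using assms by auto
  show "finite {\<alpha>. c \<alpha> + d \<alpha> \<noteq> 0}" using finite_subset[OF S(2,1)] .
  show "(\<lambda>Z. ev c Z + ev d Z) = ev (\<lambda>\<alpha>. c \<alpha> + d \<alpha>)"
    using ev_superset[OF S] ev_superset[OF S(1), of c] ev_superset[OF S(1), of d]
    by (auto simp: fun_eq_iff algebra_simps sum.distrib)
qed

lemma ev_cmult:
  assumes "finite {\<alpha>. c \<alpha> \<noteq> 0}"
  shows "finite {\<alpha>. a * c \<alpha> \<noteq> 0}" "(\<lambda>Z. a * ev c Z) = ev (\<lambda>\<alpha>. a * c \<alpha>)"
proof -
  have S: "{\<alpha>. a * c \<alpha> \<noteq> 0} \<subseteq> {\<alpha>. c \<alpha> \<noteq> 0}" by auto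
  show "finite {\<alpha>. a * c \<alpha> \<noteq> 0}" using finite_subset[OF S assms] .
  show "(\<lambda>Z. a * ev c Z) = ev (\<lambda>\<alpha>. a * c \<alpha>)"
    using ev_superset[OF assms S] by (auto simp: ev_def fun_eq_iff sum_distrib_left mult.assoc)
qed

lemma ev_inject:
  assumes "finite {\<alpha>. c \<alpha> \<noteq> 0}" "finite {\<alpha>. d \<alpha> \<noteq> 0}" "ev c = ev d"
  shows "c = d"
proof
  fix \<alpha>
  note m = ev_cmult[OF assms(2), of "-1"]
  note a = ev_add[OF assms(1) m(1)]
  have "ev (\<lambda>\<alpha>. c \<alpha> + - 1 * d \<alpha>) = (\<lambda>Z. 0)"
    unfolding a(2)[symmetric] m(2)[symmetric] assms(3) by simp
  from ev_eq_0D[OF a(1) this, of \<alpha>] show "c \<alpha> = d \<alpha>" by simp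
qed

lemma coeff4_ev: "finite {\<alpha>. c \<alpha> \<noteq> 0} \<Longrightarrow> coeff4 (ev c) = c"
  unfolding coeff4_def
proof (rule the_equality)
  fix d assume c: "finite {\<alpha>. c \<alpha> \<noteq> 0}" and d: "finite {\<alpha>. d \<alpha> \<noteq> 0} \<and> ev c = ev d"
  show "d = c" by (rule ev_inject[OF conjunct1[OF d] c conjunct2[OF d, symmetric]])
qed (rule conjI[OF _ refl])

definition is_ev :: "(hc \<Rightarrow> complex) \<Rightarrow> bool" where
  "is_ev f \<longleftrightarrow> (\<exists>c. finite {\<alpha>. c \<alpha> \<noteq> 0} \<and> f = ev c)"

lemma is_evI: "finite {\<alpha>. c \<alpha> \<noteq> 0} \<Longrightarrow> f = ev c \<Longrightarrow> is_ev f"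
  unfolding is_ev_def by (rule exI[of _ c]) simp

lemma is_evE:
  assumes "is_ev f" obtains c where "finite {\<alpha>. c \<alpha> \<noteq> 0}" "f = ev c"
  using assms unfolding is_ev_def by (elim exE conjE)

lemma is_ev_add:
  assumes "is_ev f" "is_ev g" shows "is_ev (\<lambda>Z. f Z + g Z)"
proof -
  obtain c d where c: "finite {\<alpha>. c \<alpha> \<noteq> 0}" "f = ev c" and d: "finite {\<alpha>. d \<alpha> \<noteq> 0}" "g = ev d"
    using assms by (elim is_evE)
  show ?thesis unfolding c(2) d(2) by (rule is_evI[OF ev_add[OF c(1) d(1)]])
qed

lemma ev_single: "ev (\<lambda>\<beta>. if \<beta> = \<alpha> then a else 0) = (\<lambda>Z. a * monom4 \<alpha> Z)"
proof
  fix Z show "ev (\<lambda>\<beta>. if \<beta> = \<alpha> then a else 0) Z = a * monom4 \<alpha> Z"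
    by (subst ev_superset[of "{\<alpha>}"]) auto
qed

lemma is_ev_monom: "is_ev (\<lambda>Z. a * monom4 \<alpha> Z)"
  by (rule is_evI[of "\<lambda>\<beta>. if \<beta> = \<alpha> then a else 0"]) (simp_all add: ev_single)

lemma is_ev_sum: "(\<And>x. x \<in> A \<Longrightarrow> is_ev (f x)) \<Longrightarrow> is_ev (\<lambda>Z. \<Sum>x\<in>A. f x Z)"
proof (induction A rule: infinite_finite_induct)
  case (infinite A)
  then show ?case using is_ev_monom[of 0] by simp
next
  case empty
  then show ?case using is_ev_monom[of 0] by simp
next
  case (insert x A)
  then show ?case using is_ev_add[of "f x" "\<lambda>Z. \<Sum>x\<in>A. f x Z"] by simp
qed

lemma polys_is_ev: "f \<in> polys \<Longrightarrow> is_ev f"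
proof (induction rule: polys.induct)
  case (polys_const c)
  then show ?case using is_ev_monom[of c "\<lambda>_. 0"] by simp
next
  case (polys_ent p)
  then show ?case using is_ev_monom[of 1 "(\<lambda>_. 0)(p := Suc 0)"] monom4_Suc[of "\<lambda>_. 0" p] by simp
next
  case (polys_add f g)
  then show ?case by (intro is_ev_add)
next
  case (polys_mult f g)
  obtain c d where fg: "f = ev c" "g = ev d" using polys_mult.IH by (elim is_evE)
  have "(\<lambda>Z. f Z * g Z) = (\<lambda>Z. \<Sum>\<alpha> | c \<alpha> \<noteq> 0. \<Sum>\<beta> | d \<beta> \<noteq> 0. (c \<alpha> * d \<beta>) * monom4 (\<lambda>p. \<alpha> p + \<beta> p) Z)"
    by (auto simp: fg ev_def sum_product monom4_add[symmetric] mult_ac)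
  moreover have "is_ev (\<lambda>Z. \<Sum>\<alpha> | c \<alpha> \<noteq> 0. \<Sum>\<beta> | d \<beta> \<noteq> 0. (c \<alpha> * d \<beta>) * monom4 (\<lambda>p. \<alpha> p + \<beta> p) Z)"
    by (intro is_ev_sum is_ev_monom)
  ultimately show ?case by simp
qed

lemma
  assumes "f \<in> polys"
  shows finite_coeff4: "finite {\<alpha>. coeff4 f \<alpha> \<noteq> 0}" and ev_coeff4: "ev (coeff4 f) = f"
proof -
  obtain c where c: "finite {\<alpha>. c \<alpha> \<noteq> 0}" "f = ev c"
    using polys_is_ev[OF assms] by (elim is_evE)
  then show "finite {\<alpha>. coeff4 f \<alpha> \<noteq> 0}" "ev (coeff4 f) = f" using coeff4_ev[OF c(1)] by simp_all
qed

lemma coeff4_eqI: "finite {\<alpha>. c \<alpha> \<noteq> 0} \<Longrightarrow> f = ev c \<Longrightarrow> coeff4 f = c"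
  by (simp only: coeff4_ev)

lemma coeff4_add [simp]: "f \<in> polys \<Longrightarrow> g \<in> polys \<Longrightarrow>
   coeff4 (\<lambda>Z. f Z + g Z) = (\<lambda>\<alpha>. coeff4 f \<alpha> + coeff4 g \<alpha>)"
  by (rule coeff4_eqI)
     (use ev_add[OF finite_coeff4 finite_coeff4, of f g] in \<open>auto simp: ev_coeff4\<close>)

lemma coeff4_cmult [simp]: "f \<in> polys \<Longrightarrow> coeff4 (\<lambda>Z. a * f Z) = (\<lambda>\<alpha>. a * coeff4 f \<alpha>)"
  by (rule coeff4_eqI)
     (use ev_cmult[OF finite_coeff4, of f a] in \<open>auto simp: ev_coeff4\<close>)

lemma coeff4_ent_mult:
  assumes "f \<in> polys"
  shows "coeff4 (\<lambda>Z. ent Z p * f Z) = (\<lambda>\<alpha>. if \<alpha> p = 0 then 0 else coeff4 f (\<alpha>(p := \<alpha> p - 1)))"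
  using ent_mult_ev[OF finite_coeff4[OF assms], of p] unfolding ev_coeff4[OF assms]
  by (rule coeff4_eqI)

lemma coeff4_pdiff:
  assumes "f \<in> polys"
  shows "coeff4 (pdiff p f) = (\<lambda>\<alpha>. of_nat (Suc (\<alpha> p)) * coeff4 f (\<alpha>(p := Suc (\<alpha> p))))"
  using pdiff_ev[OF finite_coeff4[OF assms], of p] unfolding ev_coeff4[OF assms]
  by (rule coeff4_eqI)

lemma coeff4_const: "coeff4 (\<lambda>Z. a) = (\<lambda>\<alpha>. if \<alpha> = (\<lambda>_. 0) then a else 0)"
  by (rule coeff4_eqI) (auto simp: ev_single)

section \<open>Weighted Fischer forms\<close>

definition mdeg :: "(2 \<times> 2 \<Rightarrow> nat) \<Rightarrow> nat" where "mdeg \<alpha> = (\<Sum>p\<in>UNIV. \<alpha> p)"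
definition mfact :: "(2 \<times> 2 \<Rightarrow> nat) \<Rightarrow> real" where "mfact \<alpha> = (\<Prod>p\<in>UNIV. fact (\<alpha> p))"

text \<open>For a constant weight this is the Fischer inner product. As the weight only depends on the
  degree, it rescales that product on each homogeneous component, where different components stay orthogonal.\<close>

definition fischer :: "(nat \<Rightarrow> real) \<Rightarrow> form" where
  "fischer w f g = (\<Sum>\<alpha> | coeff4 f \<alpha> \<noteq> 0.
     of_real (w (mdeg \<alpha>) * mfact \<alpha>) * coeff4 f \<alpha> * cnj (coeff4 g \<alpha>))"

lemma mfact_pos: "mfact \<alpha> > 0"
  by (auto simp: mfact_def intro: prod_pos)

lemma mdeg_Suc: "mdeg (\<alpha>(p := Suc (\<alpha> p))) = Suc (mdeg \<alpha>)"
proof -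
  have "mdeg \<beta> = \<beta> p + (\<Sum>q\<in>UNIV-{p}. \<beta> q)" for \<beta> unfolding mdeg_def by (rule sum.remove) auto
  from this[of \<alpha>] this[of "\<alpha>(p := Suc (\<alpha> p))"] show ?thesis by simp
qed

lemma mfact_Suc: "mfact (\<alpha>(p := Suc (\<alpha> p))) = Suc (\<alpha> p) * mfact \<alpha>"
proof -
  have "mfact \<beta> = fact (\<beta> p) * (\<Prod>q\<in>UNIV-{p}. fact (\<beta> q))" for \<beta> unfolding mfact_def by (rule prod.remove) auto
  from this[of \<alpha>] this[of "\<alpha>(p := Suc (\<alpha> p))"] show ?thesis by (simp add: fact_Suc mult.assoc)
qed

lemma fischer_superset:
  assumes "finite S" "{\<alpha>. coeff4 f \<alpha> \<noteq> 0} \<subseteq> S"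
  shows "fischer w f g = (\<Sum>\<alpha>\<in>S. of_real (w (mdeg \<alpha>) * mfact \<alpha>) * coeff4 f \<alpha> * cnj (coeff4 g \<alpha>))"
  unfolding fischer_def by (rule sum.mono_neutral_left) (use assms in auto)

lemma fischer_sym:
  assumes "f \<in> polys" "g \<in> polys"
  shows "fischer w g f = cnj (fischer w f g)"
proof -
  let ?S = "{\<alpha>. coeff4 f \<alpha> \<noteq> 0} \<union> {\<alpha>. coeff4 g \<alpha> \<noteq> 0}"
  have "finite ?S" using finite_coeff4 assms by simp
  from fischer_superset[OF this, of f w g] fischer_superset[OF this, of g w f]
  show ?thesis by (simp add: mult_ac)
qed

lemma fischer_add_left [simp]:
  assumes "f \<in> polys" "g \<in> polys"
  shows "fischer w (\<lambda>Z. f Z + g Z) h = fischer w f h + fischer w g h"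
proof -
  let ?S = "{\<alpha>. coeff4 f \<alpha> \<noteq> 0} \<union> {\<alpha>. coeff4 g \<alpha> \<noteq> 0}"
  have "finite ?S" using finite_coeff4 assms by simp
  moreover have "{\<alpha>. coeff4 (\<lambda>Z. f Z + g Z) \<alpha> \<noteq> 0} \<subseteq> ?S" using assms by auto
  ultimately show ?thesis
    using fischer_superset[of ?S f w h] fischer_superset[of ?S g w h]
      fischer_superset[of ?S "\<lambda>Z. f Z + g Z" w h] assms
    by (simp add: sum.distrib[symmetric] algebra_simps)
qed

lemma fischer_cmult_left [simp]:
  assumes "f \<in> polys"
  shows "fischer w (\<lambda>Z. a * f Z) h = a * fischer w f h"
proof -
  have "finite {\<alpha>. coeff4 f \<alpha> \<noteq> 0}" using finite_coeff4 assms by simp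
  from fischer_superset[OF this, of f w h] fischer_superset[OF this, of "\<lambda>Z. a * f Z" w h]
  show ?thesis using assms by (auto simp: sum_distrib_left mult_ac)
qed

lemma fischer_add_right [simp]:
  "f \<in> polys \<Longrightarrow> g \<in> polys \<Longrightarrow> h \<in> polys \<Longrightarrow> fischer w h (\<lambda>Z. f Z + g Z) = fischer w h f + fischer w h g"
  by (simp add: fischer_sym[of _ h w])

lemma fischer_cmult_right [simp]:
  "f \<in> polys \<Longrightarrow> h \<in> polys \<Longrightarrow> fischer w h (\<lambda>Z. a * f Z) = cnj a * fischer w h f"
  by (simp add: fischer_sym[of _ h w])

lemma fischer_uminus_left [simp]: "f \<in> polys \<Longrightarrow> fischer w (\<lambda>Z. - f Z) h = - fischer w f h"
  using fischer_cmult_left[of f w "-1" h] by simp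

lemma fischer_uminus_right [simp]:
  "f \<in> polys \<Longrightarrow> h \<in> polys \<Longrightarrow> fischer w h (\<lambda>Z. - f Z) = - fischer w h f"
  using fischer_cmult_right[of f h w "-1"] by simp

lemma fischer_diff_left [simp]:
  "f \<in> polys \<Longrightarrow> g \<in> polys \<Longrightarrow> fischer w (\<lambda>Z. f Z - g Z) h = fischer w f h - fischer w g h"
  using fischer_add_left[of f "\<lambda>Z. - g Z"] by simp

lemma fischer_diff_right [simp]:
  "f \<in> polys \<Longrightarrow> g \<in> polys \<Longrightarrow> h \<in> polys \<Longrightarrow> fischer w h (\<lambda>Z. f Z - g Z) = fischer w h f - fischer w h g"
  using fischer_add_right[of f "\<lambda>Z. - g Z"] by simp

lemma fischer_0_left [simp]: "fischer w (\<lambda>Z. 0) h = 0"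
  using fischer_cmult_left[of "\<lambda>Z. 0" w 0 h] by simp

lemma fischer_0_right [simp]: "fischer w h (\<lambda>Z. 0) = 0"
  by (simp add: fischer_def coeff4_const)

lemma fischer_sum_left [simp]:
  "(\<And>x. x \<in> A \<Longrightarrow> f x \<in> polys) \<Longrightarrow> fischer w (\<lambda>Z. \<Sum>x\<in>A. f x Z) h = (\<Sum>x\<in>A. fischer w (f x) h)"
proof (induction A rule: infinite_finite_induct)
  case (insert x A)
  then show ?case using fischer_add_left[of "f x" "\<lambda>Z. \<Sum>x\<in>A. f x Z" w h] by simp
qed auto

text \<open>Raising the exponent at \<open>p\<close> multiplies \<open>\<alpha>!\<close> by \<open>\<alpha> p + 1\<close>, which is the factor that differentiation
  produces on the other side; only the weight sees that the degree has changed.\<close>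

lemma fischer_ent_mult:
  assumes "f \<in> polys" "g \<in> polys"
  shows "fischer w (\<lambda>Z. ent Z p * f Z) g = fischer (\<lambda>d. w (Suc d)) f (pdiff p g)"
proof -
  let ?h = "\<lambda>\<alpha> :: 2 \<times> 2 \<Rightarrow> nat. \<alpha>(p := Suc (\<alpha> p))"
  have S: "{\<alpha>. coeff4 (\<lambda>Z. ent Z p * f Z) \<alpha> \<noteq> 0} = ?h ` {\<alpha>. coeff4 f \<alpha> \<noteq> 0}"
      unfolding coeff4_ent_mult[OF assms(1)]
  proof (intro equalityI subsetI)
    fix \<beta> assume "\<beta> \<in> {\<alpha>. (if \<alpha> p = 0 then 0 else coeff4 f (\<alpha>(p := \<alpha> p - 1))) \<noteq> 0}"
    then have "\<beta> p \<noteq> 0" "coeff4 f (\<beta>(p := \<beta> p - 1)) \<noteq> 0" by (auto split: if_splits)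
    then show "\<beta> \<in> ?h ` {\<alpha>. coeff4 f \<alpha> \<noteq> 0}" by (intro image_eqI[of _ _ "\<beta>(p := \<beta> p - 1)"]) auto
  qed (auto simp: fun_upd_idem)
  have inj: "inj_on ?h {\<alpha>. coeff4 f \<alpha> \<noteq> 0}"
    by (rule inj_on_inverseI[of _ "\<lambda>\<beta>. \<beta>(p := \<beta> p - 1)"]) (auto simp: fun_upd_idem)
  show ?thesis
    unfolding fischer_def S sum.reindex[OF inj]
    unfolding coeff4_ent_mult[OF assms(1)] coeff4_pdiff[OF assms(2)] o_def
    by (intro sum.cong refl) (simp add: mdeg_Suc mfact_Suc fun_upd_idem mult_ac del: of_nat_Suc)
qed

lemma fischer_pdiff_left:
  "f \<in> polys \<Longrightarrow> g \<in> polys \<Longrightarrow>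
    fischer (\<lambda>d. w (Suc d)) (pdiff p f) g = fischer w f (\<lambda>Z. ent Z p * g Z)"
  by (simp add: fischer_sym[of _ g] fischer_sym[of _ f] fischer_ent_mult)

lemma coeff4_euler:
  assumes "f \<in> polys" shows "coeff4 (euler f) = (\<lambda>\<alpha>. of_nat (mdeg \<alpha>) * coeff4 f \<alpha>)"
proof -
  have e: "coeff4 (\<lambda>Z. ent Z p * pdiff p f Z) = (\<lambda>\<alpha>. of_nat (\<alpha> p) * coeff4 f \<alpha>)" for p
    using assms by (simp add: coeff4_ent_mult coeff4_pdiff fun_eq_iff del: of_nat_Suc)
  show ?thesis unfolding euler_def sum_entries using assms
    by (simp add: e mdeg_def sum_entries algebra_simps)
qed

lemma fischer_euler_left:
  assumes "f \<in> polys"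
  shows "fischer w (euler f) g = fischer (\<lambda>d. real d * w d) f g"
proof -
  have "finite {\<alpha>. coeff4 f \<alpha> \<noteq> 0}" using finite_coeff4 assms by simp
  from fischer_superset[OF this, of f _ g] fischer_superset[OF this, of "euler f" w g]
  show ?thesis using assms by (auto simp: coeff4_euler mult_ac)
qed

lemma fischer_det_mult:
  assumes "f \<in> polys" "g \<in> polys"
  shows "fischer w (\<lambda>Z. det Z * f Z) g = fischer (\<lambda>d. w (Suc (Suc d))) f (laplacian g)"
proof -
  have "(\<lambda>Z. det Z * f Z) = (\<lambda>Z. ent Z (1,1) * (ent Z (2,2) * f Z) - ent Z (1,2) * (ent Z (2,1) * f Z))"
    by (auto simp: det_ent algebra_simps)
  then show ?thesis
    using assms by (simp add: fischer_ent_mult laplacian_def pdiff_commute[of g "(2,2)"] pdiff_commute[of g "(2,1)"])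
qed

lemma fischer_const: "fischer w (\<lambda>Z. a) (\<lambda>Z. c) = of_real (w 0) * a * cnj c"
proof -
  have "fischer w (\<lambda>Z. a) (\<lambda>Z. c) = (\<Sum>\<alpha>\<in>{\<lambda>_. 0}. of_real (w (mdeg \<alpha>) * mfact \<alpha>)
          * coeff4 (\<lambda>Z. a) \<alpha> * cnj (coeff4 (\<lambda>Z. c) \<alpha>))"
    by (rule fischer_superset) (auto simp: coeff4_const split: if_splits)
  then show ?thesis by (simp add: coeff4_const mdeg_def mfact_def)
qed

lemma fischer_weight_add:
  "fischer (\<lambda>d. v d + w d) f g = fischer v f g + fischer w f g"
  by (simp add: fischer_def sum.distrib algebra_simps)

lemma fischer_weight_mult: "fischer (\<lambda>d. a * w d) f g = of_real a * fischer w f g"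
  by (simp add: fischer_def sum_distrib_left mult_ac)

lemma fischer_nonneg:
  assumes "\<And>d. w d \<ge> 0"
  shows "fischer w f f = of_real (\<Sum>\<alpha> | coeff4 f \<alpha> \<noteq> 0. w (mdeg \<alpha>) * mfact \<alpha> * (cmod (coeff4 f \<alpha>))\<^sup>2)"
  unfolding fischer_def of_real_sum
  by (intro sum.cong refl) (simp add: mult.assoc complex_norm_square del: of_real_power)

lemma fischer_self_eq_0D:
  assumes "\<And>d. w d \<ge> 0" "f \<in> polys" "fischer w f f = 0" "w (mdeg \<alpha>) \<noteq> 0"
  shows "coeff4 f \<alpha> = 0"
proof (rule ccontr)
  assume c: "coeff4 f \<alpha> \<noteq> 0"
  have "(\<Sum>\<alpha> | coeff4 f \<alpha> \<noteq> 0. w (mdeg \<alpha>) * mfact \<alpha> * (cmod (coeff4 f \<alpha>))\<^sup>2) = 0"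
    using assms(3) unfolding fischer_nonneg[OF assms(1)] by (simp only: of_real_eq_0_iff)
  then have "w (mdeg \<alpha>) * mfact \<alpha> * (cmod (coeff4 f \<alpha>))\<^sup>2 = 0"
    using finite_coeff4[OF assms(2)] assms(1) c mfact_pos
    by (subst (asm) sum_nonneg_eq_0_iff) (auto intro!: mult_nonneg_nonneg simp: less_imp_le)
  then show False using c assms(4) mfact_pos[of \<alpha>] by simp
qed

section \<open>The form on biharmonic polynomials\<close>

text \<open>\<open>sphere_weight\<close> is the weight for which the Fischer form of harmonic polynomials \<open>f\<close>, \<open>g\<close> is the mean
  of \<open>f * cnj g\<close> over the unit sphere, and \<open>form_weight d\<close> is \<open>d * (d + 1)\<close> times as large.\<close>

definition form_weight :: "nat \<Rightarrow> real" where "form_weight d = (if d = 0 then 0 else 1 / fact (d - 1))"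
definition sphere_weight :: "nat \<Rightarrow> real" where "sphere_weight d = 1 / fact (Suc d)"

lemma weight_simps: "(\<lambda>d. form_weight (Suc (Suc d))) = sphere_weight" "(\<lambda>d. real d * form_weight (Suc d)) = form_weight"
  "(\<lambda>d. real d * sphere_weight (Suc d) + 2 * sphere_weight (Suc d)) = sphere_weight"
proof -
  show "(\<lambda>d. real d * form_weight (Suc d)) = form_weight"
  proof
    fix d show "real d * form_weight (Suc d) = form_weight d" by (cases d) (simp_all add: form_weight_def)
  qed
  show "(\<lambda>d. real d * sphere_weight (Suc d) + 2 * sphere_weight (Suc d)) = sphere_weight"
  proof
    fix d
    have "sphere_weight d = real (d + 2) * sphere_weight (Suc d)"
      by (simp add: sphere_weight_def divide_simps)
    then show "real d * sphere_weight (Suc d) + 2 * sphere_weight (Suc d) = sphere_weight d" by (simp add: algebra_simps)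
  qed
qed (auto simp: form_weight_def sphere_weight_def)

text \<open>If \<open>f = h + N k\<close> with \<open>h\<close>, \<open>k\<close> harmonic and \<open>f\<close> homogeneous of degree \<open>d \<ge> 2\<close>, then \<open>\<Delta> f = d k\<close>, and
  the two terms combine to a positive multiple of the norm of \<open>h\<close> minus a positive multiple of that
  of \<open>k\<close>. In this form the decomposition of \<open>f\<close> does not have to be known.\<close>

definition bform :: form where
  "bform f g = fischer form_weight f g - fischer sphere_weight (laplacian f) (laplacian g)"

definition harmonic :: "(hc \<Rightarrow> complex) set" where
  "harmonic = {f \<in> polys. laplacian f = (\<lambda>Z. 0)}"

definition biharmonic :: "(hc \<Rightarrow> complex) set" where
  "biharmonic = {f \<in> polys. laplacian (laplacian f) = (\<lambda>Z. 0)}"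

lemma bform_add_left [simp]: "f \<in> polys \<Longrightarrow> g \<in> polys \<Longrightarrow> bform (\<lambda>Z. f Z + g Z) h = bform f h + bform g h"
  and bform_cmult_left [simp]: "f \<in> polys \<Longrightarrow> bform (\<lambda>Z. a * f Z) h = a * bform f h"
  and bform_diff_left [simp]: "f \<in> polys \<Longrightarrow> g \<in> polys \<Longrightarrow> bform (\<lambda>Z. f Z - g Z) h = bform f h - bform g h"
  by (simp_all add: bform_def algebra_simps)

lemma bform_sym: "f \<in> polys \<Longrightarrow> g \<in> polys \<Longrightarrow> bform g f = cnj (bform f g)"
  by (simp add: bform_def fischer_sym[of f g] fischer_sym[of "laplacian f" "laplacian g"])

text \<open>The derivative along the vector field \<open>Z \<mapsto> Z C Z\<close>, where \<open>C\<close> is the matrix unit at the position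
  transposed to \<open>p\<close>, written with the Euler operator and the determinant.\<close>

definition conf_op :: "2 \<times> 2 \<Rightarrow> (hc \<Rightarrow> complex) \<Rightarrow> hc \<Rightarrow> complex" where
  "conf_op p f = (\<lambda>Z. ent Z p * euler f Z - sg p * (det Z * pdiff (opp p) f Z))"

text \<open>The derivatives along the fields \<open>Z \<mapsto> A Z\<close> and \<open>Z \<mapsto> Z A\<close> for a matrix unit \<open>A\<close> at the given
  position.\<close>

definition left_op :: "2 \<Rightarrow> 2 \<Rightarrow> (hc \<Rightarrow> complex) \<Rightarrow> hc \<Rightarrow> complex" where
  "left_op i k f = (\<lambda>Z. ent Z (k,1) * pdiff (i,1) f Z + ent Z (k,2) * pdiff (i,2) f Z)"

definition right_op :: "2 \<Rightarrow> 2 \<Rightarrow> (hc \<Rightarrow> complex) \<Rightarrow> hc \<Rightarrow> complex" where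
  "right_op k j f = (\<lambda>Z. ent Z (1,k) * pdiff (1,j) f Z + ent Z (2,k) * pdiff (2,j) f Z)"

lemma conf_op_polys [simp, intro]: "f \<in> polys \<Longrightarrow> conf_op p f \<in> polys"
  and left_op_polys [simp, intro]: "f \<in> polys \<Longrightarrow> left_op i k f \<in> polys"
  and right_op_polys [simp, intro]: "f \<in> polys \<Longrightarrow> right_op i k f \<in> polys"
  by (simp_all add: conf_op_def left_op_def right_op_def)

lemma laplacian_conf_op:
  assumes f: "f \<in> polys"
  shows "laplacian (conf_op p f) = (\<lambda>Z. ent Z p * laplacian (euler f) Z - sg p * pdiff (opp p) f Z
           - sg p * (det Z * pdiff (opp p) (laplacian f) Z))"
  using f by (simp add: conf_op_def laplacian_ent_mult laplacian_det_mult pdiff_euler pdiff_laplacian algebra_simps)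

text \<open>For harmonic \<open>f\<close> the Laplacian of \<open>conf_op p f\<close> is a multiple of a derivative of \<open>f\<close>: it is harmonic, but need not
  vanish. This is why the action lives on biharmonic rather than on harmonic polynomials.\<close>

lemma laplacian_laplacian_conf_op:
  assumes f: "f \<in> biharmonic"
  shows "laplacian (laplacian (conf_op p f)) = (\<lambda>Z. 0)"
proof -
  have f: "f \<in> polys" "laplacian (laplacian f) = (\<lambda>Z. 0)" using f by (auto simp: biharmonic_def)
  have e: "euler (\<lambda>Z. 0) = (\<lambda>Z. 0)" by (simp add: euler_def)
  show ?thesis using f(1)
    by (simp add: laplacian_conf_op laplacian_euler laplacian_ent_mult laplacian_det_mult pdiff_euler
          pdiff_laplacian[symmetric] f(2) e algebra_simps)
qed

lemma pdiff_sort: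
  assumes "f \<in> polys"
  shows "pdiff (1,2) (pdiff (1,1) f) = pdiff (1,1) (pdiff (1,2) f)" "pdiff (2,1) (pdiff (1,1) f) = pdiff (1,1) (pdiff (2,1) f)"
    "pdiff (2,2) (pdiff (1,1) f) = pdiff (1,1) (pdiff (2,2) f)" "pdiff (2,1) (pdiff (1,2) f) = pdiff (1,2) (pdiff (2,1) f)"
    "pdiff (2,2) (pdiff (1,2) f) = pdiff (1,2) (pdiff (2,2) f)" "pdiff (2,2) (pdiff (2,1) f) = pdiff (2,1) (pdiff (2,2) f)"
  using assms by (rule pdiff_commute)+

lemma laplacian_left_op: "f \<in> polys \<Longrightarrow>
    laplacian (left_op i k f) = (\<lambda>Z. left_op i k (laplacian f) Z + (if i = k then laplacian f Z else 0))"
  and laplacian_right_op: "f \<in> polys \<Longrightarrow>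
    laplacian (right_op i k f) = (\<lambda>Z. right_op i k (laplacian f) Z + (if i = k then laplacian f Z else 0))"
proof -
  assume f: "f \<in> polys"
  have "\<forall>p :: 2 \<times> 2. laplacian (left_op (fst p) (snd p) f) = (\<lambda>Z. left_op (fst p) (snd p) (laplacian f) Z
           + (if fst p = snd p then laplacian f Z else 0))"
    unfolding forall_entries
    by (simp add: f left_op_def laplacian_ent_mult pdiff_laplacian) 
       (simp add: laplacian_def f pdiff_sort algebra_simps)
  then show "laplacian (left_op i k f) = (\<lambda>Z. left_op i k (laplacian f) Z + (if i = k then laplacian f Z else 0))"
    by (metis fst_conv snd_conv)
  have "\<forall>p :: 2 \<times> 2. laplacian (right_op (fst p) (snd p) f) = (\<lambda>Z. right_op (fst p) (snd p) (laplacian f) Z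
           + (if fst p = snd p then laplacian f Z else 0))"
    unfolding forall_entries
    by (simp add: f right_op_def laplacian_ent_mult pdiff_laplacian) 
       (simp add: laplacian_def f pdiff_sort algebra_simps)
  then show "laplacian (right_op i k f) = (\<lambda>Z. right_op i k (laplacian f) Z + (if i = k then laplacian f Z else 0))"
    by (metis fst_conv snd_conv)
qed

lemma fischer_left_op: "f \<in> polys \<Longrightarrow> g \<in> polys \<Longrightarrow> fischer w (left_op i k f) g = fischer w f (left_op k i g)"
  by (simp add: left_op_def fischer_ent_mult fischer_pdiff_left)

lemma fischer_right_op: "f \<in> polys \<Longrightarrow> g \<in> polys \<Longrightarrow> fischer w (right_op i k f) g = fischer w f (right_op k i g)"
  by (simp add: right_op_def fischer_ent_mult fischer_pdiff_left)

text \<open>The commutator with the Laplacian is a multiple of the Laplacian, and it enters both sides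
  in the same way.\<close>

lemma bform_left_op: "f \<in> polys \<Longrightarrow> g \<in> polys \<Longrightarrow> bform (left_op i k f) g = bform f (left_op k i g)"
  by (cases "i = k") (simp_all add: bform_def laplacian_left_op fischer_left_op)

lemma bform_right_op: "f \<in> polys \<Longrightarrow> g \<in> polys \<Longrightarrow> bform (right_op i k f) g = bform f (right_op k i g)"
  by (cases "i = k") (simp_all add: bform_def laplacian_right_op fischer_right_op)

text \<open>Either Fischer form on its own fails to satisfy this by the same term, a product of
  \<open>pdiff (opp p) f\<close> with \<open>laplacian g\<close>; it cancels in the difference. The only other obstruction contains
  \<open>laplacian (laplacian g)\<close>.\<close>

lemma bform_conf_op:
  assumes f: "f \<in> polys" and g: "g \<in> biharmonic"
  shows "bform (conf_op p f) g = bform f (pdiff p g)"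
proof -
  have g: "g \<in> polys" "laplacian (laplacian g) = (\<lambda>Z. 0)" using g by (auto simp: biharmonic_def)
  have "fischer form_weight (conf_op p f) g = fischer form_weight f (pdiff p g) - sg p * fischer sphere_weight (pdiff (opp p) f) (laplacian g)"
    using f g(1) by (simp add: conf_op_def fischer_ent_mult fischer_euler_left fischer_det_mult weight_simps)
  moreover have "fischer sphere_weight (laplacian (conf_op p f)) (laplacian g) =
      fischer sphere_weight (laplacian f) (laplacian (pdiff p g)) - sg p * fischer sphere_weight (pdiff (opp p) f) (laplacian g)"
    using f g by (simp add: laplacian_conf_op laplacian_euler fischer_ent_mult fischer_euler_left fischer_det_mult
        pdiff_laplacian fischer_weight_mult[symmetric, of 2, simplified] flip: fischer_weight_add)
      (simp add: weight_simps)
  ultimately show ?thesis by (simp add: bform_def)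
qed

lemma bform_pdiff:
  assumes "f \<in> biharmonic" "g \<in> polys"
  shows "bform (pdiff p f) g = bform f (conf_op p g)"
proof -
  have f: "f \<in> polys" using assms by (auto simp: biharmonic_def)
  have "bform (pdiff p f) g = cnj (bform g (pdiff p f))" by (rule bform_sym) (use f assms in auto)
  also have "\<dots> = cnj (bform (conf_op p g) f)" by (simp add: bform_conf_op[OF assms(2,1)])
  also have "\<dots> = bform f (conf_op p g)" by (rule bform_sym[symmetric]) (use f assms in auto)
  finally show ?thesis .
qed

lemma bform_det_mult:
  assumes f: "f \<in> polys" and k: "k \<in> harmonic"
  shows "bform f (\<lambda>Z. det Z * k Z) = - fischer (\<lambda>d. real (Suc d) * sphere_weight d) (laplacian f) k"
proof -
  have k: "k \<in> polys" "laplacian k = (\<lambda>Z. 0)" using k by (auto simp: harmonic_def)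
  have "fischer form_weight f (\<lambda>Z. det Z * k Z) = cnj (fischer form_weight (\<lambda>Z. det Z * k Z) f)"
    by (rule fischer_sym) (use f k in auto)
  also have "\<dots> = cnj (fischer sphere_weight k (laplacian f))" using f k by (simp add: fischer_det_mult weight_simps)
  also have "\<dots> = fischer sphere_weight (laplacian f) k" using fischer_sym[of k "laplacian f" sphere_weight] f k by simp
  finally have 1: "fischer form_weight f (\<lambda>Z. det Z * k Z) = fischer sphere_weight (laplacian f) k" .
  have "fischer sphere_weight (laplacian f) (euler k) = cnj (fischer sphere_weight (euler k) (laplacian f))"
    by (rule fischer_sym) (use f k in auto)
  also have "\<dots> = fischer (\<lambda>d. real d * sphere_weight d) (laplacian f) k"
    using fischer_sym[of k "laplacian f"] f k by (simp add: fischer_euler_left)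
  finally have 2: "fischer sphere_weight (laplacian f) (euler k) = fischer (\<lambda>d. real d * sphere_weight d) (laplacian f) k" .
  have 3: "fischer (\<lambda>d. real (Suc d) * sphere_weight d) (laplacian f) k
     = fischer (\<lambda>d. real d * sphere_weight d) (laplacian f) k + fischer sphere_weight (laplacian f) k"
    unfolding fischer_weight_add[symmetric] by (simp add: algebra_simps)
  have 4: "laplacian (\<lambda>Z. det Z * k Z) = (\<lambda>Z. euler k Z + 2 * k Z)"
    using k by (simp add: laplacian_det_mult)
  show ?thesis using f k by (simp add: bform_def 1 3 2 4 del: of_nat_Suc)
qed

lemma bform_const_left: "g \<in> polys \<Longrightarrow> bform (\<lambda>Z. c) g = 0"
  by (simp add: bform_def fischer_def coeff4_const form_weight_def mdeg_def)

text \<open>Testing against \<open>N * laplacian f\<close> gives the square norm of \<open>laplacian f\<close> for a weight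
  that is positive in every degree. Once \<open>f\<close> is harmonic, its own square norm has a weight that vanishes only in
  degree \<open>0\<close>.\<close>

lemma bform_radical:
  assumes f: "f \<in> biharmonic" and 0: "\<And>g. g \<in> biharmonic \<Longrightarrow> bform f g = 0"
  shows "\<exists>c. f = (\<lambda>Z. c)"
proof -
  have fp: "f \<in> polys" and h: "laplacian f \<in> harmonic" using f by (auto simp: biharmonic_def harmonic_def)
  have "(\<lambda>Z. det Z * laplacian f Z) \<in> biharmonic"
    using h fp by (simp add: biharmonic_def harmonic_def laplacian_det_mult laplacian_euler)
       (simp add: euler_def)
  from 0[OF this] have "fischer (\<lambda>d. real (Suc d) * sphere_weight d) (laplacian f) (laplacian f) = 0"
    by (simp add: bform_det_mult[OF fp h])
  then have "coeff4 (laplacian f) \<alpha> = 0" for \<alpha>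
    by (rule fischer_self_eq_0D[rotated 2]) (use fp in \<open>auto simp: sphere_weight_def\<close>)
  then have l: "laplacian f = (\<lambda>Z. 0)" using ev_coeff4[of "laplacian f"] fp by (simp add: ev_def fun_eq_iff)
  have "fischer form_weight f f = 0" using 0[OF f] by (simp add: bform_def l)
  then have "coeff4 f \<alpha> = 0" if "\<alpha> \<noteq> (\<lambda>_. 0)" for \<alpha>
    by (rule fischer_self_eq_0D[rotated 2])
       (use fp that in \<open>auto simp: form_weight_def mdeg_def fun_eq_iff\<close>)
  then have "f Z = coeff4 f (\<lambda>_. 0)" for Z
    using ev_superset[of "{\<lambda>_. 0}" "coeff4 f" Z] ev_coeff4[OF fp] by auto
  then show ?thesis by auto
qed

section \<open>Quaternions\<close>

text \<open>The Euclidean coordinates, read off from the first row; on quaternions this inverts \<open>quat\<close>.\<close>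

definition unquat :: "hc \<Rightarrow> real^4" where
  "unquat X = (\<chi> i. if i = 1 then - Im (X$1$2) else if i = 2 then - Re (X$1$2)
                  else if i = 3 then - Im (X$1$1) else Re (X$1$1))"

lemma quat_entries:
  "quat x $ 1 $ 1 = Complex (x$4) (- x$3)" "quat x $ 1 $ 2 = Complex (- x$2) (- x$1)"
  "quat x $ 2 $ 1 = Complex (x$2) (- x$1)" "quat x $ 2 $ 2 = Complex (x$4) (x$3)"
proof -
  have [simp]: "(0 :: 4) = 4" by simp
  show "quat x $ 1 $ 1 = Complex (x$4) (- x$3)" "quat x $ 1 $ 2 = Complex (- x$2) (- x$1)"
    "quat x $ 2 $ 1 = Complex (x$2) (- x$1)" "quat x $ 2 $ 2 = Complex (x$4) (x$3)"
    by (simp_all add: quat_def e0_def e1_def e2_def e3_def mat_def complex_eq_iff)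
qed

lemma unquat_quat [simp]: "unquat (quat x) = x"
  by (simp add: unquat_def vec_eq_iff forall_4 quat_entries)

lemma quaternions_iff: "X \<in> quaternions \<longleftrightarrow> X$2$2 = cnj (X$1$1) \<and> X$2$1 = - cnj (X$1$2)"
proof
  assume "X \<in> quaternions"
  then show "X$2$2 = cnj (X$1$1) \<and> X$2$1 = - cnj (X$1$2)"
    by (auto simp: quaternions_def quat_entries complex_eq_iff)
next
  assume "X$2$2 = cnj (X$1$1) \<and> X$2$1 = - cnj (X$1$2)"
  then have "X = quat (unquat X)"
    by (simp add: vec_eq_iff forall_2 quat_entries unquat_def complex_eq_iff)
  then show "X \<in> quaternions" by (auto simp: quaternions_def)
qed

lemma quat_unquat: "X \<in> quaternions \<Longrightarrow> quat (unquat X) = X"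
  by (auto simp: quaternions_def)

lemma quat_in_quaternions [simp]: "quat x \<in> quaternions"
  by (simp add: quaternions_def)

lemma quaternions_mult: "X \<in> quaternions \<Longrightarrow> Y \<in> quaternions \<Longrightarrow> X ** Y \<in> quaternions"
  by (simp add: quaternions_iff matrix_matrix_mult_def sum_2)

lemma quaternions_adj: "X \<in> quaternions \<Longrightarrow> adj X \<in> quaternions"
  by (simp add: quaternions_iff adj_def)

lemma quat_S3 [simp]: "quat x \<in> S3 \<longleftrightarrow> norm x = 1"
proof -
  have "complex_of_real ((norm x)\<^sup>2) = 1 \<longleftrightarrow> norm x = 1"
  proof -
    have "norm x \<noteq> - 1" using norm_ge_zero[of x] by linarith
    then show ?thesis by (simp only: of_real_eq_1_iff power2_eq_1_iff) simp
  qed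
  then show ?thesis unfolding S3_def mem_Collect_eq det_quat by simp
qed

lemma linear_quat: "linear quat"
  by (rule linearI) (auto simp: quat_def algebra_simps)

lemma linear_unquat: "linear unquat"
  by (rule linearI) (auto simp: unquat_def vec_eq_iff forall_4)

lemma borel_quat [measurable]: "quat \<in> borel_measurable borel"
  by (intro borel_measurable_continuous_onI linear_continuous_on linear_linear[THEN iffD2] linear_quat)

section \<open>The measure on the unit sphere\<close>

lemma emeasure_lborel_orthogonal_bounded:
  fixes R :: "real^4 \<Rightarrow> real^4"
  assumes R: "orthogonal_transformation R" and S: "S \<in> sets borel" "bounded S" and RS: "R ` S \<in> sets borel"
  shows "emeasure lborel (R ` S) = emeasure lborel S"
proof -
  have bR: "bounded (R ` S)"
    using S(2) orthogonal_transformation_linear[OF R] unfolding linear_conv_bounded_linear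
    by (rule bounded_linear_image)
  have lm: "S \<in> lmeasurable" by (rule bounded_set_imp_lmeasurable[OF S(2)]) (simp add: S(1))
  have lR: "R ` S \<in> lmeasurable" by (rule bounded_set_imp_lmeasurable[OF bR]) (simp add: RS)
  have "emeasure lebesgue (R ` S) = emeasure lebesgue S"
    unfolding emeasure_eq_measure2[OF lR] emeasure_eq_measure2[OF lm] measure_orthogonal_image[OF R lm] ..
  then show ?thesis using S RS by simp
qed

text \<open>An orthogonal map commutes with the projection to the sphere and preserves the volume
  of the part of the ball over a set.\<close>

lemma sphere_measure_orthogonal:
  fixes R :: "real^4 \<Rightarrow> real^4"
  assumes R: "orthogonal_transformation R"
  shows "distr sphere_measure borel R = sphere_measure"
proof (rule measure_eqI)
  have sets: "sets (sphere_measure :: (real^4) measure) = sets borel" by (simp add: sphere_measure_def)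
  then have space: "space (sphere_measure :: (real^4) measure) = UNIV" using sets_eq_imp_space_eq[OF sets] by simp
  have lin: "linear R" using R by (rule orthogonal_transformation_linear)
  have meas: "R \<in> borel_measurable borel"
    by (intro borel_measurable_continuous_onI linear_continuous_on) (use lin in \<open>simp add: linear_linear\<close>)
  then have meas': "R \<in> borel_measurable sphere_measure"
    using sets by (simp cong: measurable_cong_sets)
  show "sets (distr sphere_measure borel R) = sets sphere_measure" by (simp add: sets)
  fix A assume "A \<in> sets (distr sphere_measure borel R)"
  then have A: "A \<in> sets borel" by simp
  have VA: "R -` A \<in> sets borel" using measurable_sets[OF meas A] by simp
  let ?S = "{x \<in> ball 0 1. sgn x \<in> R -` A}"
  have sb: "{x \<in> ball 0 1. sgn x \<in> B} \<in> sets borel" if "B \<in> sets borel" for B :: "(real^4) set"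
  proof -
    have "{x \<in> ball 0 1. sgn x \<in> B} = ball 0 1 \<inter> sgn -` B" by auto
    then show ?thesis using measurable_sets[OF sgn_borel_measurable that] by simp
  qed
  have n: "norm (R x) = norm x" for x using R by (simp add: orthogonal_transformation_norm)
  have s: "R (sgn x) = sgn (R x)" for x using lin by (simp add: sgn_div_norm n linear_scale)
  have "R ` ?S = {x \<in> ball 0 1. sgn x \<in> A}"
  proof (intro equalityI subsetI)
    fix y assume y: "y \<in> {x \<in> ball 0 1. sgn x \<in> A}"
    obtain x where "y = R x" using orthogonal_transformation_surj[OF R] by (metis surjD)
    then show "y \<in> R ` ?S" using y by (auto simp: s n)
  qed (auto simp: s n)
  moreover have "emeasure lborel (R ` ?S) = emeasure lborel ?S"
    by (rule emeasure_lborel_orthogonal_bounded[OF R])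
       (use sb[OF VA] sb[OF A] calculation in \<open>auto intro: bounded_subset[of "ball 0 1"]\<close>)
  ultimately show "emeasure (distr sphere_measure borel R) A = emeasure sphere_measure A"
    by (simp add: emeasure_distr[OF meas' A] space emeasure_sphere_measure[OF A] emeasure_sphere_measure[OF VA])
qed

definition sph :: "(hc \<Rightarrow> complex) \<Rightarrow> complex" where
  "sph f = (LINT X:S3|dS. f X)"

lemma sets_sphere_measure [simp, measurable_cong]: "sets (sphere_measure :: 'a::euclidean_space measure) = sets borel"
  by (simp add: sphere_measure_def)

lemma space_sphere_measure [simp]: "space (sphere_measure :: 'a::euclidean_space measure) = UNIV"
  by (simp add: sphere_measure_def)

lemma sph_eq:
  assumes "f \<in> borel_measurable borel"
  shows "sph f = (LINT x|sphere_measure. indicator {x. norm x = 1} x *\<^sub>R f (quat x))"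
    and "S3 \<in> sets borel"
proof -
  have "closed {X :: hc. X$2$2 = cnj (X$1$1) \<and> X$2$1 = - cnj (X$1$2) \<and> det X = 1}"
    by (intro closed_Collect_conj closed_Collect_eq) (auto intro!: continuous_intros simp: det_2)
  also have "{X :: hc. X$2$2 = cnj (X$1$1) \<and> X$2$1 = - cnj (X$1$2) \<and> det X = 1} = S3"
    by (auto simp: S3_def quaternions_iff)
  finally show S3: "S3 \<in> sets borel" by (rule borel_closed)
  have "sph f = (LINT x|sphere_measure. indicator S3 (quat x) *\<^sub>R f (quat x))"
    unfolding sph_def set_lebesgue_integral_def dS_def
    by (rule integral_distr) (use assms S3 in \<open>auto intro!: borel_measurable_scaleR\<close>)
  then show "sph f = (LINT x|sphere_measure. indicator {x. norm x = 1} x *\<^sub>R f (quat x))"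
    by (simp add: indicator_def)
qed

lemma sph_orthogonal:
  assumes f: "f \<in> borel_measurable borel" and \<Phi>: "\<Phi> \<in> borel_measurable borel"
    and R: "orthogonal_transformation R" and \<Phi>R: "\<And>x. \<Phi> (quat x) = quat (R x)"
  shows "sph (\<lambda>X. f (\<Phi> X)) = sph f"
proof -
  have meas: "R \<in> borel_measurable borel"
    by (intro borel_measurable_continuous_onI linear_continuous_on)
       (use R in \<open>simp add: linear_linear orthogonal_transformation_linear\<close>)
  let ?h = "\<lambda>x. indicator {x. norm x = 1} x *\<^sub>R f (quat x)"
  have h: "?h \<in> borel_measurable borel"
    using f by (intro borel_measurable_scaleR) auto
  have "sph (\<lambda>X. f (\<Phi> X)) = (LINT x|sphere_measure. ?h (R x))"
    using f \<Phi> by (subst sph_eq) (auto simp: \<Phi>R indicator_def orthogonal_transformation_norm[OF R])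
  also have "\<dots> = (LINT x|distr sphere_measure borel R. ?h x)"
    by (rule integral_distr[symmetric]) (use meas h in auto)
  also have "\<dots> = sph f" by (simp add: sphere_measure_orthogonal[OF R] sph_eq(1)[OF f])
  finally show ?thesis .
qed

text \<open>The determinant of a quaternion is its squared norm, so a linear map of the quaternions that
  preserves it is orthogonal.\<close>

lemma sph_linear_isometry:
  assumes f: "f \<in> borel_measurable borel" and lin: "linear \<Phi>"
    and quat: "\<And>X. X \<in> quaternions \<Longrightarrow> \<Phi> X \<in> quaternions"
    and det: "\<And>x. det (\<Phi> (quat x)) = det (quat x)"
  shows "sph (\<lambda>X. f (\<Phi> X)) = sph f"
proof (rule sph_orthogonal[OF f])
  let ?R = "\<lambda>x. unquat (\<Phi> (quat x))"
  have q: "quat (?R x) = \<Phi> (quat x)" for x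
    by (intro quat_unquat quat) simp
  then show "\<Phi> (quat x) = quat (?R x)" for x by simp
  show "\<Phi> \<in> borel_measurable borel"
    by (intro borel_measurable_continuous_onI linear_continuous_on) (simp add: lin linear_linear)
  show "orthogonal_transformation ?R"
    unfolding orthogonal_transformation
  proof (intro conjI allI)
    show "linear ?R"
      using linear_compose[OF linear_compose[OF linear_quat lin] linear_unquat] by (simp add: o_def)
    fix x
    have "complex_of_real ((norm (?R x))\<^sup>2) = complex_of_real ((norm x)\<^sup>2)"
      by (simp only: det_quat[symmetric] q det)
    then have "(norm (?R x))\<^sup>2 = (norm x)\<^sup>2" by (simp only: of_real_eq_iff)
    then show "norm (?R x) = norm x" by simp
  qed
qed

lemma sph_left_mult:
  assumes f: "f \<in> borel_measurable borel" and g: "g \<in> S3"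
  shows "sph (\<lambda>X. f (g ** X)) = sph f"
proof (rule sph_linear_isometry[OF f])
  show "linear (\<lambda>X :: hc. g ** X)"
    by (rule linearI) (auto simp: matrix_matrix_mult_def vec_eq_iff scaleR_sum_right distrib_left sum.distrib)
qed (use g in \<open>auto simp: S3_def quaternions_mult det_mul\<close>)

lemma sph_adj:
  assumes f: "f \<in> borel_measurable borel"
  shows "sph (\<lambda>X. f (adj X)) = sph f"
proof (rule sph_linear_isometry[OF f])
  show "linear adj" by (rule linearI) (auto simp: adj_def vec_eq_iff)
  have "det (adj X) = cnj (det X)" for X by (simp add: adj_def det_2 mult.commute)
  then show "det (adj (quat x)) = det (quat x)" for x by (simp add: det_quat)
qed (rule quaternions_adj)

lemma emeasure_sphere: "emeasure (sphere_measure :: (real^4) measure) {x. norm x = 1} = ennreal (2 * pi\<^sup>2)"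
  and emeasure_sphere_UNIV: "emeasure (sphere_measure :: (real^4) measure) UNIV = ennreal (2 * pi\<^sup>2)"
proof -
  have b: "emeasure lborel (ball 0 1 :: (real^4) set) = ennreal (pi\<^sup>2 / 2)"
    by (simp add: emeasure_ball unit_ball_vol_numeral fact_numeral)
  have b2: "{x :: real^4. norm x < 1} = ball 0 1" by auto
  have m: "4 * ennreal (pi\<^sup>2 / 2) = ennreal (2 * pi\<^sup>2)"
    using ennreal_mult[of 4 "pi\<^sup>2 / 2"] by simp
  show "emeasure (sphere_measure :: (real^4) measure) UNIV = ennreal (2 * pi\<^sup>2)"
    by (subst emeasure_sphere_measure) (simp_all add: b m b2)
  have "emeasure lborel {x \<in> ball 0 1 :: (real^4) set. sgn x \<in> {x. norm x = 1}} = emeasure lborel (ball 0 1 - {0 :: real^4})"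
    by (rule arg_cong[of _ _ "emeasure lborel"]) (auto simp: norm_sgn)
  also have "\<dots> = emeasure lborel (ball 0 1 :: (real^4) set)"
    by (rule emeasure_Diff_null_set) auto
  finally show "emeasure (sphere_measure :: (real^4) measure) {x. norm x = 1} = ennreal (2 * pi\<^sup>2)"
    by (subst emeasure_sphere_measure) (auto simp: b m)
qed

lemma finite_measure_dS: "finite_measure dS"
proof
  show "emeasure dS (space dS) \<noteq> \<infinity>"
    unfolding dS_def by (subst emeasure_distr) (auto simp: emeasure_sphere_UNIV)
qed

lemma sph_const: "sph (\<lambda>X. c) = 2 * of_real pi ^ 2 * c"
proof -
  have "sph (\<lambda>X. c) = (LINT x|sphere_measure. indicator {x :: real^4. norm x = 1} x *\<^sub>R c)"
    by (rule sph_eq) auto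
  also have "\<dots> = measure sphere_measure {x :: real^4. norm x = 1} *\<^sub>R c"
    by (intro has_bochner_integral_integral_eq has_bochner_integral_indicator)
       (auto simp: emeasure_sphere)
  finally show ?thesis by (simp add: measure_def emeasure_sphere scaleR_conv_of_real)
qed

lemma compact_S3: "compact S3"
proof -
  have "S3 = quat ` sphere 0 1"
  proof (intro equalityI subsetI)
    fix X assume X: "X \<in> S3"
    then obtain x where "X = quat x" by (auto simp: S3_def quaternions_def)
    then show "X \<in> quat ` sphere 0 1" using X by auto
  qed auto
  then show ?thesis
    using compact_continuous_image[of "sphere 0 1" quat] linear_quat
    by (simp add: linear_continuous_on linear_linear)
qed

lemma integrable_continuous_S3:
  assumes f: "continuous_on UNIV f"
  shows "set_integrable dS S3 (f :: hc \<Rightarrow> complex)"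
proof -
  interpret finite_measure dS by (rule finite_measure_dS)
  have "bounded (f ` S3)"
    using compact_S3 f continuous_on_subset by (intro compact_imp_bounded compact_continuous_image) blast+
  then obtain B where B: "\<And>X. X \<in> S3 \<Longrightarrow> norm (f X) \<le> B" by (auto simp: bounded_iff)
  have "f \<in> borel_measurable borel" using f by (rule borel_measurable_continuous_onI)
  then have m: "(\<lambda>X. indicator S3 X *\<^sub>R f X) \<in> borel_measurable dS"
    using sph_eq(2)[of "\<lambda>_. 0"] by (auto simp: dS_def intro!: borel_measurable_scaleR)
  have "AE X in dS. norm (indicator S3 X *\<^sub>R f X) \<le> max B 0"
    by (intro AE_I2) (auto simp: indicator_def dest: B)
  from integrable_const_bound[OF this m] show ?thesis by (simp add: set_integrable_def)
qed

lemma polys_continuous: "f \<in> polys \<Longrightarrow> continuous_on UNIV f"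
  by (induction rule: polys.induct) (auto intro!: continuous_intros simp: ent_def)

lemma polys_borel: "f \<in> polys \<Longrightarrow> f \<in> borel_measurable borel"
  by (intro borel_measurable_continuous_onI polys_continuous)

lemma sph_add: "f \<in> polys \<Longrightarrow> g \<in> polys \<Longrightarrow> sph (\<lambda>X. f X + g X) = sph f + sph g"
  unfolding sph_def by (intro set_integral_add integrable_continuous_S3 polys_continuous)

lemma sph_diff: "f \<in> polys \<Longrightarrow> g \<in> polys \<Longrightarrow> sph (\<lambda>X. f X - g X) = sph f - sph g"
  unfolding sph_def by (intro set_integral_diff integrable_continuous_S3 polys_continuous)

lemma sph_cmult: "sph (\<lambda>X. c * f X) = c * sph f"
  unfolding sph_def by simp

lemma sph_cong: "(\<And>X. X \<in> S3 \<Longrightarrow> f X = g X) \<Longrightarrow> sph f = sph g"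
  unfolding sph_def set_lebesgue_integral_def
  by (rule Bochner_Integration.integral_cong) (auto simp: indicator_def)

section \<open>Integration by parts on the sphere\<close>

text \<open>The one-parameter group generated by \<open>e\<close>, if \<open>e\<close> squares to \<open>- 1\<close>.\<close>

definition rot :: "hc \<Rightarrow> real \<Rightarrow> hc" where
  "rot e t = cos t *\<^sub>R mat 1 + sin t *\<^sub>R e"

definition left_field :: "hc \<Rightarrow> (hc \<Rightarrow> complex) \<Rightarrow> hc \<Rightarrow> complex" where
  "left_field e f Z = (\<Sum>p\<in>UNIV. ent (e ** Z) p * pdiff p f Z)"

lemma ent_mult: "ent (A ** B) (i, j) = ent A (i,1) * ent B (1,j) + ent A (i,2) * ent B (2,j)"
  by (simp add: ent_def matrix_matrix_mult_def sum_2)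

lemma left_field_polys [simp]: "f \<in> polys \<Longrightarrow> left_field e f \<in> polys"
  unfolding left_field_def[abs_def] sum_entries ent_mult by simp

lemma ent_scaleR: "ent (c *\<^sub>R A) p = c *\<^sub>R ent A p"
  by (simp add: ent_def)

lemma ent_diff: "ent (A - B) p = ent A p - ent B p"
  by (simp add: ent_def)

lemma rot_mult: "rot e t ** X = cos t *\<^sub>R X + sin t *\<^sub>R (e ** X)"
  by (auto simp: rot_def matrix_matrix_mult_def vec_eq_iff mat_def sum_2 forall_2 algebra_simps)

lemma ent_rot: "ent (rot e t ** X) p = cos t *\<^sub>R ent X p + sin t *\<^sub>R ent (e ** X) p"
  by (simp add: rot_mult ent_scaleR)

lemma rot_derivative:
  assumes f: "f \<in> polys" and e: "e ** e = - mat 1"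
  shows "((\<lambda>t. f (rot e t ** X)) has_vector_derivative left_field e f (rot e t ** X)) (at t within S)"
proof -
  have "e ** (rot e t ** X) = - sin t *\<^sub>R X + cos t *\<^sub>R (e ** X)"
  proof -
    have "e ** (e ** X) = - X"
      by (simp add: matrix_mul_assoc e) (simp add: matrix_matrix_mult_def vec_eq_iff mat_def sum_2 forall_2)
    moreover have "e ** (c *\<^sub>R Y) = c *\<^sub>R (e ** Y)" for c and Y :: hc
      by (auto simp: matrix_matrix_mult_def vec_eq_iff scaleR_sum_right)
    ultimately show ?thesis by (simp add: rot_mult matrix_add_ldistrib)
  qed
  then have "ent (e ** (rot e t ** X)) p = - sin t *\<^sub>R ent X p + cos t *\<^sub>R ent (e ** X) p" for p
    by (simp add: ent_scaleR ent_diff)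
  moreover have "((\<lambda>t. ent (rot e t ** X) p) has_vector_derivative
      - sin t *\<^sub>R ent X p + cos t *\<^sub>R ent (e ** X) p) (at t within S)" for p
    unfolding ent_rot by (auto intro!: derivative_eq_intros)
  ultimately show ?thesis
    unfolding left_field_def by (intro polys_has_vector_derivative[OF f]) simp
qed

lemma rot_0 [simp]: "rot e 0 = mat 1" by (simp add: rot_def)

text \<open>By invariance the difference quotients along the one-parameter group have integral \<open>0\<close>. They
  converge to the derivative, and the mean value theorem bounds them on the sphere.\<close>

lemma sph_left_field:
  assumes f: "f \<in> polys" and e: "e ** e = - mat 1" and S: "\<And>t. rot e t \<in> S3"
  shows "sph (left_field e f) = 0"
proof -
  let ?s = "\<lambda>n. inverse (real (Suc n))"
  let ?d = "\<lambda>n X. (1 / ?s n) *\<^sub>R (f (rot e (?s n) ** X) - f X)"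
  have cont: "continuous_on UNIV (\<lambda>X :: hc. A ** X)" for A :: hc
    unfolding matrix_matrix_mult_def by (intro continuous_intros)
  have fc: "continuous_on UNIV (\<lambda>X. f (A ** X))" for A :: hc
    by (rule continuous_on_compose2[OF polys_continuous[OF f] cont]) simp
  have "(\<lambda>n. LINT X|dS. indicator S3 X *\<^sub>R ?d n X) \<longlonglongrightarrow> (LINT X|dS. indicator S3 X *\<^sub>R left_field e f X)"
  proof -
    have "bounded (left_field e f ` S3)"
      using compact_S3 polys_continuous[OF left_field_polys[OF f]] continuous_on_subset
      by (intro compact_imp_bounded compact_continuous_image) blast+
    then obtain B where B: "\<And>X. X \<in> S3 \<Longrightarrow> norm (left_field e f X) \<le> B" by (auto simp: bounded_iff)
    interpret finite_measure dS by (rule finite_measure_dS)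
    have ms: "(\<lambda>X. indicator S3 X *\<^sub>R h X) \<in> borel_measurable dS" if "continuous_on UNIV h" for h :: "hc \<Rightarrow> complex"
      using integrable_continuous_S3[OF that] by (auto simp: set_integrable_def)
    show ?thesis
    proof (rule integral_dominated_convergence[where w = "\<lambda>_. max B 0"])
      show "(\<lambda>X. indicator S3 X *\<^sub>R left_field e f X) \<in> borel_measurable dS"
        by (intro ms polys_continuous left_field_polys f)
      show "(\<lambda>X. indicator S3 X *\<^sub>R ?d n X) \<in> borel_measurable dS" for n
        by (intro ms continuous_intros fc polys_continuous f)
      show "integrable dS (\<lambda>_. max B 0)" by simp
      show "AE X in dS. (\<lambda>n. indicator S3 X *\<^sub>R ?d n X) \<longlonglongrightarrow> indicator S3 X *\<^sub>R left_field e f X"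
      proof (intro AE_I2 tendsto_scaleR tendsto_const)
        fix X
        have "((\<lambda>t. f (rot e t ** X)) has_derivative (\<lambda>t. t *\<^sub>R left_field e f X)) (at 0)"
          using rot_derivative[OF f e, of X 0] by (simp add: has_vector_derivative_def)
        then have "(\<lambda>h. norm (f (rot e h ** X) - f X - h *\<^sub>R left_field e f X) / norm h) \<midarrow>0\<rightarrow> 0"
          by (simp add: has_derivative_at)
        moreover have "filterlim ?s (at 0) sequentially"
          using LIMSEQ_inverse_real_of_nat by (auto simp: filterlim_at)
        ultimately have "(\<lambda>n. norm (f (rot e (?s n) ** X) - f X - ?s n *\<^sub>R left_field e f X) / norm (?s n)) \<longlonglongrightarrow> 0"
          by (rule filterlim_compose)
        moreover have "norm (f (rot e (?s n) ** X) - f X - ?s n *\<^sub>R left_field e f X) / norm (?s n)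
            = norm (?d n X - left_field e f X)" for n
        proof -
          have "?d n X - left_field e f X = (1 / ?s n) *\<^sub>R (f (rot e (?s n) ** X) - f X - ?s n *\<^sub>R left_field e f X)"
            by (simp add: scaleR_diff_right del: of_nat_Suc)
          then show ?thesis by (simp del: of_nat_Suc)
        qed
        ultimately show "(\<lambda>n. ?d n X) \<longlonglongrightarrow> left_field e f X"
          by (simp add: tendsto_norm_zero_iff LIM_zero_iff del: of_nat_Suc)
      qed
      show "AE X in dS. norm (indicator S3 X *\<^sub>R ?d n X) \<le> max B 0" for n
      proof (intro AE_I2)
        fix X
        show "norm (indicator S3 X *\<^sub>R ?d n X) \<le> max B 0"
        proof (cases "X \<in> S3")
          case True
          have s: "0 < ?s n" by simp
          have rS: "rot e t ** X \<in> S3" for t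
            using S[of t] True by (auto simp: S3_def quaternions_mult det_mul)
          have "\<exists>t\<in>{0<..<?s n}. norm (f (rot e (?s n) ** X) - f (rot e 0 ** X)) \<le> norm ((?s n - 0) *\<^sub>R left_field e f (rot e t ** X))"
          proof (rule mvt_general[OF s])
            show "continuous_on {0..?s n} (\<lambda>t. f (rot e t ** X))"
              by (rule continuous_on_vector_derivative[OF rot_derivative[OF f e]])
            show "((\<lambda>t. f (rot e t ** X)) has_derivative (\<lambda>h. h *\<^sub>R left_field e f (rot e t ** X))) (at t)" for t
              using rot_derivative[OF f e, of X t] by (simp add: has_vector_derivative_def)
          qed
          then obtain t where t: "norm (f (rot e (?s n) ** X) - f X) \<le> ?s n * norm (left_field e f (rot e t ** X))"
            by (auto simp del: of_nat_Suc)
          also have "\<dots> \<le> ?s n * B" using B[OF rS] s by (intro mult_left_mono) auto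
          finally have "norm (f (rot e (?s n) ** X) - f X) / ?s n \<le> B"
            using s by (simp add: pos_divide_le_eq mult.commute del: of_nat_Suc)
          then show ?thesis using True by (simp add: divide_inverse mult.commute del: of_nat_Suc)
        qed simp
      qed
    qed
  qed
  moreover have "(LINT X|dS. indicator S3 X *\<^sub>R ?d n X) = 0" for n
  proof -
    have "(LINT X|dS. indicator S3 X *\<^sub>R ?d n X) = sph (\<lambda>X. of_real (1 / ?s n) * (f (rot e (?s n) ** X) - f X))"
      unfolding sph_def set_lebesgue_integral_def scaleR_conv_of_real ..
    also have "\<dots> = of_real (1 / ?s n) * sph (\<lambda>X. f (rot e (?s n) ** X) - f X)" by (rule sph_cmult)
    also have "sph (\<lambda>X. f (rot e (?s n) ** X) - f X) = sph (\<lambda>X. f (rot e (?s n) ** X)) - sph f"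
      unfolding sph_def by (intro set_integral_diff integrable_continuous_S3 fc polys_continuous f)
    also have "sph (\<lambda>X. f (rot e (?s n) ** X)) = sph f"
      by (rule sph_left_mult[OF polys_borel[OF f] S])
    finally show ?thesis by simp
  qed
  ultimately have "(\<lambda>n. 0) \<longlonglongrightarrow> (LINT X|dS. indicator S3 X *\<^sub>R left_field e f X)"
    by (simp only:)
  from LIMSEQ_unique[OF tendsto_const this]
  have "(LINT X|dS. indicator S3 X *\<^sub>R left_field e f X) = 0" by (rule sym)
  then show ?thesis by (simp add: sph_def set_lebesgue_integral_def)
qed


lemma ent_e:
  "ent (e1 ** Z) (i, j) = - \<i> * ent Z (if i = 1 then 2 else 1, j)"
  "ent (e2 ** Z) (i, j) = (if i = 1 then - ent Z (2, j) else ent Z (1, j))"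
  "ent (e3 ** Z) (i, j) = (if i = 1 then - \<i> * ent Z (1, j) else \<i> * ent Z (2, j))"
  by (cases i rule: exhaust_2[THEN disjE]; simp add: e1_def e2_def e3_def ent_mult; simp add: ent_def)+

lemma e_square: "e1 ** e1 = - mat 1" "e2 ** e2 = - mat 1" "e3 ** e3 = - mat 1"
  by (auto simp: e1_def e2_def e3_def matrix_matrix_mult_def vec_eq_iff mat_def sum_2 forall_2)

lemma rot_S3: "rot e1 t \<in> S3" "rot e2 t \<in> S3" "rot e3 t \<in> S3"
proof -
  have "complex_of_real (cos t) * complex_of_real (cos t) + complex_of_real (sin t) * complex_of_real (sin t) = 1"
    using sin_cos_squared_add3[of t] by (metis of_real_1 of_real_add of_real_mult)
  then show "rot e1 t \<in> S3" "rot e2 t \<in> S3" "rot e3 t \<in> S3"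
    unfolding S3_def quaternions_iff mem_Collect_eq det_2
    unfolding rot_def vector_add_component vector_scaleR_component
    by (simp_all add: e1_def e2_def e3_def mat_def) (simp_all add: scaleR_conv_of_real algebra_simps)
qed

text \<open>The imaginary units span su(2), and their complex span is sl(2) over the complex numbers. So the
  off-diagonal matrix units and the difference of the diagonal ones give fields of integral \<open>0\<close>.\<close>

lemma sph_left_op:
  assumes f: "f \<in> polys"
  shows "sph (left_op 1 2 f) = 0" "sph (left_op 2 1 f) = 0" "sph (left_op 1 1 f) = sph (left_op 2 2 f)"
proof -
  have 1: "left_field e1 f = (\<lambda>Z. - \<i> * (left_op 1 2 f Z + left_op 2 1 f Z))"
    and 2: "left_field e2 f = (\<lambda>Z. left_op 2 1 f Z - left_op 1 2 f Z)"
    and 3: "left_field e3 f = (\<lambda>Z. - \<i> * (left_op 1 1 f Z - left_op 2 2 f Z))"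
    by (auto simp: left_field_def left_op_def sum_entries ent_e algebra_simps fun_eq_iff)
  have "sph (left_field e1 f) = - \<i> * (sph (left_op 1 2 f) + sph (left_op 2 1 f))"
    unfolding 1 by (subst sph_cmult) (simp add: sph_add f)
  then have a: "sph (left_op 1 2 f) + sph (left_op 2 1 f) = 0"
    using sph_left_field[OF f e_square(1) rot_S3(1)] by simp
  have "sph (left_field e2 f) = sph (left_op 2 1 f) - sph (left_op 1 2 f)"
    unfolding 2 by (simp add: sph_diff f)
  then have b: "sph (left_op 2 1 f) - sph (left_op 1 2 f) = 0"
    using sph_left_field[OF f e_square(2) rot_S3(2)] by simp
  show "sph (left_op 2 1 f) = 0" "sph (left_op 1 2 f) = 0" using a b by auto
  have "sph (left_field e3 f) = - \<i> * (sph (left_op 1 1 f) - sph (left_op 2 2 f))"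
    unfolding 3 by (subst sph_cmult) (simp add: sph_diff f)
  then show "sph (left_op 1 1 f) = sph (left_op 2 2 f)"
    using sph_left_field[OF f e_square(3) rot_S3(3)] by simp
qed

lemma sph_det_mult: "sph (\<lambda>Z. det Z * f Z) = sph f"
  by (rule sph_cong) (simp add: S3_def)

lemma left_op_mult: "f \<in> polys \<Longrightarrow> g \<in> polys \<Longrightarrow>
    left_op i k (\<lambda>Z. f Z * g Z) = (\<lambda>Z. left_op i k f Z * g Z + f Z * left_op i k g Z)"
  by (auto simp: left_op_def algebra_simps)

lemma left_op_ent: "left_op i k (\<lambda>Z. ent Z (a, b)) = (\<lambda>Z. if i = a then ent Z (k, b) else 0)"
  using exhaust_2[of b] by (auto simp: left_op_def pdiff_ent)

text \<open>Cramer's rule: up to the determinant, the fields of left multiplication contain all derivations.\<close>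

lemma det_pdiff:
  "det Z * pdiff (2,2) f Z = ent Z (1,1) * left_op 2 2 f Z - ent Z (2,1) * left_op 2 1 f Z"
  "det Z * pdiff (2,1) f Z = ent Z (2,2) * left_op 2 1 f Z - ent Z (1,2) * left_op 2 2 f Z"
  "det Z * pdiff (1,2) f Z = ent Z (1,1) * left_op 1 2 f Z - ent Z (2,1) * left_op 1 1 f Z"
  "det Z * pdiff (1,1) f Z = ent Z (2,2) * left_op 1 1 f Z - ent Z (1,2) * left_op 1 2 f Z"
  by (simp_all add: det_ent left_op_def algebra_simps)

text \<open>On the sphere the determinant is \<open>1\<close>, so that \<open>det_pdiff\<close> expresses the derivative by fields of left
  multiplication, which can be shifted to the other factor. Only the sum of the two diagonal fields cannot be
  eliminated in this way; it is the Euler operator, which supplies the degree.\<close>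

lemma sph_ent_mult:
  assumes f: "f \<in> polys" and e: "euler f = (\<lambda>Z. of_nat d * f Z)"
  shows "(of_nat d + 3) / 2 * sph (\<lambda>Z. ent Z p * f Z) = sg p * sph (pdiff (opp p) f)"
proof -
  let ?s = "\<lambda>a b g. sph (\<lambda>Z. ent Z (a, b) * g Z)"
  have prod: "sph (left_op i k (\<lambda>Z. ent Z (a, b) * f Z)) = (if i = a then ?s k b f else 0) + ?s a b (left_op i k f)"
    for i k a b
    using f by (simp add: left_op_mult left_op_ent sph_add)
  have eu: "of_nat d * ?s a b f = ?s a b (left_op 1 1 f) + ?s a b (left_op 2 2 f)" for a b
  proof -
    have "of_nat d * f Z = left_op 1 1 f Z + left_op 2 2 f Z" for Z
      using fun_cong[OF e, of Z] by (simp add: euler_def sum_entries left_op_def add.assoc)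
    then have "(\<lambda>Z. of_nat d * (ent Z (a,b) * f Z)) = (\<lambda>Z. ent Z (a,b) * left_op 1 1 f Z + ent Z (a,b) * left_op 2 2 f Z)"
      by (simp only: mult.left_commute[of "of_nat d"] distrib_left)
    then show ?thesis
      using f sph_cmult[of "of_nat d" "\<lambda>Z. ent Z (a,b) * f Z"] by (simp add: sph_add)
  qed
  have fp: "(\<lambda>Z. ent Z (a, b) * f Z) \<in> polys" for a b using f by simp
  note l = sph_left_op[OF fp, unfolded prod, of 1 1] sph_left_op[OF fp, unfolded prod, of 1 2]
     sph_left_op[OF fp, unfolded prod, of 2 1] sph_left_op[OF fp, unfolded prod, of 2 2]
  have d: "sph (pdiff (2,2) f) = ?s 1 1 (left_op 2 2 f) - ?s 2 1 (left_op 2 1 f)"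
    "sph (pdiff (2,1) f) = ?s 2 2 (left_op 2 1 f) - ?s 1 2 (left_op 2 2 f)"
    "sph (pdiff (1,2) f) = ?s 1 1 (left_op 1 2 f) - ?s 2 1 (left_op 1 1 f)"
    "sph (pdiff (1,1) f) = ?s 2 2 (left_op 1 1 f) - ?s 1 2 (left_op 1 2 f)"
    using f by (simp_all add: sph_det_mult[of "pdiff _ f", symmetric] det_pdiff sph_diff)
  have "\<forall>p. (of_nat d + 3) / 2 * sph (\<lambda>Z. ent Z p * f Z) = sg p * sph (pdiff (opp p) f)"
    unfolding forall_entries opp_sg_simps d using l eu[of 1 1] eu[of 1 2] eu[of 2 1] eu[of 2 2]
    by (simp add: field_simps) algebra
  then show ?thesis by blast
qed

section \<open>Sphere integrals of harmonic polynomials\<close>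

text \<open>For a polynomial \<open>f\<close> this is a polynomial that agrees with the complex conjugate of \<open>f\<close> on the
  sphere: \<open>f\<close> is applied after the antilinear involution of the matrices that fixes the quaternions.\<close>

definition sharp :: "(hc \<Rightarrow> complex) \<Rightarrow> hc \<Rightarrow> complex" where
  "sharp f Z = cnj (f (\<chi> i j. sg (i, j) * cnj (ent Z (opp (i, j)))))"

lemma sharp_S3: "X \<in> S3 \<Longrightarrow> sharp f X = cnj (f X)"
proof -
  assume "X \<in> S3"
  then have "(\<chi> i j. sg (i, j) * cnj (ent X (opp (i, j)))) = X"
    by (simp add: S3_def quaternions_iff vec_eq_iff forall_2) (simp add: ent_def)
  then show ?thesis by (simp add: sharp_def)
qed

lemma opp_opp [simp]: "opp (opp p) = p" and sg_opp [simp]: "sg (opp p) = sg p" and sg_sg [simp]: "sg p * sg p = 1"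
  and cnj_sg [simp]: "cnj (sg p) = sg p"
  using exhaust_2[of "fst p"] exhaust_2[of "snd p"] by (cases p; auto simp: opp_def sg_def)+

lemma sharp_simps [simp]:
  "sharp (\<lambda>Z. c) = (\<lambda>Z. cnj c)"
  "sharp (\<lambda>Z. f Z + g Z) = (\<lambda>Z. sharp f Z + sharp g Z)"
  "sharp (\<lambda>Z. f Z - g Z) = (\<lambda>Z. sharp f Z - sharp g Z)"
  "sharp (\<lambda>Z. f Z * g Z) = (\<lambda>Z. sharp f Z * sharp g Z)"
  "sharp (\<lambda>Z. ent Z p) = (\<lambda>Z. sg p * ent Z (opp p))"
  by (auto simp: sharp_def ent_def)

lemma sharp_polys [simp]: "f \<in> polys \<Longrightarrow> sharp f \<in> polys"
  by (induction rule: polys.induct) auto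

lemma pdiff_sharp: "f \<in> polys \<Longrightarrow> pdiff p (sharp f) = (\<lambda>Z. sg p * sharp (pdiff (opp p) f) Z)"
proof (induction rule: polys.induct)
  case (polys_ent q)
  have "p = opp q \<longleftrightarrow> opp p = q" by auto
  then show ?case by (auto simp: pdiff_ent)
qed (auto simp: algebra_simps)

lemma sharp_euler: "f \<in> polys \<Longrightarrow> euler (sharp f) = sharp (euler f)"
  by (simp add: euler_def pdiff_sharp sum_entries algebra_simps)

definition hom :: "nat \<Rightarrow> (hc \<Rightarrow> complex) set" where
  "hom d = {f \<in> polys. euler f = (\<lambda>Z. of_nat d * f Z)}"

lemma hom_pdiff: "f \<in> hom (Suc d) \<Longrightarrow> pdiff p f \<in> hom d"
proof -
  assume f: "f \<in> hom (Suc d)"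
  then have "pdiff p (euler f) = (\<lambda>Z. of_nat (Suc d) * pdiff p f Z)"
    by (simp add: hom_def del: of_nat_Suc)
  moreover have "pdiff p (euler f) = (\<lambda>Z. euler (pdiff p f) Z + pdiff p f Z)"
    using f by (intro pdiff_euler) (simp add: hom_def)
  ultimately have "euler (pdiff p f) Z + pdiff p f Z = of_nat (Suc d) * pdiff p f Z" for Z by metis
  then show "pdiff p f \<in> hom d" using f by (auto simp: hom_def fun_eq_iff algebra_simps)
qed

lemma hom_sharp: "f \<in> hom d \<Longrightarrow> sharp f \<in> hom d"
  by (auto simp: hom_def sharp_euler)

lemma hom_mult: "f \<in> hom d \<Longrightarrow> g \<in> hom d' \<Longrightarrow> (\<lambda>Z. f Z * g Z) \<in> hom (d + d')"
  by (auto simp: hom_def euler_mult algebra_simps)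

lemma hom_0: assumes "f \<in> hom 0" shows "\<exists>c. f = (\<lambda>Z. c)"
proof -
  have f: "f \<in> polys" "euler f = (\<lambda>Z. 0)" using assms by (auto simp: hom_def)
  have "of_nat (mdeg \<alpha>) * coeff4 f \<alpha> = 0" for \<alpha>
    using fun_cong[OF coeff4_euler[OF f(1)], of \<alpha>] by (simp add: f(2) coeff4_const)
  moreover have "mdeg \<alpha> \<noteq> 0" if "\<alpha> \<noteq> (\<lambda>_. 0)" for \<alpha>
    using that by (auto simp: mdeg_def fun_eq_iff)
  ultimately have "coeff4 f \<alpha> = 0" if "\<alpha> \<noteq> (\<lambda>_. 0)" for \<alpha>
    using that by (metis mult_eq_0_iff of_nat_eq_0_iff)
  then have "f Z = coeff4 f (\<lambda>_. 0)" for Z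
    using ev_superset[of "{\<lambda>_. 0}" "coeff4 f" Z] ev_coeff4[OF f(1)] by auto
  then show ?thesis by auto
qed

lemma harmonic_pdiff: "f \<in> harmonic \<Longrightarrow> pdiff p f \<in> harmonic"
  by (auto simp: harmonic_def pdiff_laplacian[symmetric])

lemma fischer_hom: "f \<in> hom d \<Longrightarrow> fischer (\<lambda>d. real d * w d) f g = of_nat d * fischer w f g"
  by (subst fischer_euler_left[symmetric]) (auto simp: hom_def)

lemma fischer_hom_neq:
  assumes "f \<in> hom d" "g \<in> hom d'" "d \<noteq> d'"
  shows "fischer w f g = 0"
proof -
  have p: "f \<in> polys" "g \<in> polys" using assms by (auto simp: hom_def)
  have "of_nat d' * fischer w g f = cnj (of_nat d * fischer w f g)"
    unfolding fischer_hom[OF assms(1), symmetric] fischer_hom[OF assms(2), symmetric]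
    by (rule fischer_sym[OF p])
  then have "of_nat d' * fischer w g f = of_nat d * fischer w g f"
    by (simp add: fischer_sym[OF p, of w])
  then have "fischer w g f = 0" using assms(3) by auto
  then show ?thesis using fischer_sym[OF p, of w] by simp
qed

lemma fischer_pdiff_sum:
  assumes h: "h \<in> hom d" and g: "g \<in> polys"
  shows "(\<Sum>p\<in>UNIV. fischer sphere_weight (pdiff p h) (pdiff p g)) = of_nat d * of_nat (Suc d) * fischer sphere_weight h g"
proof -
  have hp: "h \<in> polys" "euler h = (\<lambda>Z. of_nat d * h Z)" using h by (auto simp: hom_def)
  \<comment> \<open>\<open>v (Suc n) = sphere_weight n\<close>, so that \<open>fischer_ent_mult\<close> can be read from right to left\<close>
  define v :: "nat \<Rightarrow> real" where "v n = real n * sphere_weight n + sphere_weight n" for n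
  have v: "(\<lambda>n. v (Suc n)) = sphere_weight" by (auto simp: v_def sphere_weight_def divide_simps)
  have "(\<Sum>p\<in>UNIV. fischer sphere_weight (pdiff p h) (pdiff p g)) = (\<Sum>p\<in>UNIV. fischer v (\<lambda>Z. ent Z p * pdiff p h Z) g)"
    using hp g by (simp add: fischer_ent_mult v)
  also have "\<dots> = fischer v (euler h) g"
    unfolding euler_def by (rule fischer_sum_left[symmetric]) (use hp in auto)
  also have "\<dots> = of_nat d * fischer v h g" using hp by simp
  also have "fischer v h g = of_nat (Suc d) * fischer sphere_weight h g"
    unfolding v_def fischer_weight_add fischer_hom[OF h] by (simp add: algebra_simps)
  finally show ?thesis by simp
qed

text \<open>By Euler's identity for \<open>g\<close> and integration by parts, the integral reduces to integrals in
  which a derivative has fallen on each of \<open>h\<close> and \<open>g\<close>; the terms in which two derivatives fall on \<open>g\<close> add up to its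
  Laplacian. The Fischer form satisfies the same recursion, by \<open>fischer_pdiff_sum\<close>.\<close>

lemma sph_harmonic:
  assumes "h \<in> hom d" "h \<in> harmonic" "g \<in> hom d'" "g \<in> harmonic"
  shows "sph (\<lambda>X. h X * sharp g X) = 2 * of_real pi ^ 2 * fischer sphere_weight h g"
  using assms
proof (induction d' arbitrary: d h g)
  case 0
  have hp: "h \<in> polys" "laplacian h = (\<lambda>Z. 0)" using 0 by (auto simp: harmonic_def)
  obtain c where g: "g = (\<lambda>Z. c)" using hom_0 0 by blast
  show ?case
  proof (cases d)
    case 0
    then obtain a where h: "h = (\<lambda>Z. a)" using hom_0 \<open>h \<in> hom d\<close> by blast
    have "fischer sphere_weight h g = a * cnj c" by (simp add: h g fischer_const sphere_weight_def)
    then show ?thesis by (simp add: g h sph_const[of "a * cnj c"])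
  next
    case (Suc e)
    have e: "pdiff p h \<in> polys" "euler (pdiff p h) = (\<lambda>Z. of_nat e * pdiff p h Z)" for p
      using hom_pdiff[of h e p] 0 Suc by (auto simp: hom_def)
    have "(of_nat e + 3) / 2 * (of_nat d * sph h) = (of_nat e + 3) / 2 * sph (euler h)"
      using 0 by (simp add: hom_def sph_cmult)
    also have "sph (euler h) = (\<Sum>p\<in>UNIV. sph (\<lambda>Z. ent Z p * pdiff p h Z))"
      using hp by (simp add: euler_def sum_entries sph_add)
    also have "(of_nat e + 3) / 2 * \<dots> = (\<Sum>p\<in>UNIV. sg p * sph (pdiff (opp p) (pdiff p h)))"
      unfolding sum_distrib_left sph_ent_mult[OF e] ..
    also have "\<dots> = 2 * sph (laplacian h)"
      using hp(1) by (simp add: sum_entries pdiff_sort laplacian_def sph_diff)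
    also have "\<dots> = 0" by (simp add: hp sph_const)
    finally have z: "(of_nat e + 3) / 2 * (of_nat d * sph h) = 0" .
    have "(of_nat (e + 3) :: complex) \<noteq> 0" "(of_nat d :: complex) \<noteq> 0"
      unfolding of_nat_eq_0_iff by (simp_all add: Suc)
    then have "sph h = 0" using z by simp
    moreover have "fischer sphere_weight h g = 0" by (rule fischer_hom_neq[OF \<open>h \<in> hom d\<close> \<open>g \<in> hom 0\<close>]) (simp add: Suc)
    ultimately show ?thesis using sph_cmult[of "cnj c" h] by (simp add: g mult.commute)
  qed
next
  case (Suc d')
  have hp: "h \<in> polys" "laplacian h = (\<lambda>Z. 0)" and gp: "g \<in> polys" "laplacian g = (\<lambda>Z. 0)"
    using Suc.prems by (auto simp: harmonic_def)
  let ?F = "\<lambda>p Z. h Z * sharp (pdiff p g) Z" and ?e = "(of_nat (d + d') + 3) / 2 :: complex"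
  have "?F p \<in> hom (d + d')" for p
    by (intro hom_mult hom_sharp hom_pdiff Suc.prems)
  then have F: "?F p \<in> polys" "euler (?F p) = (\<lambda>Z. of_nat (d + d') * ?F p Z)" for p
    by (auto simp: hom_def)
  have dF: "pdiff p (?F p) = (\<lambda>Z. pdiff p h Z * sharp (pdiff p g) Z
              + sg p * (h Z * sharp (pdiff (opp p) (pdiff p g)) Z))" for p
    using hp gp by (simp add: pdiff_sharp algebra_simps)
  have sF: "sph (pdiff p (?F p)) = sph (\<lambda>Z. pdiff p h Z * sharp (pdiff p g) Z)
              + sg p * sph (\<lambda>Z. h Z * sharp (pdiff (opp p) (pdiff p g)) Z)" for p
    unfolding dF using hp gp by (subst sph_add) (auto simp: sph_cmult)
  have "?e * (of_nat (Suc d') * sph (\<lambda>X. h X * sharp g X)) = ?e * sph (\<lambda>X. h X * sharp (euler g) X)"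
    using Suc.prems(3) sph_cmult[of "of_nat (Suc d')" "\<lambda>X. h X * sharp g X"]
    by (simp add: hom_def mult_ac del: of_nat_Suc)
  also have "sph (\<lambda>X. h X * sharp (euler g) X) = (\<Sum>p\<in>UNIV. sg p * sph (\<lambda>Z. ent Z (opp p) * ?F p Z))"
    using hp gp by (simp add: euler_def sum_entries sph_add sph_diff algebra_simps)
  also have "?e * \<dots> = (\<Sum>p\<in>UNIV. sg p * (?e * sph (\<lambda>Z. ent Z (opp p) * ?F p Z)))"
    by (simp add: sum_distrib_left mult_ac)
  also have "\<dots> = (\<Sum>p\<in>UNIV. sg p * (sg p * sph (pdiff p (?F p))))"
    using sph_ent_mult[OF F] by simp
  also have "\<dots> = (\<Sum>p\<in>UNIV. sph (\<lambda>Z. pdiff p h Z * sharp (pdiff p g) Z))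
      + (\<Sum>p\<in>UNIV. sg p * sph (\<lambda>Z. h Z * sharp (pdiff (opp p) (pdiff p g)) Z))"
    by (simp add: sF sum.distrib mult.assoc[symmetric])
  also have "(\<Sum>p\<in>UNIV. sg p * sph (\<lambda>Z. h Z * sharp (pdiff (opp p) (pdiff p g)) Z))
      = 2 * sph (\<lambda>Z. h Z * sharp (laplacian g) Z)"
    using hp(1) gp(1) by (simp add: sum_entries pdiff_sort laplacian_def sph_diff algebra_simps)
  also have "\<dots> = 0" by (simp add: gp sph_const)
  also have "(\<Sum>p\<in>UNIV. sph (\<lambda>Z. pdiff p h Z * sharp (pdiff p g) Z)) =
      2 * of_real pi ^ 2 * (\<Sum>p\<in>UNIV. fischer sphere_weight (pdiff p h) (pdiff p g))"
  proof (cases d)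
    case 0
    then obtain a where h: "h = (\<lambda>Z. a)" using hom_0 Suc.prems by blast
    then show ?thesis by (simp add: sph_const)
  next
    case (Suc e)
    then have "h \<in> hom (Suc e)" using Suc.prems by simp
    then have "sph (\<lambda>Z. pdiff p h Z * sharp (pdiff p g) Z) = 2 * of_real pi ^ 2 * fischer sphere_weight (pdiff p h) (pdiff p g)" for p
      by (intro Suc.IH[of _ e] hom_pdiff harmonic_pdiff Suc.prems)
    then show ?thesis by (simp add: sum_distrib_left)
  qed
  also have "(\<Sum>p\<in>UNIV. fischer sphere_weight (pdiff p h) (pdiff p g)) = ?e * (of_nat (Suc d') * fischer sphere_weight h g)"
  proof (cases "d = Suc d'")
    case True
    then have "?e = of_nat (Suc d)" by simp
    then show ?thesis using fischer_pdiff_sum[OF Suc.prems(1) gp(1)] True by (simp add: mult_ac del: of_nat_Suc)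
  next
    case False
    then show ?thesis using fischer_pdiff_sum[OF Suc.prems(1) gp(1)] fischer_hom_neq[OF Suc.prems(1,3)] by simp
  qed
  finally have "?e * (of_nat (Suc d') * sph (\<lambda>X. h X * sharp g X)) =
     ?e * (of_nat (Suc d') * (2 * of_real pi ^ 2 * fischer sphere_weight h g))" by (simp add: mult_ac)
  moreover have "?e \<noteq> 0"
  proof -
    have "(of_nat (d + d' + 3) :: complex) \<noteq> 0" unfolding of_nat_eq_0_iff by simp
    then show ?thesis by simp
  qed
  moreover have "(of_nat (Suc d') :: complex) \<noteq> 0" unfolding of_nat_eq_0_iff by simp
  ultimately show ?case by (simp only: mult_cancel_left) blast
qed

section \<open>Matrix coefficients as polynomials\<close>

lemma higher_deriv_monomial:
  "(deriv ^^ r) (\<lambda>s :: complex. s ^ k) = (\<lambda>s. of_nat ((k choose r) * fact r) * s ^ (k - r))"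
proof (induction r)
  case (Suc r)
  have "Suc r * (k choose Suc r) = (k - r) * (k choose r)"
    by (simp only: binomial_absorption binomial_absorb_comp)
  then have *: "(k choose Suc r) * fact (Suc r) = (k choose r) * fact r * (k - r)"
  proof -
    assume a: "Suc r * (k choose Suc r) = (k - r) * (k choose r)"
    have "(k choose Suc r) * fact (Suc r) = fact r * (Suc r * (k choose Suc r))"
      by (simp only: fact_Suc of_nat_id mult_ac)
    then show ?thesis unfolding a by (simp only: mult_ac)
  qed
  have "deriv (\<lambda>s :: complex. of_nat ((k choose r) * fact r) * s ^ (k - r))
      = (\<lambda>s. of_nat ((k choose r) * fact r) * (of_nat (k - r) * s ^ (k - r - 1)))"
    by (intro ext DERIV_imp_deriv) (auto intro!: derivative_eq_intros)
  also have "\<dots> = (\<lambda>s. of_nat ((k choose Suc r) * fact (Suc r)) * s ^ (k - Suc r))"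
    unfolding * by (simp add: mult.assoc)
  finally show ?case using Suc by simp
qed simp

lemma contour_integral_monomial:
  "((\<lambda>s. s ^ k / s ^ Suc r) has_contour_integral (if k = r then 2 * of_real pi * \<i> else 0)) (circlepath 0 1)"
proof -
  have "((\<lambda>s. s ^ k / (s - 0) ^ Suc r) has_contour_integral
     (2 * pi * \<i>) / fact r * (deriv ^^ r) (\<lambda>s. s ^ k) 0) (circlepath 0 1)"
    by (rule Cauchy_has_contour_integral_higher_derivative_circlepath)
       (auto intro!: continuous_intros holomorphic_intros)
  moreover have "(2 * pi * \<i>) / fact r * (deriv ^^ r) (\<lambda>s. s ^ k) 0 = (if k = r then 2 * of_real pi * \<i> else 0)"
    by (cases "r < k") (auto simp: higher_deriv_monomial power_0_left)
  ultimately show ?thesis by simp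
qed

text \<open>The coefficient of \<open>s ^ r\<close> in \<open>(s * z\<^sub>1\<^sub>1 + z\<^sub>2\<^sub>1) ^ c1 * (s * z\<^sub>1\<^sub>2 + z\<^sub>2\<^sub>2) ^ c2\<close>.\<close>

definition matrix_coeff :: "nat \<Rightarrow> nat \<Rightarrow> nat \<Rightarrow> hc \<Rightarrow> complex" where
  "matrix_coeff c1 c2 r Z = (\<Sum>a\<le>c1. \<Sum>b\<le>c2. if a + b = r then
      of_nat (c1 choose a) * of_nat (c2 choose b) *
      (ent Z (1,1) ^ a * ent Z (2,1) ^ (c1 - a) * (ent Z (1,2) ^ b * ent Z (2,2) ^ (c2 - b))) else 0)"

lemma tcoef_eq:
  assumes "l - m = real c1" "l + m = real c2" "l - n = real r"
  shows "tcoef l n m = matrix_coeff c1 c2 r"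
proof
  fix Z
  let ?A = "\<lambda>a b. of_nat (c1 choose a) * of_nat (c2 choose b) *
      (ent Z (1,1) ^ a * ent Z (2,1) ^ (c1 - a) * (ent Z (1,2) ^ b * ent Z (2,2) ^ (c2 - b)))"
  let ?f = "\<lambda>s. (s * Z$1$1 + Z$2$1) ^ c1 * (s * Z$1$2 + Z$2$2) ^ c2 * s powi (- int r) / s"
  have "((\<lambda>s. \<Sum>a\<le>c1. \<Sum>b\<le>c2. ?A a b * (s ^ (a + b) / s ^ Suc r)) has_contour_integral
     (\<Sum>a\<le>c1. \<Sum>b\<le>c2. ?A a b * (if a + b = r then 2 * of_real pi * \<i> else 0))) (circlepath 0 1)"
    by (intro has_contour_integral_sum has_contour_integral_lmul contour_integral_monomial) auto
  then have "(?f has_contour_integral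
     (\<Sum>a\<le>c1. \<Sum>b\<le>c2. ?A a b * (if a + b = r then 2 * of_real pi * \<i> else 0))) (circlepath 0 1)"
  proof (rule has_contour_integral_eq)
    fix s :: complex assume "s \<in> path_image (circlepath 0 1)"
    then have s: "s \<noteq> 0" by auto
    have "(s * Z$1$1 + Z$2$1) ^ c1 * (s * Z$1$2 + Z$2$2) ^ c2 = (\<Sum>a\<le>c1. \<Sum>b\<le>c2. ?A a b * s ^ (a + b))"
      by (simp add: binomial_ring sum_product ent_def power_mult_distrib power_add mult_ac)
    moreover have "s powi (- int r) / s = 1 / s ^ Suc r"
      using s by (simp add: power_int_minus divide_simps)
    ultimately have "?f s = (\<Sum>a\<le>c1. \<Sum>b\<le>c2. ?A a b * s ^ (a + b)) * (1 / s ^ Suc r)"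
      by (simp only: times_divide_eq_right[symmetric])
    then show "(\<Sum>a\<le>c1. \<Sum>b\<le>c2. ?A a b * (s ^ (a + b) / s ^ Suc r)) = ?f s"
      by (simp only: sum_distrib_right) (simp add: mult.assoc)
  qed
  then have "contour_integral (circlepath 0 1) ?f = 
     (\<Sum>a\<le>c1. \<Sum>b\<le>c2. ?A a b * (if a + b = r then 2 * of_real pi * \<i> else 0))"
    by (rule contour_integral_unique)
  also have "\<dots> = 2 * of_real pi * \<i> * matrix_coeff c1 c2 r Z"
    unfolding matrix_coeff_def sum_distrib_left by (intro sum.cong refl) auto
  finally have "1 / (2 * of_real pi * \<i>) * contour_integral (circlepath 0 1) ?f = matrix_coeff c1 c2 r Z"
    by simp
  moreover have "nat \<lfloor>l - m\<rfloor> = c1" "nat \<lfloor>l + m\<rfloor> = c2" using assms by auto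
  moreover have "\<lfloor>- l + n\<rfloor> = - int r"
    using assms(3) floor_of_int[of "- int r", where 'a = real] by (simp add: algebra_simps)
  ultimately show "tcoef l n m Z = matrix_coeff c1 c2 r Z" by (simp add: tcoef_def)
qed

text \<open>The two column sums and the first row sum; they determine the second row sum.\<close>

definition margins :: "(2 \<times> 2 \<Rightarrow> nat) \<Rightarrow> nat \<times> nat \<times> nat" where
  "margins \<alpha> = (\<alpha> (1,1) + \<alpha> (2,1), \<alpha> (1,2) + \<alpha> (2,2), \<alpha> (1,1) + \<alpha> (1,2))"

definition expo :: "nat \<Rightarrow> nat \<Rightarrow> nat \<Rightarrow> nat \<Rightarrow> 2 \<times> 2 \<Rightarrow> nat" where
  "expo a b c d p = (if p = (1,1) then a else if p = (1,2) then b else if p = (2,1) then c else d)"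

lemma expo_simps [simp]: "expo a b c d (1,1) = a" "expo a b c d (1,2) = b" "expo a b c d (2,1) = c" "expo a b c d (2,2) = d"
  by (auto simp: expo_def)

lemma eq_expo: "\<alpha> = expo (\<alpha> (1,1)) (\<alpha> (1,2)) (\<alpha> (2,1)) (\<alpha> (2,2))"
  unfolding fun_eq_iff forall_entries by simp

lemma prod_entries: "(\<Prod>p\<in>UNIV. f p) = f (1,1) * f (1,2) * f (2,1) * f (2,2)"
  for f :: "2 \<times> 2 \<Rightarrow> 'a::comm_monoid_mult"
proof -
  have "(UNIV :: (2 \<times> 2) set) = {(1,1), (1,2), (2,1), (2,2)}"
    by (auto simp: UNIV_2 simp flip: UNIV_Times_UNIV)
  then have "prod f UNIV = prod f {(1,1), (1,2), (2,1), (2,2)}" by (rule arg_cong)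
  then show ?thesis by (simp add: mult.assoc)
qed

lemma polys_eqI: "f \<in> polys \<Longrightarrow> g \<in> polys \<Longrightarrow> (\<And>\<alpha>. coeff4 f \<alpha> = coeff4 g \<alpha>) \<Longrightarrow> f = g"
  by (metis ev_coeff4 ext)

lemma finite_margins: "finite {\<alpha>. margins \<alpha> = \<mu>}"
proof -
  obtain c1 c2 r where \<mu>: "\<mu> = (c1, c2, r)" by (cases \<mu>)
  have "{\<alpha>. margins \<alpha> = \<mu>} \<subseteq> (\<lambda>(a, b). expo a b (c1 - a) (c2 - b)) ` ({..c1} \<times> {..c2})"
  proof
    fix \<alpha> assume "\<alpha> \<in> {\<alpha>. margins \<alpha> = \<mu>}"
    then show "\<alpha> \<in> (\<lambda>(a, b). expo a b (c1 - a) (c2 - b)) ` ({..c1} \<times> {..c2})"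
      using eq_expo[of \<alpha>] by (intro image_eqI[of _ _ "(\<alpha> (1,1), \<alpha> (1,2))"]) (auto simp: \<mu> margins_def)
  qed
  then show ?thesis by (rule finite_subset) auto
qed

lemma matrix_coeff_polys [simp, intro]: "matrix_coeff c1 c2 r \<in> polys"
proof -
  have "(\<lambda>Z. if a + b = r then f Z else 0) \<in> polys" if "f \<in> polys" for a b f
    using that by (cases "a + b = r") auto
  then show ?thesis unfolding matrix_coeff_def[abs_def] by (intro polys_sum) auto
qed

lemma coeff4_matrix_coeff:
  "coeff4 (matrix_coeff c1 c2 r) = (\<lambda>\<alpha>. if margins \<alpha> = (c1, c2, r) then of_real (fact c1 * fact c2 / mfact \<alpha>) else 0)"
  (is "_ = ?c")
proof (rule coeff4_eqI)
  have supp: "{\<alpha>. ?c \<alpha> \<noteq> 0} = {\<alpha>. margins \<alpha> = (c1, c2, r)}"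
    using mfact_pos by (auto simp: less_le)
  show "finite {\<alpha>. ?c \<alpha> \<noteq> 0}" unfolding supp by (rule finite_margins)
  show "matrix_coeff c1 c2 r = ev ?c"
  proof
    fix Z
    let ?h = "\<lambda>(a, b). expo a b (c1 - a) (c2 - b)" and ?P = "{(a, b). a \<le> c1 \<and> b \<le> c2 \<and> a + b = r}"
    let ?g = "\<lambda>a b. of_nat (c1 choose a) * of_nat (c2 choose b) *
      (ent Z (1,1) ^ a * ent Z (2,1) ^ (c1 - a) * (ent Z (1,2) ^ b * ent Z (2,2) ^ (c2 - b)))"
    have "ev ?c Z = (\<Sum>\<alpha> | margins \<alpha> = (c1, c2, r). ?c \<alpha> * monom4 \<alpha> Z)"
      unfolding ev_def supp ..
    also have "\<dots> = (\<Sum>(a, b)\<in>?P. ?g a b)"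
    proof (rule sum.reindex_bij_witness[of _ ?h "\<lambda>\<alpha>. (\<alpha> (1,1), \<alpha> (1,2))"])
      fix \<alpha> assume "\<alpha> \<in> {\<alpha>. margins \<alpha> = (c1, c2, r)}"
      then have \<alpha>: "c1 = \<alpha> (1,1) + \<alpha> (2,1)" "c2 = \<alpha> (1,2) + \<alpha> (2,2)" "r = \<alpha> (1,1) + \<alpha> (1,2)"
        by (auto simp: margins_def)
      show "?h (\<alpha> (1,1), \<alpha> (1,2)) = \<alpha>" using eq_expo[of \<alpha>] by (simp add: \<alpha>)
      show "(\<alpha> (1,1), \<alpha> (1,2)) \<in> ?P" by (simp add: \<alpha>)
      have "(of_real (fact c1 * fact c2 / mfact \<alpha>) :: complex) = of_nat (c1 choose \<alpha> (1,1)) * of_nat (c2 choose \<alpha> (1,2))"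
        by (simp add: \<alpha> binomial_fact mfact_def prod_entries)
      then show "(case (\<alpha> (1,1), \<alpha> (1,2)) of (a, b) \<Rightarrow> ?g a b) = ?c \<alpha> * monom4 \<alpha> Z"
        by (simp add: \<alpha> margins_def monom4_def prod_entries mult_ac)
    next
      fix x assume "x \<in> ?P"
      then show "((?h x) (1,1), (?h x) (1,2)) = x" "?h x \<in> {\<alpha>. margins \<alpha> = (c1, c2, r)}"
        by (auto simp: margins_def)
    qed
    also have "\<dots> = (\<Sum>(a, b)\<in>{..c1} \<times> {..c2}. if a + b = r then ?g a b else 0)"
      by (rule sum.mono_neutral_cong_left) (auto split: if_splits)
    also have "\<dots> = matrix_coeff c1 c2 r Z"
      by (simp add: matrix_coeff_def sum.cartesian_product)
    finally show "matrix_coeff c1 c2 r Z = ev ?c Z" ..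
  qed
qed

lemma matrix_coeff_hom: "matrix_coeff c1 c2 r \<in> hom (c1 + c2)"
proof -
  have "mdeg \<alpha> = c1 + c2" if "margins \<alpha> = (c1, c2, r)" for \<alpha>
    using that by (auto simp: mdeg_def sum_entries margins_def)
  then have "euler (matrix_coeff c1 c2 r) = (\<lambda>Z. of_nat (c1 + c2) * matrix_coeff c1 c2 r Z)"
    by (intro polys_eqI) (auto simp: coeff4_euler coeff4_matrix_coeff)
  then show ?thesis by (simp add: hom_def)
qed

definition up :: "2 \<times> 2 \<Rightarrow> (2 \<times> 2 \<Rightarrow> nat) \<Rightarrow> 2 \<times> 2 \<Rightarrow> nat" where
  "up p \<alpha> = \<alpha>(p := Suc (\<alpha> p))"

lemma coeff4_diff: "f \<in> polys \<Longrightarrow> g \<in> polys \<Longrightarrow> coeff4 (\<lambda>Z. f Z - g Z) = (\<lambda>\<alpha>. coeff4 f \<alpha> - coeff4 g \<alpha>)"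
  using coeff4_add[of f "\<lambda>Z. -1 * g Z"] coeff4_cmult[of g "-1"] by simp

text \<open>Multiplied by \<open>\<alpha>!\<close>, the coefficients absorb the factors produced by differentiation. Both
  exponents on the right have the same margins.\<close>

lemma mfact_coeff4_laplacian:
  assumes "f \<in> polys"
  shows "of_real (mfact \<alpha>) * coeff4 (laplacian f) \<alpha> =
     of_real (mfact (up (1,1) (up (2,2) \<alpha>))) * coeff4 f (up (1,1) (up (2,2) \<alpha>)) -
     of_real (mfact (up (1,2) (up (2,1) \<alpha>))) * coeff4 f (up (1,2) (up (2,1) \<alpha>))"
proof -
  have d: "coeff4 (pdiff p (pdiff q f)) \<alpha> = of_nat (Suc (\<alpha> p)) * of_nat (Suc (up p \<alpha> q)) * coeff4 f (up q (up p \<alpha>))" for p q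
    using assms by (simp add: coeff4_pdiff up_def del: of_nat_Suc)
  have m: "mfact (up q (up p \<alpha>)) = Suc (up p \<alpha> q) * (Suc (\<alpha> p) * mfact \<alpha>)" for p q
    using mfact_Suc[of "up p \<alpha>" q] mfact_Suc[of \<alpha> p] by (simp only: up_def)
  have c: "up p (up q \<alpha>) = up q (up p \<alpha>)" if "p \<noteq> q" for p q
    using that by (auto simp: up_def fun_upd_twist)
  have "coeff4 (laplacian f) \<alpha> = coeff4 (pdiff (1,1) (pdiff (2,2) f)) \<alpha> - coeff4 (pdiff (1,2) (pdiff (2,1) f)) \<alpha>"
    unfolding laplacian_def using assms by (simp add: coeff4_diff)
  then have e: "coeff4 (laplacian f) \<alpha> = of_nat (Suc (\<alpha> (1,1))) * of_nat (Suc (up (1,1) \<alpha> (2,2))) * coeff4 f (up (2,2) (up (1,1) \<alpha>))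
     - of_nat (Suc (\<alpha> (1,2))) * of_nat (Suc (up (1,2) \<alpha> (2,1))) * coeff4 f (up (2,1) (up (1,2) \<alpha>))"
    unfolding d .
  have c': "up (1,1) (up (2,2) \<alpha>) = up (2,2) (up (1,1) \<alpha>)" "up (1,2) (up (2,1) \<alpha>) = up (2,1) (up (1,2) \<alpha>)"
    by (rule c; simp)+
  show ?thesis
    unfolding e c' m by (simp only: right_diff_distrib of_real_mult of_real_of_nat_eq mult_ac)
qed

lemma matrix_coeff_harmonic: "matrix_coeff c1 c2 r \<in> harmonic"
proof -
  have "laplacian (matrix_coeff c1 c2 r) = (\<lambda>Z. 0)"
  proof (rule polys_eqI)
    fix \<alpha>
    have "margins (up (1,1) (up (2,2) \<alpha>)) = margins (up (1,2) (up (2,1) \<alpha>))"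
      by (simp add: margins_def up_def)
    moreover have "mfact \<beta> \<noteq> 0" for \<beta> using mfact_pos[of \<beta>] by simp
    ultimately have "of_real (mfact \<alpha>) * coeff4 (laplacian (matrix_coeff c1 c2 r)) \<alpha> = 0"
      unfolding mfact_coeff4_laplacian[OF matrix_coeff_polys] coeff4_matrix_coeff by simp
    then show "coeff4 (laplacian (matrix_coeff c1 c2 r)) \<alpha> = coeff4 (\<lambda>Z. 0) \<alpha>"
      using mfact_pos[of \<alpha>] by (simp add: coeff4_const)
  qed auto
  then show ?thesis by (simp add: harmonic_def)
qed

text \<open>Exponents with the same margins differ by a number of moves that lower both diagonal entries by one
  and raise both others. By \<open>mfact_coeff4_laplacian\<close> such a move changes nothing for a harmonic polynomial.\<close>

lemma harmonic_coeff4_margins: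
  assumes f: "f \<in> harmonic" and "margins \<alpha> = margins \<beta>"
  shows "of_real (mfact \<alpha>) * coeff4 f \<alpha> = of_real (mfact \<beta>) * coeff4 f \<beta>"
proof -
  let ?\<gamma> = "\<lambda>\<alpha>. of_real (mfact \<alpha>) * coeff4 f \<alpha>"
  have fp: "f \<in> polys" "laplacian f = (\<lambda>Z. 0)" using f by (auto simp: harmonic_def)
  have step: "?\<gamma> (expo (Suc a) b c (Suc d)) = ?\<gamma> (expo a (Suc b) (Suc c) d)" for a b c d
  proof -
    have "up (1,1) (up (2,2) (expo a b c d)) = expo (Suc a) b c (Suc d)"
         "up (1,2) (up (2,1) (expo a b c d)) = expo a (Suc b) (Suc c) d"
      unfolding fun_eq_iff forall_entries by (simp_all add: up_def)
    then show ?thesis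
      using mfact_coeff4_laplacian[OF fp(1), of "expo a b c d"] by (simp add: fp(2) coeff4_const)
  qed
  have shift: "?\<gamma> (expo (a + k) b c (d + k)) = ?\<gamma> (expo a (b + k) (c + k) d)" for a b c d k
  proof (induction k arbitrary: b c)
    case (Suc k)
    show ?case using step[of "a + k" b c "d + k"] Suc[of "Suc b" "Suc c"] by simp
  qed simp
  have wlog: "?\<gamma> \<alpha> = ?\<gamma> \<beta>" if m: "margins \<alpha> = margins \<beta>" and le: "\<beta> (1,1) \<le> \<alpha> (1,1)" for \<alpha> \<beta>
  proof -
    define k where "k = \<alpha> (1,1) - \<beta> (1,1)"
    have "\<alpha> = expo (\<beta> (1,1) + k) (\<alpha> (1,2)) (\<alpha> (2,1)) (\<beta> (2,2) + k)"
      "\<beta> = expo (\<beta> (1,1)) (\<alpha> (1,2) + k) (\<alpha> (2,1) + k) (\<beta> (2,2))"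
      unfolding fun_eq_iff forall_entries using m le by (auto simp: k_def margins_def)
    then show ?thesis using shift by metis
  qed
  show ?thesis
    using wlog[OF assms(2)] wlog[OF assms(2)[symmetric]] by (cases "\<beta> (1,1) \<le> \<alpha> (1,1)") auto
qed

text \<open>Grouped by margins, the coefficients of a harmonic polynomial are proportional to those of the
  matrix coefficient with these margins.\<close>

lemma harmonic_expansion:
  assumes f: "f \<in> harmonic"
  shows "\<exists>k M. finite M \<and> (\<forall>(c1, c2, r)\<in>M. r \<le> c1 + c2) \<and>
    f = (\<lambda>Z. \<Sum>\<mu>\<in>M. k \<mu> * matrix_coeff (fst \<mu>) (fst (snd \<mu>)) (snd (snd \<mu>)) Z)"
proof -
  let ?T = "\<lambda>\<mu>. matrix_coeff (fst \<mu>) (fst (snd \<mu>)) (snd (snd \<mu>))"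
  have fp: "f \<in> polys" using f by (auto simp: harmonic_def)
  let ?S = "{\<alpha>. coeff4 f \<alpha> \<noteq> 0}"
  have S: "finite ?S" using finite_coeff4[OF fp] .
  have "\<exists>k. \<forall>Z. (\<Sum>\<alpha> | \<alpha> \<in> ?S \<and> margins \<alpha> = \<mu>. coeff4 f \<alpha> * monom4 \<alpha> Z) = k * ?T \<mu> Z" if \<mu>S: "\<mu> \<in> margins ` ?S" for \<mu>
  proof -
    obtain \<beta> where \<beta>: "\<beta> \<in> ?S" "margins \<beta> = \<mu>" using \<mu>S by (metis (no_types, lifting) imageE)
    obtain c1 c2 r where \<mu>: "\<mu> = (c1, c2, r)" by (cases \<mu>)
    let ?k = "of_real (mfact \<beta> / (fact c1 * fact c2)) * coeff4 f \<beta>"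
    have c: "coeff4 f \<alpha> = ?k * coeff4 (?T \<mu>) \<alpha>" if "margins \<alpha> = \<mu>" for \<alpha>
    proof -
      have "of_real (mfact \<alpha>) * coeff4 f \<alpha> = of_real (mfact \<beta>) * coeff4 f \<beta>"
        by (rule harmonic_coeff4_margins[OF f]) (simp add: that \<beta>)
      moreover have "mfact \<alpha> \<noteq> 0" using mfact_pos[of \<alpha>] by simp
      ultimately have "coeff4 f \<alpha> = of_real (mfact \<beta> / mfact \<alpha>) * coeff4 f \<beta>"
        by (simp add: field_simps)
      then show ?thesis using that by (simp add: coeff4_matrix_coeff \<mu>)
    qed
    have nz: "coeff4 f \<alpha> \<noteq> 0" if "margins \<alpha> = \<mu>" for \<alpha>
      unfolding c[OF that] using that \<beta>(1) mfact_pos[of \<alpha>] mfact_pos[of \<beta>]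
      by (simp add: \<mu> coeff4_matrix_coeff)
    have "(\<Sum>\<alpha> | \<alpha> \<in> ?S \<and> margins \<alpha> = \<mu>. coeff4 f \<alpha> * monom4 \<alpha> Z) = ?k * ?T \<mu> Z" for Z
    proof -
      have "{\<alpha>. \<alpha> \<in> ?S \<and> margins \<alpha> = \<mu>} = {\<alpha>. margins \<alpha> = \<mu>}" using nz by auto
      then have "(\<Sum>\<alpha> | \<alpha> \<in> ?S \<and> margins \<alpha> = \<mu>. coeff4 f \<alpha> * monom4 \<alpha> Z)
          = (\<Sum>\<alpha> | margins \<alpha> = \<mu>. ?k * (coeff4 (?T \<mu>) \<alpha> * monom4 \<alpha> Z))"
        by (intro sum.cong) (simp_all add: c mult.assoc)
      also have "\<dots> = ?k * (\<Sum>\<alpha> | margins \<alpha> = \<mu>. coeff4 (?T \<mu>) \<alpha> * monom4 \<alpha> Z)"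
        by (rule sum_distrib_left[symmetric])
      also have "(\<Sum>\<alpha> | margins \<alpha> = \<mu>. coeff4 (?T \<mu>) \<alpha> * monom4 \<alpha> Z) = ev (coeff4 (?T \<mu>)) Z"
        by (rule ev_superset[symmetric]) (auto simp: finite_margins coeff4_matrix_coeff \<mu>)
      finally show ?thesis by (simp add: ev_coeff4)
    qed
    then show ?thesis by (intro exI[of _ ?k] allI)
  qed
  then have "\<forall>\<mu>\<in>margins ` ?S. \<exists>k. \<forall>Z. (\<Sum>\<alpha> | \<alpha> \<in> ?S \<and> margins \<alpha> = \<mu>. coeff4 f \<alpha> * monom4 \<alpha> Z) = k * ?T \<mu> Z"
    by (rule ballI)
  then obtain k where k: "\<forall>\<mu>\<in>margins ` ?S. \<forall>Z.
      (\<Sum>\<alpha> | \<alpha> \<in> ?S \<and> margins \<alpha> = \<mu>. coeff4 f \<alpha> * monom4 \<alpha> Z) = k \<mu> * ?T \<mu> Z"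
    by (rule bchoice[THEN exE])
  have "f Z = (\<Sum>\<mu>\<in>margins ` ?S. k \<mu> * ?T \<mu> Z)" for Z
  proof -
    have "f Z = (\<Sum>\<alpha>\<in>?S. coeff4 f \<alpha> * monom4 \<alpha> Z)" using fun_cong[OF ev_coeff4[OF fp], of Z] by (simp add: ev_def)
    also have "\<dots> = (\<Sum>\<mu>\<in>margins ` ?S. \<Sum>\<alpha> | \<alpha> \<in> ?S \<and> margins \<alpha> = \<mu>. coeff4 f \<alpha> * monom4 \<alpha> Z)"
      by (rule sum.image_gen[OF S])
    also have "\<dots> = (\<Sum>\<mu>\<in>margins ` ?S. k \<mu> * ?T \<mu> Z)"
      using k by (intro sum.cong refl) blast
    finally show ?thesis .
  qed
  then show ?thesis
    using S by (intro exI[of _ k] exI[of _ "margins ` ?S"]) (auto simp: margins_def)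
qed

section \<open>The span of the basis functions\<close>

lemma cspan_superset: "f \<in> S \<Longrightarrow> f \<in> cspan S"
  and cspan_add: "f \<in> cspan S \<Longrightarrow> g \<in> cspan S \<Longrightarrow> (\<lambda>Z. f Z + g Z) \<in> cspan S"
  and cspan_cmult: "f \<in> cspan S \<Longrightarrow> (\<lambda>Z. c * f Z) \<in> cspan S"
  and cspan_0: "(\<lambda>Z. 0) \<in> cspan S"
  and cspan_least: "S \<subseteq> T \<Longrightarrow> (\<lambda>Z. 0) \<in> T \<Longrightarrow> (\<And>f g. f \<in> T \<Longrightarrow> g \<in> T \<Longrightarrow> (\<lambda>Z. f Z + g Z) \<in> T) \<Longrightarrow>
     (\<And>c f. f \<in> T \<Longrightarrow> (\<lambda>Z. c * f Z) \<in> T) \<Longrightarrow> cspan S \<subseteq> T"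
proof -
  interpret vs: vector_space "\<lambda>(c::complex) (f :: hc \<Rightarrow> complex) Z. c * f Z"
    by (rule vector_space_functions)
  show "f \<in> S \<Longrightarrow> f \<in> cspan S" unfolding cspan_def by (rule vs.span_base)
  show "f \<in> cspan S \<Longrightarrow> g \<in> cspan S \<Longrightarrow> (\<lambda>Z. f Z + g Z) \<in> cspan S"
    unfolding cspan_def using vs.span_add by (auto simp: plus_fun_def)
  show "f \<in> cspan S \<Longrightarrow> (\<lambda>Z. c * f Z) \<in> cspan S" unfolding cspan_def by (rule vs.span_scale)
  show "(\<lambda>Z. 0) \<in> cspan S" unfolding cspan_def using vs.span_zero by (simp add: zero_fun_def)
  assume "S \<subseteq> T" "(\<lambda>Z. 0) \<in> T" "\<And>f g. f \<in> T \<Longrightarrow> g \<in> T \<Longrightarrow> (\<lambda>Z. f Z + g Z) \<in> T"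
     "\<And>c f. f \<in> T \<Longrightarrow> (\<lambda>Z. c * f Z) \<in> T"
  then show "cspan S \<subseteq> T" unfolding cspan_def
    by (intro vs.span_minimal vs.subspaceI) (auto simp: zero_fun_def plus_fun_def)
qed

lemma cspan_sum: "(\<And>x. x \<in> A \<Longrightarrow> f x \<in> cspan S) \<Longrightarrow> (\<lambda>Z. \<Sum>x\<in>A. f x Z) \<in> cspan S"
proof (induction A rule: infinite_finite_induct)
  case (insert x A)
  then show ?case using cspan_add[of "f x" S "\<lambda>Z. \<Sum>x\<in>A. f x Z"] by simp
qed (auto simp: cspan_0)

lemma idx1_nat:
  assumes "(l, m, n) \<in> idx1"
  obtains c1 c2 r where "l - m = real c1" "l + m = real c2" "l - n = real r" "r \<le> c1 + c2"
proof -
  obtain k :: nat where k: "l = real k / 2" using assms by (auto simp: idx1_def half_nats_def)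
  have w: "m - l \<in> \<int>" "- l \<le> m" "m \<le> l" "n - l \<in> \<int>" "- l \<le> n" "n \<le> l"
    using assms by (auto simp: idx1_def weights_def)
  obtain i j :: int where i: "m - l = real_of_int i" "n - l = real_of_int j" using w by (auto elim!: Ints_cases)
  show ?thesis
  proof
    show "l - m = real (nat (- i))" "l - n = real (nat (- j))" using i w by auto
    show "l + m = real (nat (int k + i))" using i w k by auto
    have "real_of_int j \<ge> - real k" using i w k by auto
    then have "- j \<le> int k" by linarith
    moreover have "i \<le> 0" "- i \<le> int k" using i w k by linarith+
    ultimately show "nat (- j) \<le> nat (- i) + nat (int k + i)" by linarith
  qed
qed

lemma nat_idx1:
  assumes "r \<le> c1 + c2"
  shows "((real c1 + real c2) / 2, (real c2 - real c1) / 2, (real c1 + real c2) / 2 - real r) \<in> idx1"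
proof -
  have "(real c2 - real c1) / 2 - (real c1 + real c2) / 2 = - real c1" by (simp add: field_simps)
  then have "(real c2 - real c1) / 2 - (real c1 + real c2) / 2 \<in> \<int>" by simp
  moreover have "(real c1 + real c2) / 2 \<in> half_nats"
    unfolding half_nats_def by (auto intro!: exI[of _ "c1 + c2"])
  moreover have "real r \<le> real c1 + real c2" using assms by linarith
  ultimately show ?thesis
    unfolding idx1_def weights_def by (auto simp: field_simps)
qed

lemma idx2_iff: "(l, m, n) \<in> idx2 \<longleftrightarrow> (l - 1, m, n) \<in> idx1"
proof
  assume a: "(l, m, n) \<in> idx2"
  then obtain k :: nat where k: "l = real k / 2" by (auto simp: idx2_def half_nats_def)
  have "1 \<le> l" using a by (auto simp: idx2_def weights_def)
  then have "l - 1 = real (k - 2) / 2" using k by (simp add: of_nat_diff field_simps)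
  then show "(l - 1, m, n) \<in> idx1" using a by (auto simp: idx1_def idx2_def half_nats_def)
next
  assume a: "(l - 1, m, n) \<in> idx1"
  then obtain k :: nat where k: "l - 1 = real k / 2" by (auto simp: idx1_def half_nats_def)
  then have "l = real (k + 2) / 2" by (simp add: field_simps)
  then show "(l, m, n) \<in> idx2" using a unfolding idx1_def idx2_def half_nats_def by blast
qed

lemma phi1_eq:
  assumes "(l, m, n) \<in> idx1"
  obtains c1 c2 r where "phi1 l m n = matrix_coeff c1 c2 r" "2 * l = real (c1 + c2)" "r \<le> c1 + c2"
proof -
  from idx1_nat[OF assms] obtain c1 c2 r where
    c: "l - m = real c1" "l + m = real c2" "l - n = real r" "r \<le> c1 + c2" .
  show ?thesis
    by (rule that[of c1 c2 r]) (use c tcoef_eq[OF c(1-3)] in \<open>auto simp: phi1_def fun_eq_iff\<close>)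
qed

lemma phi2_eq_phi1: "phi2 l m n = (\<lambda>Z. det Z * phi1 (l - 1) m n Z)"
  by (auto simp: phi2_def phi1_def)

lemma matrix_coeff_eq_phi1:
  assumes "r \<le> c1 + c2"
  shows "\<exists>l m n. (l, m, n) \<in> idx1 \<and> matrix_coeff c1 c2 r = phi1 l m n"
proof (intro exI conjI)
  show "((real c1 + real c2) / 2, (real c2 - real c1) / 2, (real c1 + real c2) / 2 - real r) \<in> idx1"
    by (rule nat_idx1[OF assms])
  show "matrix_coeff c1 c2 r = phi1 ((real c1 + real c2) / 2) ((real c2 - real c1) / 2) ((real c1 + real c2) / 2 - real r)"
    unfolding phi1_def by (intro ext fun_cong[OF tcoef_eq[symmetric]]) (simp_all add: field_simps)
qed

lemma det_mult_biharmonic: "k \<in> harmonic \<Longrightarrow> (\<lambda>Z. det Z * k Z) \<in> biharmonic"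
  by (simp add: biharmonic_def harmonic_def laplacian_det_mult laplacian_euler) (simp add: euler_def)

lemma harmonic_biharmonic: "f \<in> harmonic \<Longrightarrow> f \<in> biharmonic"
  by (simp add: biharmonic_def harmonic_def)

lemma biharmonic_add: "f \<in> biharmonic \<Longrightarrow> g \<in> biharmonic \<Longrightarrow> (\<lambda>Z. f Z + g Z) \<in> biharmonic"
  and biharmonic_cmult: "f \<in> biharmonic \<Longrightarrow> (\<lambda>Z. c * f Z) \<in> biharmonic"
  and biharmonic_const: "(\<lambda>Z. c) \<in> biharmonic"
  by (simp_all add: biharmonic_def)

lemma biharmonic_sum: "(\<And>x. x \<in> A \<Longrightarrow> f x \<in> biharmonic) \<Longrightarrow> (\<lambda>Z. \<Sum>x\<in>A. f x Z) \<in> biharmonic"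
proof (induction A rule: infinite_finite_induct)
  case (insert x A)
  then show ?case using biharmonic_add[of "f x" "\<lambda>Z. \<Sum>x\<in>A. f x Z"] by simp
qed (auto simp: biharmonic_const)

lemma phi1_harmonic:
  assumes "(l, m, n) \<in> idx1" shows "phi1 l m n \<in> harmonic"
  using phi1_eq[OF assms] matrix_coeff_harmonic by metis

lemma laplacian_sum: "(\<And>x. x \<in> A \<Longrightarrow> f x \<in> polys) \<Longrightarrow>
   laplacian (\<lambda>Z. \<Sum>x\<in>A. f x Z) = (\<lambda>Z. \<Sum>x\<in>A. laplacian (f x) Z)"
  by (simp add: laplacian_def sum_subtractf)

text \<open>The Laplacian of a biharmonic polynomial \<open>f\<close> is a combination of matrix coefficients, each of
  which is up to a nonzero factor the Laplacian of its own product with the determinant.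
  The corresponding combination of these products differs from \<open>f\<close> by a harmonic polynomial.\<close>

lemma BHplus_eq: "BHplus = biharmonic"
proof
  let ?G = "{phi1 l m n | l m n. (l, m, n) \<in> idx1} \<union> {phi2 l m n | l m n. (l, m, n) \<in> idx2}"
  show "BHplus \<subseteq> biharmonic"
    unfolding BHplus_def
  proof (rule cspan_least)
    show "?G \<subseteq> biharmonic"
      by (auto simp: idx2_iff phi2_eq_phi1 intro: det_mult_biharmonic harmonic_biharmonic phi1_harmonic)
  qed (auto intro: biharmonic_add biharmonic_cmult biharmonic_const)
  let ?T = "\<lambda>\<mu>. matrix_coeff (fst \<mu>) (fst (snd \<mu>)) (snd (snd \<mu>))"
  have T: "matrix_coeff c1 c2 r \<in> BHplus" "(\<lambda>Z. det Z * matrix_coeff c1 c2 r Z) \<in> BHplus" if r: "r \<le> c1 + c2" for c1 c2 r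
  proof -
    obtain l m n where l: "(l, m, n) \<in> idx1" "matrix_coeff c1 c2 r = phi1 l m n"
      using matrix_coeff_eq_phi1[OF r] by blast
    then show "matrix_coeff c1 c2 r \<in> BHplus" unfolding BHplus_def by (intro cspan_superset) blast
    have "(l + 1, m, n) \<in> idx2" "(\<lambda>Z. det Z * matrix_coeff c1 c2 r Z) = phi2 (l + 1) m n"
      using l by (simp_all add: idx2_iff phi2_eq_phi1)
    then show "(\<lambda>Z. det Z * matrix_coeff c1 c2 r Z) \<in> BHplus" unfolding BHplus_def
      by (intro cspan_superset) blast
  qed
  have harm: "f \<in> BHplus" if f: "f \<in> harmonic" for f
  proof -
    obtain k M where M: "finite M" "\<forall>(c1, c2, r)\<in>M. r \<le> c1 + c2" "f = (\<lambda>Z. \<Sum>\<mu>\<in>M. k \<mu> * ?T \<mu> Z)"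
      using harmonic_expansion[OF f] by blast
    have "?T \<mu> \<in> BHplus" if "\<mu> \<in> M" for \<mu> using M(2) that by (intro T) auto
    then show ?thesis unfolding M(3) BHplus_def by (intro cspan_sum cspan_cmult)
  qed
  show "biharmonic \<subseteq> BHplus"
  proof
    fix f assume "f \<in> biharmonic"
    then have f: "f \<in> polys" "laplacian f \<in> harmonic" by (auto simp: biharmonic_def harmonic_def)
    obtain k M where M: "finite M" "\<forall>(c1, c2, r)\<in>M. r \<le> c1 + c2" "laplacian f = (\<lambda>Z. \<Sum>\<mu>\<in>M. k \<mu> * ?T \<mu> Z)"
      using harmonic_expansion[OF f(2)] by blast
    let ?d = "\<lambda>\<mu>. of_nat (fst \<mu> + fst (snd \<mu>) + 2) :: complex"
    \<comment> \<open>\<open>det Z * ?T \<mu> Z\<close> has Laplacian \<open>?d \<mu> * ?T \<mu> Z\<close>, since \<open>?T \<mu>\<close> is harmonic of degree \<open>?d \<mu> - 2\<close>\<close>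
    let ?g = "\<lambda>Z. \<Sum>\<mu>\<in>M. k \<mu> / ?d \<mu> * (det Z * ?T \<mu> Z)"
    have g: "?g \<in> BHplus"
      unfolding BHplus_def
    proof (intro cspan_sum cspan_cmult, fold BHplus_def)
      fix \<mu> assume "\<mu> \<in> M"
      then show "(\<lambda>Z. det Z * ?T \<mu> Z) \<in> BHplus" using M(2) by (intro T) auto
    qed
    have gp: "?g \<in> polys" by (intro polys_sum polys_mult polys_const det_polys matrix_coeff_polys)
    have dT: "laplacian (\<lambda>Z. det Z * ?T \<mu> Z) = (\<lambda>Z. ?d \<mu> * ?T \<mu> Z)" for \<mu>
    proof -
      have "euler (?T \<mu>) = (\<lambda>Z. of_nat (fst \<mu> + fst (snd \<mu>)) * ?T \<mu> Z)" "laplacian (?T \<mu>) = (\<lambda>Z. 0)"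
        using matrix_coeff_hom matrix_coeff_harmonic by (auto simp: hom_def harmonic_def)
      then show ?thesis by (simp add: laplacian_det_mult algebra_simps)
    qed
    have d0: "?d \<mu> \<noteq> 0" for \<mu> :: "nat \<times> nat \<times> nat" unfolding of_nat_eq_0_iff by simp
    have "laplacian ?g = (\<lambda>Z. \<Sum>\<mu>\<in>M. laplacian (\<lambda>Z. k \<mu> / ?d \<mu> * (det Z * ?T \<mu> Z)) Z)"
      by (rule laplacian_sum) (intro polys_mult polys_const det_polys matrix_coeff_polys)
    also have "\<dots> = laplacian f"
      unfolding M(3)
    proof (intro ext sum.cong refl)
      fix Z \<mu>
      have "laplacian (\<lambda>Z. k \<mu> / ?d \<mu> * (det Z * ?T \<mu> Z)) Z = k \<mu> / ?d \<mu> * (?d \<mu> * ?T \<mu> Z)"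
        by (subst laplacian_cmult) (simp_all only: dT polys_mult det_polys matrix_coeff_polys)
      then show "laplacian (\<lambda>Z. k \<mu> / ?d \<mu> * (det Z * ?T \<mu> Z)) Z = k \<mu> * ?T \<mu> Z"
        using d0[of \<mu>] by (simp del: of_nat_add)
    qed
    finally have "laplacian ?g = laplacian f" .
    then have "(\<lambda>Z. f Z - ?g Z) \<in> harmonic" using f gp by (simp add: harmonic_def)
    from cspan_add[OF harm[OF this, unfolded BHplus_def] g[unfolded BHplus_def]]
    show "f \<in> BHplus" unfolding BHplus_def by simp
  qed
qed

section \<open>Differentiable families of matrices\<close>

definition mat_deriv :: "(real \<Rightarrow> complex^'n^'m) \<Rightarrow> complex^'n^'m \<Rightarrow> bool" where
  "mat_deriv M M' \<longleftrightarrow> (\<forall>i j. ((\<lambda>t. M t $ i $ j) has_vector_derivative M' $ i $ j) (at 0))"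

lemma mat_deriv_mult:
  assumes "mat_deriv M M'" "mat_deriv N N'"
  shows "mat_deriv (\<lambda>t. M t ** N t) (M' ** N 0 + M 0 ** N')"
  unfolding mat_deriv_def
proof (intro allI)
  fix i j
  have "((\<lambda>t. \<Sum>k\<in>UNIV. M t $ i $ k * N t $ k $ j) has_vector_derivative
      (\<Sum>k\<in>UNIV. M 0 $ i $ k * N' $ k $ j + M' $ i $ k * N 0 $ k $ j)) (at 0)"
    using assms unfolding mat_deriv_def
    by (intro has_vector_derivative_sum has_vector_derivative_mult) auto
  then show "((\<lambda>t. (M t ** N t) $ i $ j) has_vector_derivative (M' ** N 0 + M 0 ** N') $ i $ j) (at 0)"
    by (simp add: matrix_matrix_mult_def sum.distrib add.commute)
qed

lemma mat_deriv_add: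
  "mat_deriv M M' \<Longrightarrow> mat_deriv N N' \<Longrightarrow> mat_deriv (\<lambda>t. M t + N t) (M' + N')"
  unfolding mat_deriv_def by (auto intro!: has_vector_derivative_add)

lemma mat_deriv_const: "mat_deriv (\<lambda>t. M) 0"
  unfolding mat_deriv_def by auto

lemma differentiable_prod_finite:
  fixes f :: "'i \<Rightarrow> real \<Rightarrow> complex"
  shows "(\<And>i. i \<in> A \<Longrightarrow> f i differentiable at t) \<Longrightarrow> (\<lambda>t. \<Prod>i\<in>A. f i t) differentiable at t"
  by (induction A rule: infinite_finite_induct) auto

lemma differentiable_det:
  fixes M :: "real \<Rightarrow> complex^'n^'n"
  assumes "\<And>i j. (\<lambda>t. M t $ i $ j) differentiable at t"
  shows "(\<lambda>t. det (M t)) differentiable at t"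
  unfolding det_def
  by (rule differentiable_sum[OF finite_permutations[OF finite]] ballI differentiable_mult
        differentiable_const differentiable_prod_finite assms)+

lemma matrix_inv_mult:
  assumes "invertible (A :: 'a::field^'n^'n)"
  shows "A ** matrix_inv A = mat 1" "matrix_inv A ** A = mat 1"
  using someI_ex[OF assms[unfolded invertible_def]] unfolding matrix_inv_def by auto

lemma matrix_inv_eqI:
  fixes A :: "'a::field^'n^'n"
  assumes "A ** B = mat 1" shows "matrix_inv A = B"
proof -
  have "invertible A" using assms by (auto simp: invertible_right_inverse)
  then have "matrix_inv A ** (A ** B) = B" using matrix_inv_mult(2) by (metis matrix_mul_assoc matrix_mul_lid)
  then show ?thesis using assms by simp
qed

lemma matrix_inv_cramer:
  fixes A :: "'a::field^'n^'n"
  assumes "det A \<noteq> 0"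
  shows "matrix_inv A $ k $ l = det (\<chi> i j. if j = k then (if i = l then 1 else 0) else A $ i $ j) / det A"
proof -
  have A: "invertible A" using assms by (simp add: invertible_det_nz)
  define x where "x = (\<chi> i. matrix_inv A $ i $ l)"
  define b :: "'a^'n" where "b = (\<chi> i. if i = l then 1 else 0)"
  have "A *v x = b"
  proof -
    have "(A *v x) $ i = (A ** matrix_inv A) $ i $ l" for i
      by (simp add: x_def matrix_vector_mult_def matrix_matrix_mult_def)
    then show ?thesis using matrix_inv_mult(1)[OF A] by (simp add: b_def vec_eq_iff mat_def)
  qed
  then have "x = (\<chi> k. det (\<chi> i j. if j = k then b $ i else A $ i $ j) / det A)"
    by (rule cramer[OF assms, THEN iffD1])
  then have "x $ k = det (\<chi> i j. if j = k then b $ i else A $ i $ j) / det A"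
    by (metis (no_types) vec_lambda_beta)
  then show ?thesis unfolding x_def b_def vec_lambda_beta .
qed

lemma mat_deriv_imp_differentiable:
  "mat_deriv M M' \<Longrightarrow> (\<lambda>t. M t $ i $ j) differentiable at 0"
  unfolding mat_deriv_def by (metis differentiableI_vector)

lemma mat_deriv_eventually_invertible:
  assumes "mat_deriv M M'" "invertible (M 0)"
  shows "\<forall>\<^sub>F t in nhds 0. invertible (M t :: complex^'n^'n)"
proof -
  have "isCont (\<lambda>t. det (M t)) 0"
    by (rule differentiable_imp_continuous_within, rule differentiable_det)
       (rule mat_deriv_imp_differentiable[OF assms(1)])
  then have "((\<lambda>t. det (M t)) \<longlongrightarrow> det (M 0)) (nhds 0)"
    unfolding isCont_def by (rule tendsto_at_iff_tendsto_nhds[THEN iffD1])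
  then have "\<forall>\<^sub>F t in nhds 0. det (M t) \<noteq> 0"
    by (rule tendsto_imp_eventually_ne) (use assms(2) in \<open>simp add: invertible_det_nz\<close>)
  then show ?thesis by (simp add: invertible_det_nz)
qed

lemma matrix_mult_uminus: "A ** (- B) = - (A ** B)" "(- A) ** B = - (A ** (B :: complex^'n^'n))"
  by (auto simp: matrix_matrix_mult_def vec_eq_iff sum_negf)

text \<open>Cramer's formula shows that the entries of the inverse are differentiable. The value of the
  derivative then follows from the product rule for \<open>M t ** matrix_inv (M t) = mat 1\<close>.\<close>

lemma mat_deriv_inverse:
  fixes M :: "real \<Rightarrow> complex^'n^'n"
  assumes M: "mat_deriv M M'" and inv: "invertible (M 0)"
  shows "mat_deriv (\<lambda>t. matrix_inv (M t)) (- (matrix_inv (M 0) ** M' ** matrix_inv (M 0)))"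
proof -
  let ?Q = "\<lambda>t. matrix_inv (M t)"
  note ev = mat_deriv_eventually_invertible[OF M inv]
  have "(\<lambda>t. ?Q t $ k $ l) differentiable at 0" for k l
  proof -
    let ?C = "\<lambda>t. det (\<chi> i j. if j = k then (if i = l then 1 else 0) else M t $ i $ j) / det (M t)"
    have "?C differentiable at 0"
    proof (rule differentiable_divide)
      have "(\<lambda>t. if j = k then (if i = l then 1 else 0) else M t $ i $ j) differentiable at 0" for i j
        using mat_deriv_imp_differentiable[OF M] by (cases "j = k") auto
      then show "(\<lambda>t. det (\<chi> i j. if j = k then (if i = l then 1 else 0) else M t $ i $ j)) differentiable at 0"
        by (intro differentiable_det) simp
      show "(\<lambda>t. det (M t)) differentiable at 0"
        by (rule differentiable_det) (use mat_deriv_imp_differentiable[OF M] in auto)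
      show "det (M 0) \<noteq> 0" using inv by (simp add: invertible_det_nz)
    qed
    then have C: "(?C has_vector_derivative vector_derivative ?C (at 0)) (at 0)"
      by (simp add: vector_derivative_works)
    have "\<forall>\<^sub>F t in nhds 0. ?Q t $ k $ l = ?C t"
      using ev by eventually_elim (rule matrix_inv_cramer, simp add: invertible_det_nz)
    then have "((\<lambda>t. ?Q t $ k $ l) has_vector_derivative vector_derivative ?C (at 0)) (at 0)"
      using C by (subst has_vector_derivative_cong_ev[where g = ?C])
         (auto elim: eventually_mono dest: eventually_nhds_x_imp_x)
    then show ?thesis by (rule differentiableI_vector)
  qed
  then have Q: "mat_deriv ?Q (\<chi> k l. vector_derivative (\<lambda>t. ?Q t $ k $ l) (at 0))" (is "mat_deriv _ ?Q'")
    unfolding mat_deriv_def by (simp add: vector_derivative_works)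
  have "M' ** ?Q 0 + M 0 ** ?Q' = 0"
  proof -
    have "(M' ** ?Q 0 + M 0 ** ?Q') $ i $ j = 0" for i j
    proof (rule vector_derivative_unique_at)
      show "((\<lambda>t. (M t ** ?Q t) $ i $ j) has_vector_derivative (M' ** ?Q 0 + M 0 ** ?Q') $ i $ j) (at 0)"
        using mat_deriv_mult[OF M Q] unfolding mat_deriv_def by blast
      have "\<forall>\<^sub>F t in nhds 0. (M t ** ?Q t) $ i $ j = mat 1 $ i $ j"
        using ev by eventually_elim (simp add: matrix_inv_mult)
      then show "((\<lambda>t. (M t ** ?Q t) $ i $ j) has_vector_derivative 0) (at 0)"
        by (subst has_vector_derivative_cong_ev[where g = "\<lambda>_. mat 1 $ i $ j"])
           (auto elim: eventually_mono dest: eventually_nhds_x_imp_x)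
    qed
    then show ?thesis by (simp add: vec_eq_iff)
  qed
  then have "?Q 0 ** (M 0 ** ?Q') = ?Q 0 ** (- (M' ** ?Q 0))"
    by (metis add_eq_0_iff2 add.commute)
  then have "?Q' = - (?Q 0 ** M' ** ?Q 0)"
    by (simp add: matrix_mul_assoc matrix_inv_mult[OF inv] matrix_mult_uminus)
  then show ?thesis using Q by simp
qed

section \<open>The matrix exponential\<close>

definition mpow :: "'a::comm_semiring_1^'n^'n \<Rightarrow> nat \<Rightarrow> 'a^'n^'n" where
  "mpow A k = (((**) A) ^^ k) (mat 1)"

lemma mpow_Suc: "mpow A (Suc k) = A ** mpow A k" and mpow_0: "mpow A 0 = mat 1"
  by (simp_all add: mpow_def)

lemma scaleR_matrix_mult: "(t *\<^sub>R A) ** B = t *\<^sub>R (A ** B)" "A ** (t *\<^sub>R B) = t *\<^sub>R (A ** (B :: complex^'n^'n))"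
  by (auto simp: matrix_matrix_mult_def vec_eq_iff scaleR_sum_right)

lemma mpow_scaleR: "mpow (t *\<^sub>R (A :: complex^'n^'n)) k = t ^ k *\<^sub>R mpow A k"
  by (induction k) (simp_all add: mpow_Suc mpow_0 scaleR_matrix_mult)

lemma norm_mpow_entry:
  fixes A :: "complex^'n^'n"
  shows "norm (mpow A k $ i $ j) \<le> (\<Sum>i\<in>UNIV. \<Sum>j\<in>UNIV. norm (A $ i $ j)) ^ k"
proof (induction k arbitrary: i j)
  case (Suc k)
  let ?C = "\<Sum>i\<in>UNIV. \<Sum>j\<in>UNIV. norm (A $ i $ j)"
  have "norm (mpow A (Suc k) $ i $ j) = norm (\<Sum>l\<in>UNIV. A $ i $ l * mpow A k $ l $ j)"
    by (simp add: mpow_Suc matrix_matrix_mult_def)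
  also have "\<dots> \<le> (\<Sum>l\<in>UNIV. norm (A $ i $ l) * ?C ^ k)"
    by (rule sum_norm_le) (auto simp: norm_mult intro!: mult_left_mono Suc.IH)
  also have "\<dots> = (\<Sum>l\<in>UNIV. norm (A $ i $ l)) * ?C ^ k" by (simp add: sum_distrib_right)
  also have "\<dots> \<le> ?C * ?C ^ k"
    by (intro mult_right_mono member_le_sum zero_le_power sum_nonneg) (auto intro: sum_nonneg)
  finally show ?case by simp
qed (auto simp: mpow_0 mat_def)

lemma summable_mexp_entry:
  fixes A :: "gl2hc" and z :: complex
  shows "summable (\<lambda>k. mpow A k $ i $ j / fact k * z ^ k)"
proof (rule summable_comparison_test')
  let ?C = "\<Sum>i\<in>UNIV. \<Sum>j\<in>UNIV. norm (A $ i $ j)"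
  show "summable (\<lambda>k. inverse (fact k) * (?C * norm z) ^ k)" by (rule summable_exp)
  show "norm (mpow A k $ i $ j / fact k * z ^ k) \<le> inverse (fact k) * (?C * norm z) ^ k" for k
    using mult_right_mono[OF norm_mpow_entry[of A k i j], of "norm z ^ k / fact k"]
    by (simp add: norm_mult norm_divide norm_power power_mult_distrib divide_simps)
qed

lemma mexp_entry:
  "mexp (t *\<^sub>R A) $ i $ j = (\<Sum>k. mpow A k $ i $ j / fact k * of_real t ^ k)"
proof -
  let ?f = "\<lambda>k. (1 / fact k) *\<^sub>R mpow (t *\<^sub>R A) k"
  let ?S = "\<chi> i j. \<Sum>k. mpow A k $ i $ j / fact k * of_real t ^ k"
  have e: "?f k $ i $ j = mpow A k $ i $ j / fact k * of_real t ^ k" for k i j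
    by (simp only: mpow_scaleR vector_scaleR_component) (simp add: scaleR_conv_of_real)
  have "?f sums ?S"
    unfolding sums_def
  proof (intro vec_tendstoI)
    fix i j
    have "(\<lambda>k. mpow A k $ i $ j / fact k * of_real t ^ k) sums (?S $ i $ j)"
      using summable_sums[OF summable_mexp_entry[of A i j "of_real t"]] by simp
    then show "(\<lambda>n. (\<Sum>k<n. ?f k) $ i $ j) \<longlonglongrightarrow> ?S $ i $ j"
      unfolding sums_def sum_component e .
  qed
  then have "mexp (t *\<^sub>R A) = ?S" by (simp add: mexp_def mpow_def sums_iff)
  then show ?thesis by simp
qed

lemma mat_deriv_mexp: "mat_deriv (\<lambda>t. mexp (t *\<^sub>R A)) A"
  unfolding mat_deriv_def
proof (intro allI)
  fix i j
  let ?c = "\<lambda>k. mpow A k $ i $ j / fact k"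
  have "((\<lambda>z. \<Sum>k. ?c k * z ^ k) has_field_derivative (\<Sum>k. diffs ?c k * 0 ^ k)) (at 0)"
    by (rule termdiffs_strong_converges_everywhere) (rule summable_mexp_entry)
  moreover have "(\<Sum>k. diffs ?c k * 0 ^ k) = A $ i $ j"
    by (subst powser_zero) (simp add: diffs_def mpow_def)
  ultimately have "((\<lambda>z. \<Sum>k. ?c k * z ^ k) has_field_derivative A $ i $ j) (at (of_real 0))" by simp
  from has_vector_derivative_real_field[OF this]
  show "((\<lambda>t. mexp (t *\<^sub>R A) $ i $ j) has_vector_derivative A $ i $ j) (at 0)"
    by (simp add: mexp_entry)
qed

lemma mexp_0: "mexp 0 = mat 1"
proof -
  have "mexp (0 *\<^sub>R A) = mat 1" for A
    unfolding vec_eq_iff mexp_entry[of 0] by (simp only: of_real_0 powser_zero) (simp add: mpow_0)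
  then show ?thesis by simp
qed

section \<open>The infinitesimal conformal action\<close>

text \<open>The derivative at \<open>t = 0\<close> of the fractional linear action of \<open>exp (- t Y)\<close>.\<close>

definition vfield :: "gl2hc \<Rightarrow> hc \<Rightarrow> hc" where
  "vfield Y Z = Z ** (blk21 Y ** Z + blk22 Y) - blk11 Y ** Z - blk12 Y"

definition moebius :: "gl2hc \<Rightarrow> hc \<Rightarrow> hc" where
  "moebius g Z = (blk11 g ** Z + blk12 g) ** matrix_inv (blk21 g ** Z + blk22 g)"

lemma blk_mat_1 [simp]: "blk11 (mat 1) = mat 1" "blk12 (mat 1) = 0" "blk21 (mat 1) = 0" "blk22 (mat 1) = mat 1"
  by (auto simp: blk11_def blk12_def blk21_def blk22_def mat_def vec_eq_iff)

lemma blk_uminus [simp]: "blk11 (- Y) = - blk11 Y" "blk12 (- Y) = - blk12 Y" "blk21 (- Y) = - blk21 Y" "blk22 (- Y) = - blk22 Y"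
  by (auto simp: blk11_def blk12_def blk21_def blk22_def vec_eq_iff)

lemma mat_deriv_blk:
  assumes "mat_deriv g g'"
  shows "mat_deriv (\<lambda>t. blk11 (g t)) (blk11 g')" "mat_deriv (\<lambda>t. blk12 (g t)) (blk12 g')"
    "mat_deriv (\<lambda>t. blk21 (g t)) (blk21 g')" "mat_deriv (\<lambda>t. blk22 (g t)) (blk22 g')"
  using assms by (auto simp: mat_deriv_def blk11_def blk12_def blk21_def blk22_def)

lemma invertible_mat_1: "invertible (mat 1 :: 'a::field^'n^'n)"
  by (simp add: invertible_det_nz)

lemma matrix_inv_mat_1 [simp]: "matrix_inv (mat 1 :: 'a::field^'n^'n) = mat 1"
  by (rule matrix_inv_eqI) simp

lemma mat_deriv_moebius:
  "mat_deriv (\<lambda>t. moebius (matrix_inv (mexp (t *\<^sub>R Y))) Z) (vfield Y Z)"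
proof -
  let ?g = "\<lambda>t. matrix_inv (mexp (t *\<^sub>R Y))"
  have g: "mat_deriv ?g (- Y)"
    using mat_deriv_inverse[OF mat_deriv_mexp[of Y]] by (simp add: mexp_0 invertible_mat_1)
  note b = mat_deriv_blk[OF g]
  have n: "mat_deriv (\<lambda>t. blk11 (?g t) ** Z + blk12 (?g t)) (- (blk11 Y ** Z) - blk12 Y)"
    using mat_deriv_add[OF mat_deriv_mult[OF b(1) mat_deriv_const[of Z]] b(2)]
    by (simp add: matrix_mult_uminus)
  have d: "mat_deriv (\<lambda>t. blk21 (?g t) ** Z + blk22 (?g t)) (- (blk21 Y ** Z) - blk22 Y)"
    using mat_deriv_add[OF mat_deriv_mult[OF b(3) mat_deriv_const[of Z]] b(4)]
    by (simp add: matrix_mult_uminus)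
  have i: "mat_deriv (\<lambda>t. matrix_inv (blk21 (?g t) ** Z + blk22 (?g t))) (blk21 Y ** Z + blk22 Y)"
    using mat_deriv_inverse[OF d] by (simp add: mexp_0 invertible_mat_1 add.commute)
  show ?thesis
    using mat_deriv_mult[OF n i] by (simp add: moebius_def mexp_0 vfield_def algebra_simps)
qed

lemma moebius_0: "moebius (matrix_inv (mexp (0 *\<^sub>R Y))) Z = Z"
  by (simp add: moebius_def mexp_0)

definition lie :: "gl2hc \<Rightarrow> (hc \<Rightarrow> complex) \<Rightarrow> hc \<Rightarrow> complex" where
  "lie Y f Z = (\<Sum>p\<in>UNIV. ent (vfield Y Z) p * pdiff p f Z)"

lemma polys_mat_deriv:
  assumes "f \<in> polys" "mat_deriv M M'"
  shows "((\<lambda>t. f (M t)) has_vector_derivative (\<Sum>p\<in>UNIV. ent M' p * pdiff p f (M 0))) (at 0)"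
  using polys_has_vector_derivative[OF assms(1), of M "ent M'" 0 UNIV] assms(2)
  by (simp add: mat_deriv_def ent_def)

lemma rho'_polys:
  assumes "f \<in> polys" shows "rho' UNIV Y f = lie Y f"
proof
  fix Z
  have "((\<lambda>t. rho_group (mexp (t *\<^sub>R Y)) f Z) has_vector_derivative lie Y f Z) (at 0)"
    using polys_mat_deriv[OF assms mat_deriv_moebius[of Y Z]]
    by (simp add: rho_group_def Let_def moebius_def[symmetric] lie_def moebius_0[simplified])
  then show "rho' UNIV Y f Z = lie Y f Z" by (simp add: rho'_def vector_derivative_at)
qed

section \<open>Inversion\<close>

definition pullback_inv :: "(hc \<Rightarrow> complex) \<Rightarrow> hc \<Rightarrow> complex" where
  "pullback_inv f Z = (if Z \<in> GL2 then f (matrix_inv Z) else 0)"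

text \<open>Conjugation by the matrix of the fractional linear map \<open>Z \<mapsto> Z\<^sup>-\<^sup>1\<close>.\<close>

definition block_swap :: "gl2hc \<Rightarrow> gl2hc" where
  "block_swap Y = (\<chi> i j. Y $ (case i of Inl a \<Rightarrow> Inr a | Inr a \<Rightarrow> Inl a) $ (case j of Inl a \<Rightarrow> Inr a | Inr a \<Rightarrow> Inl a))"

lemma blk_block_swap [simp]: "blk11 (block_swap Y) = blk22 Y" "blk12 (block_swap Y) = blk21 Y"
   "blk21 (block_swap Y) = blk12 Y" "blk22 (block_swap Y) = blk11 Y"
  by (simp_all add: blk11_def blk12_def blk21_def blk22_def block_swap_def)

lemma adj_adj: "adj (adj A) = A" by (simp add: adj_def vec_eq_iff)

lemma block_swap_u22: "Y \<in> u22 \<Longrightarrow> block_swap Y \<in> u22"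
  by (auto simp: u22_def adj_adj)

lemma GL2_invertible: "Z \<in> GL2 \<longleftrightarrow> invertible Z"
  by (simp add: GL2_def invertible_det_nz)

lemma matrix_add_right: "(A + B) ** C = A ** C + B ** (C :: hc)"
  by (simp add: matrix_matrix_mult_def vec_eq_iff sum.distrib algebra_simps)

lemma vfield_inverse:
  assumes "invertible Z"
  shows "- (matrix_inv Z ** vfield Y Z ** matrix_inv Z) = vfield (block_swap Y) (matrix_inv Z)"
proof -
  let ?I = "matrix_inv Z"
  have a: "X - Y = X + - Y" for X Y :: hc by simp
  have 1: "?I ** (Z ** A) = A" "A ** ?I ** Z = A" for A
    using matrix_inv_mult[OF assms] by (simp_all add: matrix_mul_assoc) (simp_all flip: matrix_mul_assoc)
  have 2: "(A ** Z) ** ?I = A" for A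
    using matrix_inv_mult[OF assms] by (simp flip: matrix_mul_assoc)
  show ?thesis
    unfolding vfield_def a matrix_add_ldistrib matrix_add_right matrix_mult_uminus blk_block_swap
    by (simp add: 1 2 matrix_mul_assoc[symmetric] matrix_inv_mult[OF assms])
qed

lemma rho'_pullback_inv:
  assumes f: "f \<in> polys"
  shows "rho' GL2 Y (pullback_inv f) = pullback_inv (rho' UNIV (block_swap Y) f)"
proof
  fix Z
  show "rho' GL2 Y (pullback_inv f) Z = pullback_inv (rho' UNIV (block_swap Y) f) Z"
  proof (cases "Z \<in> GL2")
    case True
    let ?m = "\<lambda>t. moebius (matrix_inv (mexp (t *\<^sub>R Y))) Z"
    have Z: "invertible Z" "invertible (?m 0)" using True by (simp_all only: GL2_invertible moebius_0)
    have i: "mat_deriv (\<lambda>t. matrix_inv (?m t)) (vfield (block_swap Y) (matrix_inv Z))"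
      using mat_deriv_inverse[OF mat_deriv_moebius Z(2)] unfolding moebius_0 vfield_inverse[OF Z(1)] .
    have "((\<lambda>t. f (matrix_inv (?m t))) has_vector_derivative lie (block_swap Y) f (matrix_inv Z)) (at 0)"
      using polys_mat_deriv[OF f i] unfolding moebius_0 lie_def .
    moreover have "\<forall>\<^sub>F t in nhds 0. pullback_inv f (?m t) = f (matrix_inv (?m t))"
      using mat_deriv_eventually_invertible[OF mat_deriv_moebius Z(2)]
      by eventually_elim (simp add: pullback_inv_def GL2_invertible)
    ultimately have "((\<lambda>t. pullback_inv f (?m t)) has_vector_derivative lie (block_swap Y) f (matrix_inv Z)) (at 0)"
      by (subst has_vector_derivative_cong_ev[where g = "\<lambda>t. f (matrix_inv (?m t))"])
         (auto elim: eventually_mono dest: eventually_nhds_x_imp_x)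
    then have "rho' GL2 Y (pullback_inv f) Z = lie (block_swap Y) f (matrix_inv Z)"
      using True by (simp add: rho'_def rho_group_def Let_def moebius_def[symmetric] vector_derivative_at)
    then show ?thesis using True by (simp add: pullback_inv_def rho'_polys[OF f])
  qed (simp add: rho'_def pullback_inv_def)
qed

section \<open>Non-degenerate descent to a quotient\<close>

lemma descends_nondegenerateI:
  assumes B: "hermitian_form V B" and WV: "W \<subseteq> V" and W0: "(\<lambda>Z. 0) \<in> W"
    and Vd: "\<And>f g. f \<in> V \<Longrightarrow> g \<in> V \<Longrightarrow> (\<lambda>Z. f Z - g Z) \<in> V"
    and Wd: "\<And>f g. f \<in> W \<Longrightarrow> g \<in> W \<Longrightarrow> (\<lambda>Z. f Z - g Z) \<in> W"
    and null: "\<And>w g. w \<in> W \<Longrightarrow> g \<in> V \<Longrightarrow> B w g = 0"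
    and radical: "\<And>f. f \<in> V \<Longrightarrow> (\<And>g. g \<in> V \<Longrightarrow> B f g = 0) \<Longrightarrow> f \<in> W"
  shows "descends_nondegenerate V W B"
proof -
  let ?R = "coset_rel V W"
  have left: "B f g = B f' g" if "(f, f') \<in> ?R" "g \<in> V" for f f' g
  proof -
    have f: "f \<in> V" "f' \<in> V" "(\<lambda>Z. f Z - f' Z) \<in> W" using that by (auto simp: coset_rel_def)
    have "B (\<lambda>Z. 1 * f' Z + 1 * (f Z - f' Z)) g = 1 * B f' g + 1 * B (\<lambda>Z. f Z - f' Z) g"
      by (rule B[unfolded hermitian_form_def, THEN conjunct1, rule_format, OF f(2) Vd[OF f(1,2)] that(2)])
    then show ?thesis using null[OF f(3) that(2)] by simp
  qed
  have sym: "B g f = cnj (B f g)" if "f \<in> V" "g \<in> V" for f g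
    by (rule B[unfolded hermitian_form_def, THEN conjunct2, rule_format, OF that])
  define q where "q C D = B (SOME f. f \<in> C) (SOME g. g \<in> D)" for C D
  have rep: "(f, SOME f'. f' \<in> ?R `` {f}) \<in> ?R" if "f \<in> V" for f
  proof -
    have "f \<in> ?R `` {f}" using that W0 by (simp add: coset_rel_def)
    then have "(SOME f'. f' \<in> ?R `` {f}) \<in> ?R `` {f}" unfolding some_in_eq by blast
    then show ?thesis by simp
  qed
  have q: "q (?R `` {f}) (?R `` {g}) = B f g" if "f \<in> V" "g \<in> V" for f g
  proof -
    have V: "(SOME f'. f' \<in> ?R `` {f}) \<in> V" "(SOME g'. g' \<in> ?R `` {g}) \<in> V"
      using rep[OF that(1)] rep[OF that(2)] by (auto simp: coset_rel_def)
    have "B f g = B (SOME f'. f' \<in> ?R `` {f}) g" by (rule left[OF rep]) (use that in auto)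
    also have "\<dots> = cnj (B g (SOME f'. f' \<in> ?R `` {f}))" by (rule sym) (use that V in auto)
    also have "B g (SOME f'. f' \<in> ?R `` {f}) = B (SOME g'. g' \<in> ?R `` {g}) (SOME f'. f' \<in> ?R `` {f})"
      by (rule left[OF rep]) (use that V in auto)
    also have "cnj \<dots> = B (SOME f'. f' \<in> ?R `` {f}) (SOME g'. g' \<in> ?R `` {g})"
      by (rule sym[symmetric]) (use V in auto)
    finally show ?thesis unfolding q_def ..
  qed
  have "C = W" if C: "C \<in> V // ?R" and 0: "\<forall>D\<in>V // ?R. q C D = 0" for C
  proof -
    obtain f where f: "f \<in> V" "C = ?R `` {f}" using C by (rule quotientE)
    have "B f g = 0" if "g \<in> V" for g
      using 0[rule_format, OF quotientI[OF that]] q[OF f(1) that] unfolding f(2) by simp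
    then have fW: "f \<in> W" by (rule radical[OF f(1)])
    show ?thesis
    proof (intro equalityI subsetI)
      fix g assume "g \<in> C"
      then have "(\<lambda>Z. f Z - g Z) \<in> W" by (simp add: f(2) coset_rel_def)
      from Wd[OF fW this] show "g \<in> W" by simp
    next
      fix g assume "g \<in> W"
      moreover from Wd[OF fW this] have "(\<lambda>Z. f Z - g Z) \<in> W" .
      ultimately show "g \<in> C" using WV f(1) by (auto simp: f(2) coset_rel_def)
    qed
  qed
  then have "(\<forall>f\<in>V. \<forall>g\<in>V. q (?R `` {f}) (?R `` {g}) = B f g) \<and>
      (\<forall>C\<in>V // ?R. (\<forall>D\<in>V // ?R. q C D = 0) \<longrightarrow> C = W)"
    using q by (intro conjI ballI impI)
  then show ?thesis unfolding descends_nondegenerate_def by (intro conjI[OF WV] exI[of _ q])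
qed

section \<open>Invariance under u(2,2)\<close>

lemma bform_sum_left: "(\<And>x. x \<in> A \<Longrightarrow> f x \<in> polys) \<Longrightarrow> bform (\<lambda>Z. \<Sum>x\<in>A. f x Z) h = (\<Sum>x\<in>A. bform (f x) h)"
  by (simp add: bform_def laplacian_sum sum_subtractf)

text \<open>\<open>conf_op\<close> is indexed by the position transposed to that of the matrix unit, hence the
  exchange of indices in its coefficient.\<close>

lemma lie_eq:
  "lie Y f = (\<lambda>Z. \<Sum>p\<in>UNIV. ent (blk21 Y) (snd p, fst p) * conf_op p f Z - ent (blk12 Y) p * pdiff p f Z
     - ent (blk11 Y) p * left_op (fst p) (snd p) f Z + ent (blk22 Y) p * right_op (fst p) (snd p) f Z)"
proof
  fix Z
  have v: "ent (vfield Y Z) (i, j) = ent Z (i,1) * (ent (blk21 Y) (1,1) * ent Z (1,j) + ent (blk21 Y) (1,2) * ent Z (2,j) + ent (blk22 Y) (1,j))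
       + ent Z (i,2) * (ent (blk21 Y) (2,1) * ent Z (1,j) + ent (blk21 Y) (2,2) * ent Z (2,j) + ent (blk22 Y) (2,j))
       - (ent (blk11 Y) (i,1) * ent Z (1,j) + ent (blk11 Y) (i,2) * ent Z (2,j)) - ent (blk12 Y) (i,j)" for i j
    by (simp add: vfield_def ent_diff ent_mult)
  show "lie Y f Z = (\<Sum>p\<in>UNIV. ent (blk21 Y) (snd p, fst p) * conf_op p f Z - ent (blk12 Y) p * pdiff p f Z
     - ent (blk11 Y) p * left_op (fst p) (snd p) f Z + ent (blk22 Y) p * right_op (fst p) (snd p) f Z)"
    unfolding lie_def sum_entries v
    by (simp add: conf_op_def left_op_def right_op_def euler_def sum_entries det_ent) algebra
qed

lemma biharmonic_pdiff: "f \<in> biharmonic \<Longrightarrow> pdiff p f \<in> biharmonic"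
  by (simp add: biharmonic_def pdiff_laplacian[symmetric])

lemma biharmonic_left_op: "f \<in> biharmonic \<Longrightarrow> left_op i k f \<in> biharmonic"
  by (cases "i = k") (simp_all add: biharmonic_def laplacian_left_op, simp_all add: left_op_def)

lemma biharmonic_right_op: "f \<in> biharmonic \<Longrightarrow> right_op i k f \<in> biharmonic"
  by (cases "i = k") (simp_all add: biharmonic_def laplacian_right_op, simp_all add: right_op_def)

lemma biharmonic_conf_op: "f \<in> biharmonic \<Longrightarrow> conf_op p f \<in> biharmonic"
  using laplacian_laplacian_conf_op by (simp add: biharmonic_def)

lemma biharmonic_diff: "f \<in> biharmonic \<Longrightarrow> g \<in> biharmonic \<Longrightarrow> (\<lambda>Z. f Z - g Z) \<in> biharmonic"
  by (simp add: biharmonic_def)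

lemma biharmonic_lie: "f \<in> biharmonic \<Longrightarrow> lie Y f \<in> biharmonic"
  unfolding lie_eq
  by (intro biharmonic_sum biharmonic_add biharmonic_diff biharmonic_cmult biharmonic_conf_op
        biharmonic_pdiff biharmonic_left_op biharmonic_right_op)

lemma bform_lie_left:
  assumes f: "f \<in> biharmonic" and g: "g \<in> biharmonic"
  shows "bform (lie Y f) g = (\<Sum>p\<in>UNIV. ent (blk21 Y) (snd p, fst p) * bform f (pdiff p g)
     - ent (blk12 Y) p * bform f (conf_op p g) - ent (blk11 Y) p * bform f (left_op (snd p) (fst p) g)
     + ent (blk22 Y) p * bform f (right_op (snd p) (fst p) g))"
proof -
  have fp: "f \<in> polys" "g \<in> polys" using f g by (auto simp: biharmonic_def)
  show ?thesis
    unfolding lie_eq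
    by (subst bform_sum_left)
       (use fp in \<open>simp_all add: bform_conf_op[OF fp(1) g] bform_pdiff[OF f fp(2)] bform_left_op bform_right_op\<close>)
qed

lemma bform_lie_right:
  assumes f: "f \<in> biharmonic" and g: "g \<in> biharmonic"
  shows "bform f (lie Y g) = (\<Sum>p\<in>UNIV. cnj (ent (blk21 Y) (snd p, fst p)) * bform f (conf_op p g)
     - cnj (ent (blk12 Y) p) * bform f (pdiff p g) - cnj (ent (blk11 Y) p) * bform f (left_op (fst p) (snd p) g)
     + cnj (ent (blk22 Y) p) * bform f (right_op (fst p) (snd p) g))"
proof -
  have fp: "f \<in> polys" "g \<in> polys" using f g by (auto simp: biharmonic_def)
  have "bform f (lie Y g) = cnj (bform (lie Y g) f)"
    by (rule bform_sym) (use fp biharmonic_lie[OF g] in \<open>auto simp: biharmonic_def\<close>)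
  also have "bform (lie Y g) f = (\<Sum>p\<in>UNIV. ent (blk21 Y) (snd p, fst p) * bform (conf_op p g) f
     - ent (blk12 Y) p * bform (pdiff p g) f - ent (blk11 Y) p * bform (left_op (fst p) (snd p) g) f
     + ent (blk22 Y) p * bform (right_op (fst p) (snd p) g) f)"
    unfolding lie_eq by (subst bform_sum_left) (use fp in simp_all)
  also have "cnj \<dots> = (\<Sum>p\<in>UNIV. cnj (ent (blk21 Y) (snd p, fst p)) * cnj (bform (conf_op p g) f)
     - cnj (ent (blk12 Y) p) * cnj (bform (pdiff p g) f) - cnj (ent (blk11 Y) p) * cnj (bform (left_op (fst p) (snd p) g) f)
     + cnj (ent (blk22 Y) p) * cnj (bform (right_op (fst p) (snd p) g) f))"
    by simp
  finally show ?thesis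
    using fp by (simp add: bform_sym[of _ f, symmetric])
qed

text \<open>The operators are adjoint in pairs: \<open>pdiff p\<close> with \<open>conf_op p\<close>, and the linear fields with those of
  the transposed matrix units. The equations of u(2,2) say that the two coefficients in each
  pair contribute with opposite signs.\<close>

lemma bform_u22:
  assumes f: "f \<in> biharmonic" and g: "g \<in> biharmonic" and Y: "Y \<in> u22"
  shows "bform (lie Y f) g + bform f (lie Y g) = 0"
proof -
  have "ent (blk11 Y) (j, i) = - cnj (ent (blk11 Y) (i, j))" "ent (blk22 Y) (j, i) = - cnj (ent (blk22 Y) (i, j))"
    "ent (blk21 Y) (j, i) = cnj (ent (blk12 Y) (i, j))" for i j
  proof -
    have adj: "ent (adj M) (j, i) = cnj (ent M (i, j))" for M by (simp add: ent_def adj_def)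
    have neg: "ent (- M) p = - ent M p" for M p by (simp add: ent_def)
    show "ent (blk11 Y) (j, i) = - cnj (ent (blk11 Y) (i, j))" "ent (blk22 Y) (j, i) = - cnj (ent (blk22 Y) (i, j))"
      "ent (blk21 Y) (j, i) = cnj (ent (blk12 Y) (i, j))"
      using Y unfolding u22_def mem_Collect_eq by (metis adj neg)+
  qed
  note e = this
  have A: "cnj (ent (blk11 Y) (i, j)) = - ent (blk11 Y) (j, i)"
    and D: "cnj (ent (blk22 Y) (i, j)) = - ent (blk22 Y) (j, i)" for i j
    using e(1)[of j i] e(2)[of j i] by simp_all
  show ?thesis
    unfolding bform_lie_left[OF f g] bform_lie_right[OF f g] sum_entries fst_conv snd_conv A D e(3)
    by (simp add: algebra_simps)
qed

section \<open>Values on the basis functions\<close>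

lemma bform_ent: "bform (\<lambda>Z. ent Z p) (\<lambda>Z. ent Z p) = 1"
  using fischer_ent_mult[of "\<lambda>Z. 1" "\<lambda>Z. ent Z p" form_weight p]
  by (simp add: bform_def pdiff_ent fischer_const form_weight_def) (simp add: laplacian_def pdiff_ent)

lemma bform_det: "bform (\<lambda>Z. det Z) (\<lambda>Z. det Z) = - 2"
proof -
  have "laplacian (\<lambda>Z. det Z * 1) = (\<lambda>Z. 2)"
    by (subst laplacian_det_mult) (simp_all add: euler_def)
  then have l: "laplacian (\<lambda>Z. det Z) = (\<lambda>Z. 2)" by simp
  have "bform (\<lambda>Z. det Z) (\<lambda>Z. det Z * 1) = - 2"
    by (subst bform_det_mult) (simp_all add: l harmonic_def fischer_const sphere_weight_def)
  then show ?thesis by simp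
qed

lemma integral_S3_harmonic:
  assumes "h \<in> hom d" "h \<in> harmonic" "g \<in> hom d'" "g \<in> harmonic"
  shows "sph (\<lambda>X. h X * cnj (g X)) = 2 * of_real pi ^ 2 * fischer sphere_weight h g"
proof -
  have "sph (\<lambda>X. h X * cnj (g X)) = sph (\<lambda>X. h X * sharp g X)"
    by (rule sph_cong) (simp add: sharp_S3)
  then show ?thesis using sph_harmonic[OF assms] by simp
qed

lemma bform_harmonic:
  assumes h: "h \<in> hom d" "h \<in> harmonic" and g: "g \<in> hom d'" "g \<in> harmonic"
  shows "bform h g = of_real (real d * (real d + 1) / (2 * pi\<^sup>2)) * sph (\<lambda>X. h X * cnj (g X))"
proof -
  have w: "form_weight = (\<lambda>n. real n * (real n * sphere_weight n + sphere_weight n))"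
  proof
    fix n show "form_weight n = real n * (real n * sphere_weight n + sphere_weight n)"
      by (cases n) (auto simp: form_weight_def sphere_weight_def divide_simps)
  qed
  have "bform h g = fischer form_weight h g" using h g by (simp add: bform_def harmonic_def)
  also have "\<dots> = of_nat d * fischer (\<lambda>n. real n * sphere_weight n + sphere_weight n) h g"
    unfolding w by (rule fischer_hom[OF h(1)])
  also have "\<dots> = of_nat d * (of_nat d + 1) * fischer sphere_weight h g"
    by (simp add: fischer_weight_add fischer_hom[OF h(1)] algebra_simps)
  finally show ?thesis by (simp add: integral_S3_harmonic[OF h g])
qed

lemma bform_det_harmonic:
  assumes h: "h \<in> hom e" "h \<in> harmonic" and g: "g \<in> hom d'" "g \<in> harmonic"
  shows "bform (\<lambda>Z. det Z * h Z) (\<lambda>Z. det Z * g Z)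
    = - of_real ((real e + 2) * (real e + 1) / (2 * pi\<^sup>2)) * sph (\<lambda>X. (det X * h X) * cnj (det X * g X))"
proof -
  have hp: "h \<in> polys" "laplacian h = (\<lambda>Z. 0)" "euler h = (\<lambda>Z. of_nat e * h Z)"
    using h by (auto simp: hom_def harmonic_def)
  have l: "laplacian (\<lambda>Z. det Z * h Z) = (\<lambda>Z. (of_nat e + 2) * h Z)"
    using hp by (simp add: laplacian_det_mult algebra_simps)
  have "(\<lambda>d. real (Suc d) * sphere_weight d) = (\<lambda>d. real d * sphere_weight d + sphere_weight d)" by (auto simp: algebra_simps)
  then have "bform (\<lambda>Z. det Z * h Z) (\<lambda>Z. det Z * g Z)
      = - fischer (\<lambda>d. real d * sphere_weight d + sphere_weight d) (\<lambda>Z. (of_nat e + 2) * h Z) g"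
    using hp by (simp add: bform_det_mult[OF _ g(2)] l)
  also have "\<dots> = - ((of_nat e + 2) * ((of_nat e + 1) * fischer sphere_weight h g))"
    unfolding fischer_cmult_left[OF hp(1)] fischer_weight_add fischer_hom[OF h(1)]
    by (simp add: algebra_simps)
  finally have "bform (\<lambda>Z. det Z * h Z) (\<lambda>Z. det Z * g Z)
      = - ((of_nat e + 2) * ((of_nat e + 1) * fischer sphere_weight h g))" .
  moreover have "sph (\<lambda>X. (det X * h X) * cnj (det X * g X)) = sph (\<lambda>X. h X * cnj (g X))"
    by (rule sph_cong) (simp add: S3_def)
  ultimately show ?thesis by (simp add: integral_S3_harmonic[OF h g])
qed

lemma phi1_hom:
  assumes "(l, m, n) \<in> idx1"
  obtains d where "2 * l = real d" "phi1 l m n \<in> hom d"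
proof -
  from phi1_eq[OF assms] obtain c1 c2 r where
    "phi1 l m n = matrix_coeff c1 c2 r" "2 * l = real (c1 + c2)" .
  then show ?thesis using that[of "c1 + c2"] matrix_coeff_hom by simp
qed

lemma bform_phi1:
  assumes i: "(l, m, n) \<in> idx1" and j: "(l', m', n') \<in> idx1"
  shows "bform (phi1 l m n) (phi1 l' m' n') = of_real (2 * l * (2 * l + 1) / (2 * pi\<^sup>2)) *
    sph (\<lambda>X. phi1 l m n X * cnj (phi1 l' m' n' X))"
proof -
  from phi1_hom[OF i] obtain d where d: "2 * l = real d" "phi1 l m n \<in> hom d" .
  from phi1_hom[OF j] obtain d' where d': "2 * l' = real d'" "phi1 l' m' n' \<in> hom d'" .
  show ?thesis using bform_harmonic[OF d(2) phi1_harmonic[OF i] d'(2) phi1_harmonic[OF j]]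
    unfolding d(1) .
qed

lemma bform_phi2:
  assumes i: "(l, m, n) \<in> idx2" and j: "(l', m', n') \<in> idx2"
  shows "bform (phi2 l m n) (phi2 l' m' n') = - of_real (2 * l * (2 * l - 1) / (2 * pi\<^sup>2)) *
    sph (\<lambda>X. phi2 l m n X * cnj (phi2 l' m' n' X))"
proof -
  note i = i[unfolded idx2_iff] and j = j[unfolded idx2_iff]
  from phi1_hom[OF i] obtain d where d: "2 * (l - 1) = real d" "phi1 (l - 1) m n \<in> hom d" .
  from phi1_hom[OF j] obtain d' where d': "2 * (l' - 1) = real d'" "phi1 (l' - 1) m' n' \<in> hom d'" .
  have l': "2 * l = real d + 2" using d(1) by simp
  have l: "2 * l * (2 * l - 1) = (real d + 2) * (real d + 1)" unfolding l' by simp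
  show ?thesis using bform_det_harmonic[OF d(2) phi1_harmonic[OF i] d'(2) phi1_harmonic[OF j]]
    unfolding phi2_eq_phi1 l .
qed

lemma bform_phi1_phi2:
  assumes i: "(l, m, n) \<in> idx1" and j: "(l', m', n') \<in> idx2"
  shows "bform (phi1 l m n) (phi2 l' m' n') = 0" "bform (phi2 l' m' n') (phi1 l m n) = 0"
proof -
  note h = phi1_harmonic[OF i] phi1_harmonic[OF j[unfolded idx2_iff]]
  show 0: "bform (phi1 l m n) (phi2 l' m' n') = 0"
    unfolding phi2_eq_phi1 by (subst bform_det_mult) (use h in \<open>auto simp: harmonic_def\<close>)
  have "phi1 l m n \<in> polys" "phi2 l' m' n' \<in> polys"
    using h unfolding phi2_eq_phi1 harmonic_def by auto
  from bform_sym[OF this] show "bform (phi2 l' m' n') (phi1 l m n) = 0" by (simp add: 0)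
qed

section \<open>The pseudounitary structure on biharmonic polynomials\<close>

lemma constants_UNIV: "constants UNIV = {\<lambda>Z. c | c. True}"
  by (auto simp: constants_def)

lemma hermitian_bform: "hermitian_form biharmonic bform"
  unfolding hermitian_form_def biharmonic_def by (auto intro: bform_sym)

lemma lie_const: "lie Y (\<lambda>Z. c) = (\<lambda>Z. 0)"
  by (simp add: lie_def fun_eq_iff)

lemma rho'_biharmonic: "f \<in> biharmonic \<Longrightarrow> rho' UNIV Y f = lie Y f"
  by (intro rho'_polys) (simp add: biharmonic_def)

lemma pseudounitary_biharmonic: "pseudounitary UNIV biharmonic bform"
  unfolding pseudounitary_def
proof (intro conjI)
  show "rho'_stable UNIV biharmonic"
    by (auto simp: rho'_stable_def rho'_biharmonic biharmonic_lie)
  show "rho'_stable UNIV (constants UNIV)"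
    by (auto simp: rho'_stable_def constants_UNIV rho'_polys lie_const)
  show "hermitian_form biharmonic bform" by (rule hermitian_bform)
  have "(\<lambda>Z. ent Z (1,1)) \<in> biharmonic" "(\<lambda>Z. det Z) \<in> biharmonic"
    using det_mult_biharmonic[of "\<lambda>Z. 1"]
    by (simp_all add: biharmonic_def laplacian_def pdiff_ent harmonic_def)
  then show "indefinite_form biharmonic bform"
    unfolding indefinite_form_def
    by (intro conjI bexI[of _ "\<lambda>Z. ent Z (1,1)"] bexI[of _ "\<lambda>Z. det Z"]) (simp_all add: bform_ent bform_det)
  show "u22_invariant UNIV biharmonic bform"
    by (auto simp: u22_invariant_def rho'_biharmonic bform_u22)
  show "descends_nondegenerate biharmonic (constants UNIV) bform"
  proof (rule descends_nondegenerateI[OF hermitian_bform])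
    show "f \<in> constants UNIV" if "f \<in> biharmonic" "\<And>g. g \<in> biharmonic \<Longrightarrow> bform f g = 0" for f
      using bform_radical[OF that] by (simp add: constants_UNIV)
  qed (auto simp: constants_UNIV biharmonic_const biharmonic_diff bform_const_left biharmonic_def)
qed

section \<open>Transport along inversion\<close>

lemma matrix_inv_matrix_inv: "invertible (A :: 'a::field^'n^'n) \<Longrightarrow> matrix_inv (matrix_inv A) = A"
  by (intro matrix_inv_eqI matrix_inv_mult)

lemma invertible_matrix_inv: "invertible (A :: 'a::field^'n^'n) \<Longrightarrow> invertible (matrix_inv A)"
  using matrix_inv_mult[of A] unfolding invertible_def by blast

text \<open>Every matrix is a limit of invertible ones, of the form \<open>Z + t\<close>.\<close>

lemma polys_eq_0_on_GL2:
  assumes h: "h \<in> polys" and 0: "\<And>Z. Z \<in> GL2 \<Longrightarrow> h Z = 0"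
  shows "h Z = 0"
proof (rule ccontr)
  assume nz: "h Z \<noteq> 0"
  let ?p = "\<lambda>t :: real. Z + t *\<^sub>R mat 1"
  have "isCont (\<lambda>t. h (?p t)) 0"
    using continuous_on_compose2[OF polys_continuous[OF h], of UNIV ?p]
    by (simp add: continuous_on_eq_continuous_at continuous_intros)
  then have "\<forall>\<^sub>F t in nhds 0. h (?p t) \<noteq> 0"
    unfolding isCont_def using nz
    by (intro tendsto_imp_eventually_ne[OF tendsto_at_iff_tendsto_nhds[THEN iffD1]]) auto
  then obtain e where e: "e > 0" "\<And>t. \<bar>t\<bar> < e \<Longrightarrow> h (?p t) \<noteq> 0"
    unfolding eventually_nhds_metric by (auto simp: dist_real_def)
  define s where "s = e / 4"
  have "det (?p t) = 0" if "\<bar>t\<bar> < e" for t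
    using 0[of "?p t"] e(2)[OF that] by (auto simp: GL2_def)
  then have d: "det (?p s) = 0" "det (?p (2 * s)) = 0" "det (?p (3 * s)) = 0"
    using e(1) by (auto simp: s_def)
  have det: "det (?p t) = of_real t ^ 2 + of_real t * (Z$1$1 + Z$2$2) + det Z" for t
    by (simp add: det_2 mat_def scaleR_conv_of_real[where 'a = complex] power2_eq_square algebra_simps)
  \<comment> \<open>the determinant is a monic quadratic polynomial in \<open>t\<close>, whose second difference is \<open>2 * s\<^sup>2\<close>\<close>
  have "det (?p (3 * s)) - 2 * det (?p (2 * s)) + det (?p s) = 2 * of_real s ^ 2"
    unfolding det by (simp add: power2_eq_square algebra_simps)
  then have "s = 0" unfolding d by simp
  then show False using e(1) by (simp add: s_def)
qed

lemma inj_pullback_inv: "inj_on pullback_inv polys"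
proof (rule inj_onI)
  fix f g assume f: "f \<in> polys" and g: "g \<in> polys" and eq: "pullback_inv f = pullback_inv g"
  have "f Z - g Z = 0" if "Z \<in> GL2" for Z
  proof -
    have "invertible Z" using that by (simp add: GL2_invertible)
    then show ?thesis
      using fun_cong[OF eq, of "matrix_inv Z"]
      by (simp add: pullback_inv_def GL2_invertible invertible_matrix_inv matrix_inv_matrix_inv)
  qed
  then have "f Z - g Z = 0" for Z
    by (rule polys_eq_0_on_GL2[OF polys_diff[OF f g]])
  then show "f = g" by auto
qed

lemma pullback_inv_linear:
  "pullback_inv (\<lambda>Z. a * f Z + b * g Z) = (\<lambda>Z. a * pullback_inv f Z + b * pullback_inv g Z)"
  "pullback_inv (\<lambda>Z. f Z + g Z) = (\<lambda>Z. pullback_inv f Z + pullback_inv g Z)"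
  "pullback_inv (\<lambda>Z. f Z - g Z) = (\<lambda>Z. pullback_inv f Z - pullback_inv g Z)"
  "pullback_inv (\<lambda>Z. a * f Z) = (\<lambda>Z. a * pullback_inv f Z)"
  "pullback_inv (\<lambda>Z. 0) = (\<lambda>Z. 0)"
  by (auto simp: pullback_inv_def)

lemma cspan_pullback_inv: "cspan (pullback_inv ` S) = pullback_inv ` cspan S"
proof
  show "cspan (pullback_inv ` S) \<subseteq> pullback_inv ` cspan S"
  proof (rule cspan_least)
    show "pullback_inv ` S \<subseteq> pullback_inv ` cspan S" using cspan_superset by blast
    show "(\<lambda>Z. 0) \<in> pullback_inv ` cspan S"
      using cspan_0 by (intro image_eqI[of _ _ "\<lambda>Z. 0"]) (simp_all add: pullback_inv_linear)
    show "(\<lambda>Z. f Z + g Z) \<in> pullback_inv ` cspan S" if "f \<in> pullback_inv ` cspan S" "g \<in> pullback_inv ` cspan S" for f g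
      using that by (auto simp: pullback_inv_linear(2)[symmetric] intro: cspan_add)
    show "(\<lambda>Z. c * f Z) \<in> pullback_inv ` cspan S" if "f \<in> pullback_inv ` cspan S" for c f
      using that by (auto simp: pullback_inv_linear(4)[symmetric] intro: cspan_cmult)
  qed
  have "cspan S \<subseteq> {f. pullback_inv f \<in> cspan (pullback_inv ` S)}"
    by (rule cspan_least) (auto simp: pullback_inv_linear intro: cspan_superset cspan_0 cspan_add cspan_cmult)
  then show "pullback_inv ` cspan S \<subseteq> cspan (pullback_inv ` S)" by auto
qed

lemma phi1'_eq: "phi1' l m n = pullback_inv (phi1 l n m)"
  by (auto simp: phi1'_def pullback_inv_def phi1_def)

lemma phi2'_eq: "phi2' l m n = pullback_inv (phi2 l n m)"
proof
  fix Z
  have "det (matrix_inv Z) = inverse (det Z)" if "Z \<in> GL2"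
  proof -
    have "det Z * det (matrix_inv Z) = 1"
      using that matrix_inv_mult(1)[of Z] by (simp add: GL2_invertible flip: det_mul)
    then show ?thesis by (metis inverse_unique)
  qed
  then show "phi2' l m n Z = pullback_inv (phi2 l n m) Z"
    by (simp add: phi2'_def pullback_inv_def phi2_def)
qed

lemma idx_sym: "(l, m, n) \<in> idx1 \<longleftrightarrow> (l, n, m) \<in> idx1" "(l, m, n) \<in> idx2 \<longleftrightarrow> (l, n, m) \<in> idx2"
  by (auto simp: idx1_def idx2_def)

lemma BHminus_eq: "BHminus = pullback_inv ` biharmonic"
proof -
  have "{F l n m | l m n. (l, m, n) \<in> I} = {F l m n | l m n. (l, m, n) \<in> I}"
    if "\<And>l m n. (l, m, n) \<in> I \<longleftrightarrow> (l, n, m) \<in> I" for F :: "real \<Rightarrow> real \<Rightarrow> real \<Rightarrow> hc \<Rightarrow> complex" and I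
    using that by blast
  note swap = this[of idx1 "\<lambda>l m n. pullback_inv (phi1 l m n)", OF idx_sym(1)]
    this[of idx2 "\<lambda>l m n. pullback_inv (phi2 l m n)", OF idx_sym(2)]
  have image: "pullback_inv ` {F l m n | l m n. (l, m, n) \<in> I} = {pullback_inv (F l m n) | l m n. (l, m, n) \<in> I}"
    for F :: "real \<Rightarrow> real \<Rightarrow> real \<Rightarrow> hc \<Rightarrow> complex" and I by blast
  show ?thesis
    unfolding BHplus_eq[symmetric] BHminus_def BHplus_def phi1'_eq phi2'_eq cspan_pullback_inv[symmetric]
      image_Un image swap ..
qed

definition bform_minus :: form where
  "bform_minus f g = bform (inv_into polys pullback_inv f) (inv_into polys pullback_inv g)"

lemma bform_minus_pullback:
  "f \<in> polys \<Longrightarrow> g \<in> polys \<Longrightarrow> bform_minus (pullback_inv f) (pullback_inv g) = bform f g"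
  by (simp add: bform_minus_def inv_into_f_f[OF inj_pullback_inv])

lemma biharmonic_polys: "f \<in> biharmonic \<Longrightarrow> f \<in> polys"
  by (simp add: biharmonic_def)

lemma pullback_inv_const: "pullback_inv (\<lambda>Z. c) = (\<lambda>Z. if Z \<in> GL2 then c else 0)"
  by (simp add: pullback_inv_def fun_eq_iff)

lemma constants_GL2: "constants GL2 = pullback_inv ` constants UNIV"
  unfolding constants_UNIV by (auto simp: constants_def simp flip: pullback_inv_const)

lemma pseudounitary_BHminus: "pseudounitary GL2 BHminus bform_minus"
proof -
  let ?P = "pullback_inv"
  note P = pseudounitary_biharmonic[unfolded pseudounitary_def]
  note mp = bform_minus_pullback[OF biharmonic_polys biharmonic_polys]
  have cb: "(\<lambda>Z. c) \<in> biharmonic" for c by (rule biharmonic_const)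
  have cg: "f \<in> constants GL2 \<longleftrightarrow> (\<exists>c. f = ?P (\<lambda>Z. c))" for f
    by (auto simp: constants_GL2 constants_UNIV)
  have E: "\<exists>h. h \<in> biharmonic \<and> f = ?P h" if "f \<in> BHminus" for f
    using that unfolding BHminus_eq by (rule imageE) blast
  have I: "?P h \<in> BHminus" if "h \<in> biharmonic" for h
    using that unfolding BHminus_eq by (rule imageI)
  have rho: "rho' GL2 Y (?P h) = ?P (lie (block_swap Y) h)" if "h \<in> biharmonic" for Y h
    using that by (simp only: rho'_pullback_inv rho'_biharmonic biharmonic_polys)
  have H: "hermitian_form BHminus bform_minus"
    unfolding hermitian_form_def
  proof (intro conjI allI ballI)
    fix a b f g h assume "f \<in> BHminus" "g \<in> BHminus" "h \<in> BHminus"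
    then obtain f' g' h' where *: "f' \<in> biharmonic" "g' \<in> biharmonic" "h' \<in> biharmonic"
      "f = ?P f'" "g = ?P g'" "h = ?P h'" using E by meson
    have "(\<lambda>Z. a * f' Z + b * g' Z) \<in> biharmonic" by (intro biharmonic_add biharmonic_cmult *)
    then have "bform_minus (?P (\<lambda>Z. a * f' Z + b * g' Z)) (?P h') = bform (\<lambda>Z. a * f' Z + b * g' Z) h'"
      using *(3) by (rule mp)
    also have "\<dots> = a * bform f' h' + b * bform g' h'"
      using * by (simp add: biharmonic_polys)
    finally show "bform_minus (\<lambda>Z. a * f Z + b * g Z) h = a * bform_minus f h + b * bform_minus g h"
      by (simp only: * pullback_inv_linear(1) mp)
  next
    fix f g assume "f \<in> BHminus" "g \<in> BHminus"
    then obtain f' g' where *: "f' \<in> biharmonic" "g' \<in> biharmonic" "f = ?P f'" "g = ?P g'" using E by meson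
    show "bform_minus g f = cnj (bform_minus f g)"
      unfolding *(3,4) mp[OF *(1,2)] mp[OF *(2,1)] by (rule bform_sym) (use * in \<open>simp_all add: biharmonic_polys\<close>)
  qed
  show ?thesis
    unfolding pseudounitary_def
  proof (intro conjI)
    show "rho'_stable GL2 BHminus"
      unfolding rho'_stable_def
    proof (intro allI ballI)
      fix Y f assume "f \<in> BHminus"
      then obtain h where h: "h \<in> biharmonic" "f = ?P h" using E by blast
      show "rho' GL2 Y f \<in> BHminus" unfolding h(2) rho[OF h(1)] by (intro I biharmonic_lie h)
    qed
    show "rho'_stable GL2 (constants GL2)"
      unfolding rho'_stable_def
    proof (intro allI ballI)
      fix Y f assume "f \<in> constants GL2"
      then obtain c where h: "f = ?P (\<lambda>Z. c)" using cg by blast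
      show "rho' GL2 Y f \<in> constants GL2" unfolding h rho[OF cb] lie_const cg by (rule exI) (rule refl)
    qed
    show "hermitian_form BHminus bform_minus" by (rule H)
    obtain f g where "f \<in> biharmonic" "Re (bform f f) > 0" "g \<in> biharmonic" "Re (bform g g) < 0"
      using P unfolding indefinite_form_def by blast
    then show "indefinite_form BHminus bform_minus"
      unfolding indefinite_form_def
      by (intro conjI bexI[of _ "?P f"] bexI[of _ "?P g"] I) (simp_all only: mp)
    show "u22_invariant GL2 BHminus bform_minus"
      unfolding u22_invariant_def
    proof (intro ballI)
      fix Y f g assume Y: "Y \<in> u22" and "f \<in> BHminus" "g \<in> BHminus"
      then obtain f' g' where *: "f' \<in> biharmonic" "g' \<in> biharmonic" "f = ?P f'" "g = ?P g'" using E by meson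
      show "bform_minus (rho' GL2 Y f) g + bform_minus f (rho' GL2 Y g) = 0"
        unfolding *(3,4) rho[OF *(1)] rho[OF *(2)] mp[OF biharmonic_lie[OF *(1)] *(2)] mp[OF *(1) biharmonic_lie[OF *(2)]]
        by (rule bform_u22[OF *(1,2) block_swap_u22[OF Y]])
    qed
    show "descends_nondegenerate BHminus (constants GL2) bform_minus"
    proof (rule descends_nondegenerateI[OF H])
      show "constants GL2 \<subseteq> BHminus" using I[OF cb] by (auto simp: cg)
      show "(\<lambda>Z. 0) \<in> constants GL2" unfolding cg by (rule exI[of _ 0]) (simp add: pullback_inv_const)
      show "(\<lambda>Z. f Z - g Z) \<in> BHminus" if fg: "f \<in> BHminus" "g \<in> BHminus" for f g
      proof -
        obtain f' g' where *: "f' \<in> biharmonic" "g' \<in> biharmonic" "f = ?P f'" "g = ?P g'" using E fg by meson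
        show ?thesis unfolding *(3,4) pullback_inv_linear(3)[symmetric] by (intro I biharmonic_diff *)
      qed
      show "(\<lambda>Z. f Z - g Z) \<in> constants GL2" if fg: "f \<in> constants GL2" "g \<in> constants GL2" for f g
      proof -
        obtain a b where "f = ?P (\<lambda>Z. a)" "g = ?P (\<lambda>Z. b)" using fg cg by meson
        then have "(\<lambda>Z. f Z - g Z) = ?P (\<lambda>Z. a - b)" by (simp only: pullback_inv_linear(3))
        then show ?thesis unfolding cg by blast
      qed
      show "bform_minus f g = 0" if fg: "f \<in> constants GL2" "g \<in> BHminus" for f g
      proof -
        obtain c g' where *: "f = ?P (\<lambda>Z. c)" "g' \<in> biharmonic" "g = ?P g'" using fg cg E by meson
        show ?thesis unfolding *(1,3) mp[OF cb *(2)] by (rule bform_const_left[OF biharmonic_polys[OF *(2)]])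
      qed
      show "f \<in> constants GL2" if f: "f \<in> BHminus" and 0: "\<And>g. g \<in> BHminus \<Longrightarrow> bform_minus f g = 0" for f
      proof -
        obtain h where h: "h \<in> biharmonic" "f = ?P h" using E f by blast
        have "bform h g = 0" if "g \<in> biharmonic" for g
          using 0[OF I[OF that]] unfolding h(2) mp[OF h(1) that] .
        then have "\<exists>c. h = (\<lambda>Z. c)" by (rule bform_radical[OF h(1)])
        then show ?thesis unfolding cg h(2) by blast
      qed
    qed
  qed
qed

lemma matrix_inv_S3: "X \<in> S3 \<Longrightarrow> matrix_inv X = adj X"
proof (rule matrix_inv_eqI)
  assume X: "X \<in> S3"
  then have q: "X$2$2 = cnj (X$1$1)" "X$2$1 = - cnj (X$1$2)" "X$1$1 * X$2$2 - X$1$2 * X$2$1 = 1"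
    by (auto simp: S3_def quaternions_iff det_2)
  show "X ** adj X = mat 1"
    using q(3) unfolding q(1,2)
    by (simp add: matrix_matrix_mult_def adj_def mat_def vec_eq_iff forall_2 sum_2 q(1,2) algebra_simps)
qed

text \<open>On the sphere the inverse is the adjoint, which is orthogonal in Euclidean coordinates.\<close>

lemma sph_pullback_inv:
  assumes f: "f \<in> polys" and g: "g \<in> polys"
  shows "sph (\<lambda>X. pullback_inv f X * cnj (pullback_inv g X)) = sph (\<lambda>X. f X * cnj (g X))"
proof -
  have "sph (\<lambda>X. pullback_inv f X * cnj (pullback_inv g X)) = sph (\<lambda>X. f (adj X) * cnj (g (adj X)))"
    by (rule sph_cong) (auto simp: pullback_inv_def matrix_inv_S3 GL2_def S3_def)
  also have "\<dots> = sph (\<lambda>X. f X * cnj (g X))"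
  proof (rule sph_adj)
    show "(\<lambda>X. f X * cnj (g X)) \<in> borel_measurable borel"
      by (intro borel_measurable_continuous_onI continuous_intros polys_continuous f g)
  qed
  finally show ?thesis .
qed

lemma phi_polys: "(l, m, n) \<in> idx1 \<Longrightarrow> phi1 l m n \<in> polys" "(l, m, n) \<in> idx2 \<Longrightarrow> phi2 l m n \<in> polys"
  using phi1_harmonic unfolding phi2_eq_phi1 idx2_iff harmonic_def by auto

theorem theorem12:
  shows
   "(\<exists>B. pseudounitary UNIV BHplus B \<and>
       (\<forall>l m n l' m' n'. (l, m, n) \<in> idx1 \<longrightarrow> (l', m', n') \<in> idx1 \<longrightarrow>
          B (phi1 l m n) (phi1 l' m' n') =
            of_real (2 * l * (2 * l + 1) / (2 * pi\<^sup>2)) *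
            (LINT X:S3|dS. phi1 l m n X * cnj (phi1 l' m' n' X))) \<and>
       (\<forall>l m n l' m' n'. (l, m, n) \<in> idx2 \<longrightarrow> (l', m', n') \<in> idx2 \<longrightarrow>
          B (phi2 l m n) (phi2 l' m' n') =
            - of_real (2 * l * (2 * l - 1) / (2 * pi\<^sup>2)) *
            (LINT X:S3|dS. phi2 l m n X * cnj (phi2 l' m' n' X))) \<and>
       (\<forall>l m n l' m' n'. (l, m, n) \<in> idx1 \<longrightarrow> (l', m', n') \<in> idx2 \<longrightarrow>
          B (phi1 l m n) (phi2 l' m' n') = 0 \<and> B (phi2 l' m' n') (phi1 l m n) = 0)) \<and>
    (\<exists>B. pseudounitary GL2 BHminus B \<and>
       (\<forall>l m n l' m' n'. (l, m, n) \<in> idx1 \<longrightarrow> (l', m', n') \<in> idx1 \<longrightarrow>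
          B (phi1' l m n) (phi1' l' m' n') =
            of_real (2 * l * (2 * l + 1) / (2 * pi\<^sup>2)) *
            (LINT X:S3|dS. phi1' l m n X * cnj (phi1' l' m' n' X))) \<and>
       (\<forall>l m n l' m' n'. (l, m, n) \<in> idx2 \<longrightarrow> (l', m', n') \<in> idx2 \<longrightarrow>
          B (phi2' l m n) (phi2' l' m' n') =
            - of_real (2 * l * (2 * l - 1) / (2 * pi\<^sup>2)) *
            (LINT X:S3|dS. phi2' l m n X * cnj (phi2' l' m' n' X))) \<and>
       (\<forall>l m n l' m' n'. (l, m, n) \<in> idx1 \<longrightarrow> (l', m', n') \<in> idx2 \<longrightarrow>
          B (phi1' l m n) (phi2' l' m' n') = 0 \<and> B (phi2' l' m' n') (phi1' l m n) = 0))"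
proof (rule conjI; rule exI; intro conjI allI impI)
  show "pseudounitary UNIV BHplus bform"
    unfolding BHplus_eq by (rule pseudounitary_biharmonic)
  show "pseudounitary GL2 BHminus bform_minus" by (rule pseudounitary_BHminus)
  fix l m n l' m' n' :: real
  note bform_minus_pullback[simp] sph_pullback_inv[simp] phi_polys[simp]
  {
    assume i: "(l, m, n) \<in> idx1" "(l', m', n') \<in> idx1"
    show "bform (phi1 l m n) (phi1 l' m' n') = of_real (2 * l * (2 * l + 1) / (2 * pi\<^sup>2)) *
        (LINT X:S3|dS. phi1 l m n X * cnj (phi1 l' m' n' X))"
      using bform_phi1[OF i] unfolding sph_def .
    show "bform_minus (phi1' l m n) (phi1' l' m' n') = of_real (2 * l * (2 * l + 1) / (2 * pi\<^sup>2)) *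
        (LINT X:S3|dS. phi1' l m n X * cnj (phi1' l' m' n' X))"
      using bform_phi1[OF i[unfolded idx_sym(1)[of _ m] idx_sym(1)[of _ m']]] i
      unfolding sph_def[symmetric] phi1'_eq by (simp add: idx_sym(1))
  next
    assume i: "(l, m, n) \<in> idx2" "(l', m', n') \<in> idx2"
    show "bform (phi2 l m n) (phi2 l' m' n') = - of_real (2 * l * (2 * l - 1) / (2 * pi\<^sup>2)) *
        (LINT X:S3|dS. phi2 l m n X * cnj (phi2 l' m' n' X))"
      using bform_phi2[OF i] unfolding sph_def .
    show "bform_minus (phi2' l m n) (phi2' l' m' n') = - of_real (2 * l * (2 * l - 1) / (2 * pi\<^sup>2)) *
        (LINT X:S3|dS. phi2' l m n X * cnj (phi2' l' m' n' X))"
      using bform_phi2[OF i[unfolded idx_sym(2)[of _ m] idx_sym(2)[of _ m']]] i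
      unfolding sph_def[symmetric] phi2'_eq by (simp add: idx_sym(2))
  next
    assume i: "(l, m, n) \<in> idx1" "(l', m', n') \<in> idx2"
    then have i': "(l, n, m) \<in> idx1" "(l', n', m') \<in> idx2" by (simp_all add: idx_sym)
    show "bform (phi1 l m n) (phi2 l' m' n') = 0" "bform (phi2 l' m' n') (phi1 l m n) = 0"
      using bform_phi1_phi2[OF i] by auto
    show "bform_minus (phi1' l m n) (phi2' l' m' n') = 0" "bform_minus (phi2' l' m' n') (phi1' l m n) = 0"
      using bform_phi1_phi2[OF i'] i' by (simp_all add: phi1'_eq phi2'_eq)
  }
qed

end
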